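(* Let $T>0$, let $u_0\in H$, and let $u$ be a weak solution on $(0,T)\times\mathbb{T}^3$ to the incompressible Euler equations $$\partial_t u+(u\cdot\nabla)u+\nabla p=0,\qquad \operatorname{div}u=0,\qquad u(0,x)=u_0(x).$$ Assume that $u$ is a Beltrami field, i.e. there is a scalar function $\lambda=\lambda(t,x)$ on $(0,T)\times\mathbb{T}^3$ such that $$\nabla\times u(t,x)=\lambda(t,x)\,u(t,x).$$ Assume further that one of the following holds: (i) $\lambda\in L^\beta(0,T;H^\tau(\mathbb{T}^3))$ for some $\frac12<\tau\le\frac32$ and some $\beta>\frac{5}{2\tau-1}$; or (ii) $\lambda\in L^{5/2}(0,T;H^\tau(\mathbb{T}^3))$ for some $\tau>\frac32$. Then the kinetic energy is conserved, that is, $\|u(t)\|_{L^2(\mathbb{T}^3)}=\|u_0\|_{L^2(\mathbb{T}^3)}$ for a.e. $t\in[0,T]$.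
   Context: $\mathbb{T}^3=\mathbb{R}^3/\mathbb{Z}^3$ is the three-dimensional torus. $(\cdot,\cdot)$ is the scalar product of $L^2(\mathbb{T}^3)$ (for vector- or matrix-valued functions as appropriate). $H$ is the closure in $L^2(\mathbb{T}^3)$ of the smooth, periodic, divergence-free, zero-mean vector fields $\mathbb{T}^3\to\mathbb{R}^3$. Weak solution: given $u_0\in H$, a measurable function $u:(0,T)\times\mathbb{T}^3\to\mathbb{R}^3$ is a weak solution to the Euler equations with initial datum $u_0$ if $u\in L^\infty(0,T;H)$ and $$\int_0^T\big[(u,\partial_t\varphi)+(u\otimes u,\nabla\varphi)\big]\,dt=-(u_0,\varphi(0))$$ for all $\varphi\in\mathcal{D}_T=\{\varphi\in C_0^\infty([0,T);C^\infty(\mathbb{T}^3)):\ \nabla\cdot\varphi=0\}$ (vector-valued test functions, compactly supported in time in $[0,T)$). The curl $\nabla\times u$ is taken in the sense of distributions in $x$, and the Beltrami relation holds for a.e. $t$ as an identity of distributions on $\mathbb{T}^3$. Sobolev spaces: $H^\tau(\mathbb{T}^3)=W^{\tau,2}(\mathbb{T}^3)$. For a non-negative integer $\tau=k$ this is the usual Sobolev space; for $\tau=k+\theta$ with $k\in\mathbb{N}_0$, $\theta\in(0,1)$, its norm is $\|v\|_{W^{k,2}}+\sum_{|r|=k}[\partial_r v]_{W^{\theta,2}}$, where $[v]_{W^{\theta,2}}=\Big(\int_{\mathbb{T}^3}\int_{\mathbb{T}^3}\frac{|v(x)-v(y)|^2}{|x-y|^{3+2\theta}}\,dx\,dy\Big)^{1/2}$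 (with $|x-y|$ the distance on the torus). $L^q(0,T;X)$ denotes the Bochner space of measurable functions with $\|v(\cdot)\|_X\in L^q(0,T)$. *)

theory Defs
  imports "HOL-Analysis.Analysis"
begin

section \<open>Functions on the torus\<close>

text \<open>
  A function on the torus \<open>\<real>\<^sup>3 / \<int>\<^sup>3\<close> is represented by a \<open>\<int>\<^sup>3\<close>-periodic function on
  \<open>\<real>\<^sup>3\<close>; integration over the torus is integration over the unit cube.  The closed cube
  differs from a fundamental domain by a null set only.
\<close>

definition periodic :: "(real^3 \<Rightarrow> 'a) \<Rightarrow> bool" where
  "periodic f \<longleftrightarrow> (\<forall>x i. f (x + axis i 1) = f x)"

definition torus :: "(real^3) measure" where
  "torus = lebesgue_on (cbox 0 1)"

definition torus_dist :: "real^3 \<Rightarrow> real^3 \<Rightarrow> real" where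
  "torus_dist x y = infdist (x - y) {k. \<forall>i. k $ i \<in> \<int>}"

definition L2_torus :: "(real^3 \<Rightarrow> 'a::euclidean_space) set" where
  "L2_torus = {f. periodic f \<and> f \<in> borel_measurable lebesgue \<and>
                  integrable torus (\<lambda>x. (norm (f x))\<^sup>2)}"

definition inner_L2 :: "(real^3 \<Rightarrow> 'a::euclidean_space) \<Rightarrow> (real^3 \<Rightarrow> 'a) \<Rightarrow> real" where
  "inner_L2 f g = (LINT x|torus. f x \<bullet> g x)"

definition norm_L2 :: "(real^3 \<Rightarrow> 'a::euclidean_space) \<Rightarrow> real" where
  "norm_L2 f = sqrt (LINT x|torus. (norm (f x))\<^sup>2)"


section \<open>Smooth functions and classical differential operators\<close>

text \<open>
  Iterated directional derivatives, taken within \<open>S\<close>.  The derivative within \<open>S\<close> is unique for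
  the two domains used below, \<open>UNIV\<close> and \<open>{0..<T} \<times> UNIV\<close>; in the latter case it is one-sided
  in time at time \<open>0\<close>.
\<close>

definition iter_deriv ::
    "'a::euclidean_space set \<Rightarrow> 'a list \<Rightarrow> ('a \<Rightarrow> 'b::euclidean_space) \<Rightarrow> 'a \<Rightarrow> 'b" where
  "iter_deriv S vs f = foldr (\<lambda>v g x. frechet_derivative g (at x within S) v) vs f"

text \<open>
  \<open>C\<^sup>\<infinity>\<close>: differentiability of all iterated derivatives already entails their continuity.
\<close>

definition smooth_on :: "'a::euclidean_space set \<Rightarrow> ('a \<Rightarrow> 'b::euclidean_space) \<Rightarrow> bool" where
  "smooth_on S f \<longleftrightarrow> (\<forall>vs. iter_deriv S vs f differentiable_on S)"

definition partial :: "3 \<Rightarrow> (real^3 \<Rightarrow> 'a::euclidean_space) \<Rightarrow> real^3 \<Rightarrow> 'a" where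
  "partial i f x = frechet_derivative f (at x) (axis i 1)"

definition grad :: "(real^3 \<Rightarrow> real^3) \<Rightarrow> real^3 \<Rightarrow> real^3^3" where
  "grad f x = (\<chi> i j. partial i f x $ j)"

definition divergence :: "(real^3 \<Rightarrow> real^3) \<Rightarrow> real^3 \<Rightarrow> real" where
  "divergence f x = (\<Sum>i\<in>UNIV. partial i f x $ i)"

definition curl :: "(real^3 \<Rightarrow> real^3) \<Rightarrow> real^3 \<Rightarrow> real^3" where
  "curl f x = vector [partial 2 f x $ 3 - partial 3 f x $ 2,
                      partial 3 f x $ 1 - partial 1 f x $ 3,
                      partial 1 f x $ 2 - partial 2 f x $ 1]"

definition tensor :: "real^3 \<Rightarrow> real^3 \<Rightarrow> real^3^3" where
  "tensor a b = (\<chi> i j. a $ i * b $ j)"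


section \<open>The energy space and weak solutions of the Euler equations\<close>

definition solenoidal_smooth :: "(real^3 \<Rightarrow> real^3) set" where
  "solenoidal_smooth = {v. periodic v \<and> smooth_on UNIV v \<and> (\<forall>x. divergence v x = 0) \<and>
                           (LINT x|torus. v x) = 0}"

definition solenoidal_L2 :: "(real^3 \<Rightarrow> real^3) set" where
  "solenoidal_L2 = {f \<in> L2_torus. \<forall>\<epsilon>>0. \<exists>v\<in>solenoidal_smooth. norm_L2 (\<lambda>x. f x - v x) < \<epsilon>}"

definition measurable_space_time :: "real \<Rightarrow> (real \<Rightarrow> real^3 \<Rightarrow> 'a::euclidean_space) \<Rightarrow> bool" where
  "measurable_space_time T v \<longleftrightarrow>
     (\<forall>t\<in>{0<..<T}. periodic (v t)) \<and>
     (\<lambda>(t, x). v t x) \<in> borel_measurable (lebesgue_on ({0<..<T} \<times> UNIV))"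

text \<open>
  The Bochner spaces \<open>L\<^sup>q(0,T;X)\<close>, \<open>q < \<infinity>\<close>, and \<open>L\<^sup>\<infinity>(0,T;X)\<close> for a space \<open>X\<close> of functions on
  the torus with norm \<open>N\<close>.  Only separable \<open>X\<close> embedded in \<open>L\<^sup>2\<close> occur, for which strong
  measurability in time amounts to joint measurability in space-time.
\<close>

definition bochner_Lq ::
    "real \<Rightarrow> real \<Rightarrow> (real^3 \<Rightarrow> 'a::euclidean_space) set \<Rightarrow> ((real^3 \<Rightarrow> 'a) \<Rightarrow> real)
      \<Rightarrow> (real \<Rightarrow> real^3 \<Rightarrow> 'a) set" where
  "bochner_Lq T q X N = {v. measurable_space_time T v \<and>
      (AE t in lebesgue_on {0<..<T}. v t \<in> X) \<and>
      (\<lambda>t. N (v t)) \<in> borel_measurable (lebesgue_on {0<..<T}) \<and>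
      integrable (lebesgue_on {0<..<T}) (\<lambda>t. N (v t) powr q)}"

definition bochner_Linf ::
    "real \<Rightarrow> (real^3 \<Rightarrow> 'a::euclidean_space) set \<Rightarrow> ((real^3 \<Rightarrow> 'a) \<Rightarrow> real)
      \<Rightarrow> (real \<Rightarrow> real^3 \<Rightarrow> 'a) set" where
  "bochner_Linf T X N = {v. measurable_space_time T v \<and>
      (AE t in lebesgue_on {0<..<T}. v t \<in> X) \<and>
      (\<lambda>t. N (v t)) \<in> borel_measurable (lebesgue_on {0<..<T}) \<and>
      (\<exists>C. AE t in lebesgue_on {0<..<T}. N (v t) \<le> C)}"

text \<open>
  The class \<open>\<D>\<^sub>T\<close>; only the values of \<open>\<phi> t\<close> for \<open>t \<in> [0,T)\<close> matter.
\<close>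

definition euler_test_functions :: "real \<Rightarrow> (real \<Rightarrow> real^3 \<Rightarrow> real^3) set" where
  "euler_test_functions T = {\<phi>.
      smooth_on ({0..<T} \<times> UNIV) (\<lambda>(t, x). \<phi> t x) \<and>
      (\<forall>t\<in>{0..<T}. periodic (\<phi> t)) \<and>
      (\<exists>T'<T. \<forall>t\<in>{0..<T}. T' \<le> t \<longrightarrow> (\<forall>x. \<phi> t x = 0)) \<and>
      (\<forall>t\<in>{0..<T}. \<forall>x. divergence (\<phi> t) x = 0)}"

definition weak_euler_solution ::
    "real \<Rightarrow> (real^3 \<Rightarrow> real^3) \<Rightarrow> (real \<Rightarrow> real^3 \<Rightarrow> real^3) \<Rightarrow> bool" where
  "weak_euler_solution T u\<^sub>0 u \<longleftrightarrow>
     u \<in> bochner_Linf T solenoidal_L2 norm_L2 \<and>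
     (\<forall>\<phi>\<in>euler_test_functions T.
        (LINT t|lebesgue_on {0<..<T}.
            inner_L2 (u t) (\<lambda>x. vector_derivative (\<lambda>s. \<phi> s x) (at t)) +
            inner_L2 (\<lambda>x. tensor (u t x) (u t x)) (grad (\<phi> t)))
        = - inner_L2 u\<^sub>0 (\<phi> 0))"


section \<open>Weak derivatives and Beltrami fields\<close>

text \<open>
  \<open>w\<close> is the distributional curl of \<open>v\<close>, both being integrable and hence distributions.
  Tested against vector fields, the transpose of the curl is the curl itself.
\<close>

definition weak_curl :: "(real^3 \<Rightarrow> real^3) \<Rightarrow> (real^3 \<Rightarrow> real^3) \<Rightarrow> bool" where
  "weak_curl v w \<longleftrightarrow> integrable torus v \<and> integrable torus w \<and>
     (\<forall>\<psi>. periodic \<psi> \<and> smooth_on UNIV \<psi> \<longrightarrow> inner_L2 w \<psi> = inner_L2 v (curl \<psi>))"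

definition beltrami_field ::
    "real \<Rightarrow> (real \<Rightarrow> real^3 \<Rightarrow> real^3) \<Rightarrow> (real \<Rightarrow> real^3 \<Rightarrow> real) \<Rightarrow> bool" where
  "beltrami_field T u lam \<longleftrightarrow>
     (AE t in lebesgue_on {0<..<T}. weak_curl (u t) (\<lambda>x. lam t x *\<^sub>R u t x))"

definition multi_degree :: "nat^3 \<Rightarrow> nat" where
  "multi_degree r = (\<Sum>i\<in>UNIV. r $ i)"

definition multi_partial :: "nat^3 \<Rightarrow> (real^3 \<Rightarrow> real) \<Rightarrow> real^3 \<Rightarrow> real" where
  "multi_partial r \<psi> =
     (partial 1 ^^ (r $ 1)) ((partial 2 ^^ (r $ 2)) ((partial 3 ^^ (r $ 3)) \<psi>))"

text \<open>
  \<open>g\<close> is a square-integrable weak derivative of order \<open>r\<close> of \<open>f\<close>; it is unique up to null sets,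
  so the choice made in \<open>weak_partial\<close> is immaterial for integrals.
\<close>

definition is_weak_partial :: "nat^3 \<Rightarrow> (real^3 \<Rightarrow> real) \<Rightarrow> (real^3 \<Rightarrow> real) \<Rightarrow> bool" where
  "is_weak_partial r f g \<longleftrightarrow> g \<in> L2_torus \<and>
     (\<forall>\<psi>. periodic \<psi> \<and> smooth_on UNIV \<psi> \<longrightarrow>
        inner_L2 g \<psi> = (- 1) ^ multi_degree r * inner_L2 f (multi_partial r \<psi>))"

definition weak_partial :: "nat^3 \<Rightarrow> (real^3 \<Rightarrow> real) \<Rightarrow> real^3 \<Rightarrow> real" where
  "weak_partial r f = (SOME g. is_weak_partial r f g)"


section \<open>Sobolev spaces of real order on the torus\<close>

definition sobolev_int :: "nat \<Rightarrow> (real^3 \<Rightarrow> real) set" where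
  "sobolev_int k = {f \<in> L2_torus. \<forall>r. multi_degree r \<le> k \<longrightarrow> (\<exists>g. is_weak_partial r f g)}"

definition sobolev_int_norm :: "nat \<Rightarrow> (real^3 \<Rightarrow> real) \<Rightarrow> real" where
  "sobolev_int_norm k f =
     sqrt (\<Sum>r | multi_degree r \<le> k. (norm_L2 (weak_partial r f))\<^sup>2)"

text \<open>The square of the Gagliardo seminorm of order \<open>\<theta>\<close>.\<close>

definition gagliardo :: "real \<Rightarrow> (real^3 \<Rightarrow> real) \<Rightarrow> ennreal" where
  "gagliardo \<theta> f =
     (\<integral>\<^sup>+x. \<integral>\<^sup>+y. ennreal (\<bar>f x - f y\<bar>\<^sup>2 / torus_dist x y powr (3 + 2 * \<theta>)) \<partial>torus \<partial>torus)"

text \<open>The order \<open>\<tau> \<ge> 0\<close> is decomposed as \<open>\<tau> = k + \<theta>\<close> with \<open>k = \<lfloor>\<tau>\<rfloor>\<close> and \<open>\<theta> = frac \<tau>\<close>.\<close>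

definition sobolev :: "real \<Rightarrow> (real^3 \<Rightarrow> real) set" where
  "sobolev \<tau> = {f \<in> sobolev_int (nat \<lfloor>\<tau>\<rfloor>).
     \<tau> \<notin> \<int> \<longrightarrow>
       (\<forall>r. multi_degree r = nat \<lfloor>\<tau>\<rfloor> \<longrightarrow> gagliardo (frac \<tau>) (weak_partial r f) < \<infinity>)}"

definition sobolev_norm :: "real \<Rightarrow> (real^3 \<Rightarrow> real) \<Rightarrow> real" where
  "sobolev_norm \<tau> f = sobolev_int_norm (nat \<lfloor>\<tau>\<rfloor>) f +
     (if \<tau> \<in> \<int> then 0
      else \<Sum>r | multi_degree r = nat \<lfloor>\<tau>\<rfloor>.
             sqrt (enn2real (gagliardo (frac \<tau>) (weak_partial r f))))"

end

theory Submission
  imports Defs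
begin

text \<open>
  Formally \<open>(u \<cdot> \<nabla>) u = (\<nabla> \<times> u) \<times> u + \<nabla> (\<bar>u\<bar>\<^sup>2 / 2)\<close>.  For a Beltrami field the first term is
  \<open>\<lambda> u \<times> u = 0\<close>, so that the nonlinearity is a gradient and drops out against solenoidal test
  fields: the solution does not move, \<open>u(t) = u\<^sub>0\<close> for almost every \<open>t\<close>, and in particular its
  energy is constant.  Two things have to be justified.

  At a fixed time, \<open>\<integral> (u \<otimes> u) : \<nabla>\<phi> = 0\<close> for solenoidal \<open>\<phi>\<close> has to be proved for \<open>u \<in> L\<^sup>2\<close> with
  \<open>\<nabla> \<times> u = \<lambda> u\<close> and \<open>\<lambda> \<in> H\<^sup>\<tau>\<close>, \<open>\<tau> > 1/2\<close>.  The point is that such a field is bounded.  A solenoidal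
  field is controlled by its mean over a cube of half-width \<open>\<epsilon>\<close> plus \<open>K\<^sub>\<epsilon> \<bar>\<nabla> \<times> u\<bar>\<close>, where \<open>K\<^sub>\<epsilon>\<close> is an
  integral operator whose kernel behaves like \<open>\<bar>x - y\<bar>\<^sup>-\<^sup>2\<close> near the diagonal
  (\<open>solenoidal_field_bound\<close>, \<open>rep_bound\<close>).  The exponent \<open>\<tau> > 1/2\<close> is exactly what makes \<open>\<bar>\<lambda>\<bar>\<close> a Kato
  potential for this kernel: \<open>\<integral> \<bar>\<lambda>(x + s y)\<bar> dy \<le> C s\<^sup>-\<^sup>\<alpha>\<close> over \<open>[-1,1]\<^sup>3\<close> with \<open>\<alpha> < 1\<close>, uniformly in
  \<open>x\<close>, by comparing dyadic cubes (\<open>sobolev_kato\<close>).  Hence \<open>K\<^sub>\<epsilon> \<bar>\<lambda>\<bar>\<close> is small for small \<open>\<epsilon>\<close>, and the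
  inequality \<open>\<bar>u\<bar> \<le> H + K\<^sub>\<epsilon> (\<bar>\<lambda>\<bar> \<bar>u\<bar>)\<close> gives \<open>\<bar>u\<bar> \<le> 2 H\<close>: the excess of \<open>\<bar>u\<bar>\<close> over \<open>2 H\<close> vanishes because
  \<open>K\<^sub>\<epsilon>\<close> is symmetric (\<open>u_bounded\<close>).  For bounded \<open>u\<close> the formal identity survives mollification
  (\<open>flux_zero\<close>, \<open>beltrami_flux_zero\<close>).

  In time, the weak formulation is tested with \<open>\<chi>(t) g(x) d\<close>, where \<open>\<chi>\<close> is a flat cut-off and
  \<open>x \<mapsto> g(x) d\<close> a solenoidal trigonometric mode; it yields that the corresponding Fourier coefficient
  of \<open>u(t)\<close> is constant (\<open>modes_constant\<close>).  There are countably many modes and they determine a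
  solenoidal field (\<open>norm_L2_eq_if_modes_eq\<close>).

  Mollification is by trigonometric polynomials (powers of \<open>\<Prod>\<^sub>i (1 + cos 2\<pi>x\<^sub>i) / 2\<close>): these are
  periodic and smooth, hence admissible in all weak identities.
\<close>

section \<open>Lebesgue measure on boxes\<close>

text \<open>
  Lebesgue measure restricted to a box, but as a measure on the whole space: its measurable sets
  are all Borel sets, so that Borel functions need no restriction before they are integrated.
\<close>

definition unif :: "'a::euclidean_space \<Rightarrow> 'a \<Rightarrow> 'a measure" where
  "unif a b = density lborel (indicator (cbox a b))"

lemma sets_unif [simp, measurable_cong]: "sets (unif a b) = sets borel"
  by (simp add: unif_def)

lemma space_unif [simp]: "space (unif a b) = UNIV"
  by (simp add: unif_def)

lemma nn_integral_unif:
  assumes [measurable]: "f \<in> borel_measurable borel"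
  shows "(\<integral>\<^sup>+x. f x \<partial>unif a b) = (\<integral>\<^sup>+x. f x * indicator (cbox a b) x \<partial>lborel)"
  unfolding unif_def by (subst nn_integral_density) (auto simp: mult.commute)

lemma AE_unif: "(AE x in unif a b. P x) \<longleftrightarrow> (AE x in lborel. x \<in> cbox a b \<longrightarrow> P x)"
  unfolding unif_def by (subst AE_density) (auto simp: indicator_def)

lemma AE_unifI: "(AE x in lborel. P x) \<Longrightarrow> AE x in unif a b. P x"
  by (auto simp: AE_unif)

lemma emeasure_unif: "emeasure (unif a b) UNIV = emeasure lborel (cbox a b)"
  by (simp add: unif_def emeasure_density)

lemma finite_measure_unif: "finite_measure (unif a b)"
  by (rule finite_measureI) (use emeasure_lborel_cbox_finite[of a b] in \<open>simp add: emeasure_unif\<close>)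

interpretation unif: finite_measure "unif a b" for a b
  by (rule finite_measure_unif)

interpretation unif2: pair_sigma_finite "unif a b" "unif c d" for a b c d ..

lemma integral_unif:
  fixes f :: "'a::euclidean_space \<Rightarrow> 'b::euclidean_space"
  assumes [measurable]: "f \<in> borel_measurable borel"
  shows "(\<integral>x. f x \<partial>unif a b) = (LINT x:cbox a b|lborel. f x)"
  unfolding unif_def set_lebesgue_integral_def
  by (subst integral_density[where f = f and g="\<lambda>x. indicator (cbox a b) x ::
      real", simplified ennreal_indicator]) auto

lemma measure_tor [simp]: "emeasure (unif 0 (1::real^3)) UNIV = 1"
proof -
  have "(\<Prod>b\<in>Basis. (1::real^3) \<bullet> b) = 1"
    by (rule prod.neutral) (auto simp: Basis_vec_def inner_axis)
  then show ?thesis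
    by (simp add: emeasure_unif emeasure_lborel_cbox_eq Basis_vec_def inner_axis)
qed

lemma measure_B [simp]: "emeasure (unif (-1) (1::real^3)) UNIV = 8"
proof -
  have 1: "b \<in> Basis \<Longrightarrow> (1::real^3) \<bullet> b = 1" for b
    by (auto simp: Basis_vec_def inner_axis)
  have 2: "(2::real^3) \<bullet> b = 2" if "b \<in> Basis" for b
    using 1[OF that] by (metis inner_add_left one_add_one)
  have "(\<Prod>b\<in>Basis. ((1::real^3) - -1) \<bullet> b) = (\<Prod>b\<in>(Basis::(real^3) set). 2)"
    by (rule prod.cong) (auto simp: inner_diff_left 1 2)
  also have "\<dots> = 8" by simp
  finally show ?thesis
    using 1 2 by (simp add: emeasure_unif emeasure_lborel_cbox_eq)
qed

lemma integrable_unif_bounded: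
  fixes f :: "'a::euclidean_space \<Rightarrow> real"
  assumes "f \<in> borel_measurable borel" "\<And>x. x \<in> cbox a b \<Longrightarrow> \<bar>f x\<bar> \<le> C"
  shows "integrable (unif a b) f"
  by (rule unif.integrable_const_bound[where B=C]) (use assms in \<open>auto simp: AE_unif\<close>)

lemma integrable_unif_continuous:
  fixes f :: "'a::euclidean_space \<Rightarrow> real"
  assumes "continuous_on UNIV f"
  shows "integrable (unif a b) f"
proof -
  have "compact (f ` cbox a b)"
    by (intro compact_continuous_image continuous_on_subset[OF assms]) auto
  then obtain C where "\<forall>x\<in>cbox a b. \<bar>f x\<bar> \<le> C"
    by (auto dest!: compact_imp_bounded simp: bounded_iff)
  then show ?thesis
    by (intro integrable_unif_bounded[of f _ _ C])
        (use assms in \<open>auto intro: borel_measurable_continuous_onI\<close>)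
qed

section \<open>Periodic functions\<close>

text \<open>The period lattice \<open>\<int>\<^sup>3\<close>.\<close>

definition lattice :: "(real^3) set" where
  "lattice = {k. \<forall>i. k $ i \<in> \<int>}"

text \<open>The representative of a point in the fundamental domain \<open>[0,1)\<^sup>3\<close>.\<close>

definition wrap :: "real^3 \<Rightarrow> real^3" where
  "wrap x = (\<chi> i. frac (x $ i))"

lemma countable_lattice: "countable lattice"
proof -
  have "lattice \<subseteq> (\<lambda>(a,b,c). vector [of_int a, of_int b, of_int c] :: real^3) ` UNIV"
  proof
    fix k assume "k \<in> lattice"
    then have "k = vector [of_int \<lfloor>k$1\<rfloor>, of_int \<lfloor>k$2\<rfloor>, of_int \<lfloor>k$3\<rfloor>]"
      by (auto simp: vec_eq_iff forall_3 lattice_def elim!: Ints_cases)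
    then show "k \<in> (\<lambda>(a,b,c). vector [of_int a, of_int b, of_int c] :: real^3) ` UNIV"
      by (intro image_eqI[of _ _ "(\<lfloor>k$1\<rfloor>, \<lfloor>k$2\<rfloor>, \<lfloor>k$3\<rfloor>)"]) auto
  qed
  then show ?thesis by (rule countable_subset) (auto intro: countable_image)
qed

lemma periodic_nat: "periodic f \<Longrightarrow> f (x + real n *\<^sub>R axis i 1) = f x"
proof (induction n)
  case (Suc n)
  have "x + real (Suc n) *\<^sub>R axis i 1 = (x + real n *\<^sub>R axis i 1) + axis i 1"
    by (simp add: algebra_simps)
  then show ?case using Suc by (metis periodic_def)
qed simp

lemma periodic_int: assumes "periodic f" "c \<in> \<int>" shows "f (x + c *\<^sub>R axis i 1) = f x"
proof (cases "c \<ge> 0")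
  case True
  then obtain n where "c = real n" using assms(2)
    by (metis Ints_cases of_int_of_nat_eq of_int_0_le_iff nonneg_int_cases)
  then show ?thesis using periodic_nat[OF assms(1)] by simp
next
  case False
  then have "-c \<ge> 0" "-c \<in> \<int>" using assms by auto
  then obtain n where "- c = real n" by (metis Ints_cases of_int_of_nat_eq of_int_0_le_iff
      nonneg_int_cases)
  then have "c = - real n" by simp
  then show ?thesis using periodic_nat[OF assms(1), of "x + c *\<^sub>R axis i 1" n i] by simp
qed

lemma periodic_lattice: assumes "periodic f" "k \<in> lattice" shows "f (x + k) = f x"
proof -
  have "k = (k$1) *\<^sub>R axis 1 1 + (k$2) *\<^sub>R axis 2 1 + (k$3) *\<^sub>R axis 3 1"
    by (simp add: vec_eq_iff forall_3 axis_def)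
  then have "f (x + k) = f (((x + (k$1) *\<^sub>R axis 1 1) + (k$2) *\<^sub>R axis 2 1) + (k$3) *\<^sub>R axis 3 1)"
    by (metis add.assoc)
  also have "\<dots> = f x"
    using assms by (simp add: periodic_int lattice_def)
  finally show ?thesis .
qed

lemma lattice_uminus: "k \<in> lattice \<Longrightarrow> - k \<in> lattice"
  by (auto simp: lattice_def)

lemma wrap_lattice: "wrap x - x \<in> lattice" "x - wrap x \<in> lattice"
  by (auto simp: lattice_def wrap_def frac_def)

lemma periodic_wrap: "periodic f \<Longrightarrow> f (wrap x) = f x"
  using periodic_lattice[OF _ wrap_lattice(1), of f x x] by simp

lemma wrap_in_cube: "wrap x \<in> cbox 0 1"
  by (auto simp: cbox_def wrap_def Basis_vec_def inner_axis less_imp_le[OF frac_lt_1] )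

lemma wrap_plus_axis: "wrap (x + axis i 1) = wrap x"
  by (auto simp: vec_eq_iff wrap_def axis_def frac_1_eq)

lemma periodic_shift: "periodic f \<Longrightarrow> periodic (\<lambda>x. f (x + a))"
  unfolding periodic_def by (metis add.assoc add.commute)

lemma measurable_wrap [measurable]: "wrap \<in> borel_measurable borel"
proof -
  have "(\<lambda>x. \<Sum>i\<in>UNIV. frac (x $ i) *\<^sub>R axis i (1::real)) \<in> borel_measurable (borel :: (real^3) measure)"
    unfolding frac_def by measurable
  also have "(\<lambda>x. \<Sum>i\<in>UNIV. frac (x $ i) *\<^sub>R axis i (1::real)) = wrap"
    by (auto simp: fun_eq_iff vec_eq_iff wrap_def axis_def if_distrib sum.delta cong: if_cong)
  finally show ?thesis .
qed

text \<open>The half-open unit cube, whose lattice translates tile the space exactly.\<close>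

definition hcube :: "(real^3) set" where "hcube = {x. \<forall>i. 0 \<le> x $ i \<and> x $ i < 1}"

lemma hcube_sets [measurable]: "hcube \<in> sets borel"
proof -
  have "hcube = wrap -` UNIV \<inter> {x. wrap x = x}"
    by (auto simp: hcube_def wrap_def vec_eq_iff frac_eq)
  also have "\<dots> \<in> sets borel" by measurable
  finally show ?thesis .
qed

lemma AE_hcube: "AE x in lborel. indicator (cbox 0 (1::real^3)) x = (indicator hcube x :: ennreal)"
proof -
  have "negligible (cbox 0 (1::real^3) - box 0 1)" by (rule negligible_frontier_interval)
  then have "AE x in lebesgue. x \<notin> cbox 0 (1::real^3) - box 0 1"
    unfolding negligible_iff_null_sets by (rule AE_not_in)
  then have "AE x in lborel. x \<notin> cbox 0 (1::real^3) - box 0 1"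
    by (simp add: AE_completion_iff)
  then show ?thesis
  proof eventually_elim
    case (elim x)
    have "x \<in> box 0 1 \<Longrightarrow> x \<in> hcube" by (auto simp: box_def hcube_def Basis_vec_def inner_axis
        less_imp_le)
    moreover have "x \<in> hcube \<Longrightarrow> x \<in> cbox 0 1" by (auto simp: cbox_def hcube_def Basis_vec_def inner_axis
        less_imp_le)
    ultimately show ?case using elim by (auto simp: indicator_def)
  qed
qed

lemma hcube_tiling: "(\<integral>\<^sup>+k. indicator hcube (y + k) \<partial>count_space lattice) = 1"
proof -
  define k0 where "k0 = wrap y - y"
  have k0: "k0 \<in> lattice" by (simp add: k0_def wrap_lattice)
  have *: "indicator hcube (y + k) = (indicator {k0} k :: ennreal)" if "k \<in> lattice" for k
  proof -
    have "y + k \<in> hcube \<longleftrightarrow> k = k0"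
    proof
      assume "y + k \<in> hcube"
      then have "frac (y $ i + k $ i) = y $ i + k $ i" for i by (auto simp: hcube_def frac_eq)
      moreover have "frac (y $ i + k $ i) = frac (y $ i)" for i
        using that by (auto simp: lattice_def frac_def elim!: Ints_cases)
            (metis Ints_of_int floor_add_int Ints_cases floor_of_int of_int_add add.commute
            add_diff_cancel_left' floor_add2)?
      ultimately show "k = k0" by (auto simp: k0_def vec_eq_iff wrap_def)
    next
      assume "k = k0" then show "y + k \<in> hcube" by (auto simp: k0_def hcube_def wrap_def frac_lt_1)
    qed
    then show ?thesis by (auto simp: indicator_def)
  qed
  have "(\<integral>\<^sup>+k. indicator hcube (y + k) \<partial>count_space lattice) =
      (\<integral>\<^sup>+k. indicator {k0} k \<partial>count_space lattice)"
    by (rule nn_integral_cong) (use * in auto)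
  also have "\<dots> = 1" using k0 by (subst nn_integral_indicator) auto
  finally show ?thesis .
qed

lemma nn_integral_lborel_shift:
  fixes f :: "'a::euclidean_space \<Rightarrow> ennreal"
  assumes [measurable]: "f \<in> borel_measurable borel"
  shows "(\<integral>\<^sup>+x. f (x + a) \<partial>lborel) = (\<integral>\<^sup>+x. f x \<partial>lborel)"
proof -
  have "(\<integral>\<^sup>+x. f x \<partial>lborel) = (\<integral>\<^sup>+x. f x \<partial>distr lborel borel ((+) a))"
    by (simp only: lborel_distr_plus)
  also have "\<dots> = (\<integral>\<^sup>+x. f (a + x) \<partial>lborel)" by (subst nn_integral_distr) auto
  finally show ?thesis by (simp add: add.commute)
qed

text \<open>
  Translation invariance of the integral of a periodic function over one period: the translated
  cube is cut along the lattice tiling and its pieces are moved back.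
\<close>

lemma nn_integral_tor_shift:
  fixes f :: "real^3 \<Rightarrow> ennreal"
  assumes [measurable]: "f \<in> borel_measurable borel" and per: "periodic f"
  shows "(\<integral>\<^sup>+x. f (x + a) \<partial>unif 0 1) = (\<integral>\<^sup>+x. f x \<partial>unif 0 1)"
proof -
  note [measurable] = countable_lattice
  have H: "(\<integral>\<^sup>+x. g x \<partial>unif 0 1) = (\<integral>\<^sup>+x. g x * indicator hcube x \<partial>lborel)" 
    if [measurable]: "g \<in> borel_measurable borel" for g :: "real^3 \<Rightarrow> ennreal"
    unfolding nn_integral_unif[OF that]
    by (rule nn_integral_cong_AE) (use AE_hcube in \<open>auto elim: eventually_mono\<close>)
  have per': "f (x - k) = f x" if "k \<in> lattice" for x k
    using periodic_lattice[OF per lattice_uminus[OF that], of x] by simp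
  have "(\<integral>\<^sup>+x. f (x + a) \<partial>unif 0 1) = (\<integral>\<^sup>+x. f (x + a) * indicator hcube (x + a - a) \<partial>lborel)"
    by (subst H) auto
  also have "\<dots> = (\<integral>\<^sup>+x. f x * indicator hcube (x - a) \<partial>lborel)"
    by (rule nn_integral_lborel_shift[of "\<lambda>x. f x * indicator hcube (x - a)"]) measurable
  also have "\<dots> = (\<integral>\<^sup>+x. \<integral>\<^sup>+k. f x * indicator hcube (x - a) * indicator hcube (x +
      k) \<partial>count_space lattice \<partial>lborel)"
    by (subst nn_integral_cmult) (auto simp: hcube_tiling)
  also have "\<dots> = (\<integral>\<^sup>+k. \<integral>\<^sup>+x. f x * indicator hcube (x - a) * indicator hcube (x +
      k) \<partial>lborel \<partial>count_space lattice)"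
    by (rule nn_integral_count_space_nn_integral) (auto simp: countable_lattice)
  also have "\<dots> = (\<integral>\<^sup>+k. \<integral>\<^sup>+x. f x * indicator hcube (x - a - k) * indicator hcube x \<partial>lborel \<partial>count_space
      lattice)"
  proof (rule nn_integral_cong)
    fix k assume k: "k \<in> space (count_space lattice)"
    have "(\<integral>\<^sup>+x. f x * indicator hcube (x - a) * indicator hcube (x + k) \<partial>lborel)
       = (\<integral>\<^sup>+x. f (x + k) * indicator hcube (x + k - a - k) * indicator hcube (x + k) \<partial>lborel)"
      using k by (simp add: periodic_lattice[OF per] algebra_simps)
    also have "\<dots> = (\<integral>\<^sup>+x. f x * indicator hcube (x - a - k) * indicator hcube x \<partial>lborel)"
      by (rule nn_integral_lborel_shift[of "\<lambda>x. f x * indicator hcube (x - a - k) * indicator hcube x"])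
          measurable
    finally show "(\<integral>\<^sup>+x. f x * indicator hcube (x - a) * indicator hcube (x + k) \<partial>lborel) = \<dots>" .
  qed
  also have "\<dots> = (\<integral>\<^sup>+x. \<integral>\<^sup>+k. f x * indicator hcube (x - a - k) * indicator hcube x \<partial>count_space lattice
      \<partial>lborel)"
    by (rule nn_integral_count_space_nn_integral[symmetric]) (auto simp: countable_lattice)
  also have "\<dots> = (\<integral>\<^sup>+x. f x * indicator hcube x * (\<integral>\<^sup>+k. indicator hcube (x - a - k) \<partial>count_space lattice) \<partial>lborel)"
    by (subst nn_integral_cmult[symmetric]) (auto simp: mult_ac)
  also have "\<dots> = (\<integral>\<^sup>+x. f x * indicator hcube x \<partial>lborel)"
  proof -
    have "(\<integral>\<^sup>+k. indicator hcube (y - k) \<partial>count_space lattice) = 1" for y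
    proof -
      have "bij_betw uminus lattice lattice"
        by (rule bij_betwI[of _ _ _ uminus]) (auto simp: lattice_uminus)
      then have "(\<integral>\<^sup>+k. indicator hcube (y + - k) \<partial>count_space lattice) =
          (\<integral>\<^sup>+k. indicator hcube (y + k) \<partial>count_space lattice)"
        by (rule nn_integral_bij_count_space)
      then show ?thesis by (simp add: hcube_tiling)
    qed
    then show ?thesis by simp
  qed
  finally show ?thesis by (simp add: H)
qed

lemma nn_integral_affine:
  fixes f :: "real^3 \<Rightarrow> ennreal"
  assumes [measurable]: "f \<in> borel_measurable borel" and "s > 0"
  shows "(\<integral>\<^sup>+y. f (x + s *\<^sub>R y) \<partial>lborel) = ennreal (1 / s^3) * (\<integral>\<^sup>+z. f z \<partial>lborel)"
proof -
  have "(\<integral>\<^sup>+z. f z \<partial>lborel) = (\<integral>\<^sup>+z. f z \<partial>density (distr lborel borel (\<lambda>y. x +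
      s *\<^sub>R y)) (\<lambda>_. \<bar>s\<bar>^DIM(real^3)))"
    using \<open>s > 0\<close> by (subst lborel_affine[of s x]) auto
  also have "\<dots> = ennreal (s^3) * (\<integral>\<^sup>+y. f (x + s *\<^sub>R y) \<partial>lborel)"
    using \<open>s > 0\<close> by (simp add: nn_integral_density nn_integral_distr nn_integral_cmult)
  finally show ?thesis using \<open>s > 0\<close>
    by (simp add: mult.assoc[symmetric] ennreal_mult[symmetric])
qed

lemma nn_integral_ball_eq:
  fixes f :: "real^3 \<Rightarrow> ennreal"
  assumes [measurable]: "f \<in> borel_measurable borel" and s: "0 < s"
  shows "(\<integral>\<^sup>+y. f (x + s *\<^sub>R y) \<partial>unif (-1) 1) =
      ennreal (1 / s^3) * (\<integral>\<^sup>+z. f z * indicator (cbox (x - s *\<^sub>R 1) (x + s *\<^sub>R 1)) z \<partial>lborel)"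
proof -
  have ind: "y \<in> cbox (-1) (1::real^3) \<longleftrightarrow> x + s *\<^sub>R y \<in> cbox (x - s *\<^sub>R 1) (x + s *\<^sub>R 1)" for y
  proof -
    have "- 1 \<le> y $ i \<and> y $ i \<le> 1 \<longleftrightarrow> x $ i - s \<le> x $ i + s * y $ i \<and> x $ i + s * y $ i \<le> x $ i + s" for i
    proof -
      have "- 1 \<le> y $ i \<longleftrightarrow> s * (- 1) \<le> s * y $ i" using s by (subst mult_le_cancel_left_pos) auto
      moreover have "y $ i \<le> 1 \<longleftrightarrow> s * y $ i \<le> s * 1" using s by (subst mult_le_cancel_left_pos) auto
      ultimately show ?thesis by auto
    qed
    then show ?thesis by (simp add: mem_box_cart)
  qed
  have "(\<integral>\<^sup>+y. f (x + s *\<^sub>R y) \<partial>unif (-1) 1) =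
      (\<integral>\<^sup>+y. f (x + s *\<^sub>R y) * indicator (cbox (x - s *\<^sub>R 1) (x + s *\<^sub>R 1)) (x + s *\<^sub>R y) \<partial>lborel)"
    by (subst nn_integral_unif) (auto intro!: nn_integral_cong simp: indicator_def ind)
  also have "\<dots> = ennreal (1 / s^3) * (\<integral>\<^sup>+z. f z * indicator (cbox (x - s *\<^sub>R 1) (x +
      s *\<^sub>R 1)) z \<partial>lborel)"
    by (rule nn_integral_affine[of "\<lambda>z. f z * indicator (cbox (x - s *\<^sub>R 1) (x + s *\<^sub>R 1)) z"])
        (use s in auto)
  finally show ?thesis .
qed

text \<open>A cube of half-width \<open>s \<le> 1/2\<close> fits into a period cell.\<close>

lemma nn_integral_small_cube_le:
  fixes f :: "real^3 \<Rightarrow> ennreal"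
  assumes [measurable]: "f \<in> borel_measurable borel" and per: "periodic f" and s: "0 < s" "s \<le> 1/2"
  shows "(\<integral>\<^sup>+y. f (x + s *\<^sub>R y) \<partial>unif (-1) 1) \<le> ennreal (1 / s^3) * (\<integral>\<^sup>+z. f z \<partial>unif 0 1)"
proof -
  define a where "a = x - (1/2) *\<^sub>R (1::real^3)"
  have sub: "z - a \<in> cbox 0 1" if "z \<in> cbox (x - s *\<^sub>R 1) (x + s *\<^sub>R 1)" for z
  proof -
    have *: "x $ i - s \<le> z $ i" "z $ i \<le> x $ i + s" for i
      using that by (auto simp: mem_box_cart)
    show ?thesis unfolding mem_box_cart a_def
    proof (intro allI)
      fix i show "(0::real^3) $ i \<le> (z - (x - (1/2) *\<^sub>R 1)) $ i \<and> (z - (x - (1/2) *\<^sub>R 1)) $ i \<le>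
          (1::real^3) $ i"
        using *[of i] s by simp
    qed
  qed
  have "(\<integral>\<^sup>+z. f z * indicator (cbox (x - s *\<^sub>R 1) (x + s *\<^sub>R 1)) z \<partial>lborel) \<le>
      (\<integral>\<^sup>+z. f z * indicator (cbox 0 1) (z - a) \<partial>lborel)"
    by (intro nn_integral_mono mult_left_mono) (auto simp: indicator_def sub)
  also have "\<dots> = (\<integral>\<^sup>+z. f (z + a) * indicator (cbox 0 1) (z + a - a) \<partial>lborel)"
    by (rule nn_integral_lborel_shift[of "\<lambda>z. f z * indicator (cbox 0 1) (z - a)", symmetric])
        measurable
  also have "\<dots> = (\<integral>\<^sup>+z. f (z + a) \<partial>unif 0 1)"
    by (subst nn_integral_unif) auto
  also have "\<dots> = (\<integral>\<^sup>+z. f z \<partial>unif 0 1)" by (rule nn_integral_tor_shift) (auto simp: per)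
  finally show ?thesis
    unfolding nn_integral_ball_eq[OF assms(1) s(1)] by (rule mult_left_mono) simp
qed

text \<open>The torus \<open>[0,1]\<^sup>3\<close> and the reference cube \<open>[-1,1]\<^sup>3\<close>.\<close>

abbreviation tor :: "(real^3) measure" where "tor \<equiv> unif 0 1"
abbreviation cube :: "(real^3) measure" where "cube \<equiv> unif (-1) 1"

text \<open>The \<open>L\<^sup>1\<close> mass of \<open>f\<close> on the cube around \<open>x\<close> of half-width \<open>s\<close>, rescaled to the reference cube.\<close>

abbreviation cube_mass :: "(real^3 \<Rightarrow> real) \<Rightarrow> real^3 \<Rightarrow> real \<Rightarrow> ennreal" where
  "cube_mass f x s \<equiv> \<integral>\<^sup>+y. ennreal \<bar>f (x + s *\<^sub>R y)\<bar> \<partial>cube"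

lemma integral_tor_shift:
  fixes f :: "real^3 \<Rightarrow> 'b::euclidean_space"
  assumes [measurable]: "f \<in> borel_measurable borel" and per: "periodic f"
  shows "(\<integral>x. f (x + a) \<partial>tor) = (\<integral>x. f x \<partial>tor)"
proof -
  have D: "distr tor borel (\<lambda>x. wrap (x + a)) = distr tor borel wrap"
  proof (rule measure_eqI)
    fix A assume "A \<in> sets (distr tor borel (\<lambda>x. wrap (x + a)))"
    then have [measurable]: "A \<in> sets borel" by simp
    have "emeasure (distr tor borel (\<lambda>x. wrap (x + a))) A =
        (\<integral>\<^sup>+x. indicator A x \<partial>distr tor borel (\<lambda>x. wrap (x + a)))"
      by simp
    also have "\<dots> = (\<integral>\<^sup>+x. indicator A (wrap (x + a)) \<partial>tor)"
      by (subst nn_integral_distr) auto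
    also have "\<dots> = (\<integral>\<^sup>+x. indicator A (wrap x) \<partial>tor)"
      by (rule nn_integral_tor_shift) (auto simp: periodic_def wrap_plus_axis)
    also have "\<dots> = (\<integral>\<^sup>+x. indicator A x \<partial>distr tor borel wrap)"
      by (subst nn_integral_distr) auto
    also have "\<dots> = emeasure (distr tor borel wrap) A"
      by simp
    finally show "emeasure (distr tor borel (\<lambda>x. wrap (x + a))) A = emeasure (distr tor borel wrap) A" .
  qed simp
  have "(\<integral>x. f (x + a) \<partial>tor) = (\<integral>x. f (wrap (x + a)) \<partial>tor)" by (simp add: periodic_wrap[OF per])
  also have "\<dots> = (\<integral>x. f x \<partial>distr tor borel (\<lambda>x. wrap (x + a)))" by (subst integral_distr) auto
  also have "\<dots> = (\<integral>x. f (wrap x) \<partial>tor)" unfolding D by (subst integral_distr) auto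
  also have "\<dots> = (\<integral>x. f x \<partial>tor)" by (simp add: periodic_wrap[OF per])
  finally show ?thesis .
qed

section \<open>Continuously differentiable functions\<close>

text \<open>\<open>f\<close> is continuously differentiable with partial derivatives \<open>g i = \<partial>\<^sub>i f\<close>.\<close>

definition c1_grad :: "(real^3 \<Rightarrow> real) \<Rightarrow> (3 \<Rightarrow> real^3 \<Rightarrow> real) \<Rightarrow> bool" where
  "c1_grad f g \<longleftrightarrow> (\<forall>x. (f has_derivative (\<lambda>h. \<Sum>i\<in>UNIV. g i x * h $ i)) (at x)) \<and>
     (\<forall>i. continuous_on UNIV (g i))"

lemma c1_gradD: "c1_grad f g \<Longrightarrow> (f has_derivative (\<lambda>h. \<Sum>i\<in>UNIV. g i x * h $ i)) (at x)"
  by (simp add: c1_grad_def)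

lemma c1_grad_cont_grad: "c1_grad f g \<Longrightarrow> continuous_on UNIV (g i)"
  by (simp add: c1_grad_def)

lemma c1_grad_cont: "c1_grad f g \<Longrightarrow> continuous_on UNIV f"
  by (meson c1_gradD continuous_at_imp_continuous_on has_derivative_continuous)

lemma c1_grad_measurable: "c1_grad f g \<Longrightarrow> f \<in> borel_measurable borel"
    "c1_grad f g \<Longrightarrow> g i \<in> borel_measurable borel"
  by (auto intro: borel_measurable_continuous_onI c1_grad_cont c1_grad_cont_grad)

lemma sum_mult_axis: "(\<Sum>i\<in>UNIV. c i * (axis j 1 :: real^3) $ i) = c j"
  by (simp add: axis_def if_distrib cong: if_cong)

lemma c1_grad_partial: assumes "c1_grad f g" shows "partial i f x = g i x"
proof -
  have "frechet_derivative f (at x) = (\<lambda>h. \<Sum>i\<in>UNIV. g i x * h $ i)"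
    by (rule frechet_derivative_at[OF c1_gradD[OF assms], symmetric])
  then show ?thesis by (simp add: partial_def sum_mult_axis)
qed

lemma c1_grad_add: "c1_grad f g \<Longrightarrow> c1_grad f' g' \<Longrightarrow> c1_grad (\<lambda>x. f x + f' x) (\<lambda>i x. g i x + g' i x)"
  unfolding c1_grad_def
  by (intro conjI allI continuous_intros) (simp_all add: distrib_right sum.distrib has_derivative_add)

lemma c1_grad_mult: assumes "c1_grad f g" "c1_grad f' g'"
  shows "c1_grad (\<lambda>x. f x * f' x) (\<lambda>i x. f x * g' i x + g i x * f' x)"
  unfolding c1_grad_def
proof (intro conjI allI)
  fix x
  have e: "(\<lambda>h. f x * (\<Sum>i\<in>UNIV. g' i x * h $ i) + (\<Sum>i\<in>UNIV. g i x * h $ i) * f' x) =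
        (\<lambda>h::real^3. \<Sum>i\<in>UNIV. (f x * g' i x + g i x * f' x) * h $ i)"
    by (auto simp: fun_eq_iff sum.distrib sum_distrib_left sum_distrib_right algebra_simps)
  show "((\<lambda>x. f x * f' x) has_derivative (\<lambda>h. \<Sum>i\<in>UNIV. (f x * g' i x + g i x * f' x) * h $ i)) (at x)"
    unfolding e[symmetric] by (rule has_derivative_mult[OF c1_gradD[OF assms(1)] c1_gradD[OF assms(2)]])
  fix i show "continuous_on UNIV (\<lambda>x. f x * g' i x + g i x * f' x)"
    by (intro continuous_intros c1_grad_cont[OF assms(1)] c1_grad_cont[OF assms(2)]
       c1_grad_cont_grad[OF assms(1)] c1_grad_cont_grad[OF assms(2)])
qed

lemma c1_grad_const: "c1_grad (\<lambda>x. c) (\<lambda>i x. 0)"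
  by (auto simp: c1_grad_def)

lemma c1_grad_cmult: "c1_grad f g \<Longrightarrow> c1_grad (\<lambda>x. c * f x) (\<lambda>i x. c * g i x)"
  using c1_grad_mult[OF c1_grad_const[of c]] by simp

lemma c1_grad_eq: "c1_grad f g \<Longrightarrow> (\<And>x. f x = f' x) \<Longrightarrow> (\<And>i x. g i x = g' i x) \<Longrightarrow> c1_grad f' g'"
  by (metis ext)

lemma c1_grad_periodic: assumes "c1_grad f g" "periodic f" shows "periodic (g i)"
  unfolding periodic_def
proof (intro allI)
  fix x j
  have "((\<lambda>x. f (x + axis j 1)) has_derivative (\<lambda>h. \<Sum>i\<in>UNIV. g i (x + axis j 1) * h $ i)) (at x)"
    by (rule has_derivative_compose[of "\<lambda>x. x + axis j 1" "\<lambda>h. h" x UNIV f, OF _ c1_gradD[OF assms(1)]])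
      (auto intro!: derivative_eq_intros)
  then have "(f has_derivative (\<lambda>h. \<Sum>i\<in>UNIV. g i (x + axis j 1) * h $ i)) (at x)"
    using assms(2) by (simp add: periodic_def)
  then have "(\<lambda>h. \<Sum>i\<in>UNIV. g i (x + axis j 1) * h $ i) = (\<lambda>h. \<Sum>i\<in>UNIV. g i x * h $ i)"
    using c1_gradD[OF assms(1)] by (rule has_derivative_unique)
  from fun_cong[OF this, of "axis i 1"] show "g i (x + axis j 1) = g i x"
    by (simp add: sum_mult_axis)
qed

lemma c1_grad_line:
  assumes "c1_grad f g"
  shows "((\<lambda>s. f (x + s *\<^sub>R y)) has_real_derivative (\<Sum>i\<in>UNIV. g i (x + s *\<^sub>R y) * y $ i)) (at s)"
proof -
  have "((\<lambda>s. f (x + s *\<^sub>R y)) has_derivative (\<lambda>h. \<Sum>i\<in>UNIV. g i (x + s *\<^sub>R y) * (h *\<^sub>R y) $ i)) (at s)"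
    by (rule has_derivative_compose[of "\<lambda>s. x + s *\<^sub>R y" "\<lambda>h. h *\<^sub>R y"
        s UNIV f, OF _ c1_gradD[OF assms]])
      (auto intro!: derivative_eq_intros)
  then show ?thesis
    unfolding has_field_derivative_def
    by (rule has_derivative_eq_rhs) (auto simp: fun_eq_iff sum_distrib_left mult_ac)
qed

lemma c1_grad_FTC:
  assumes "c1_grad f g" "a \<le> b"
  shows "(\<integral>s. (\<Sum>i\<in>UNIV. g i (x + s *\<^sub>R y) * y $ i) \<partial>unif a b) = f (x + b *\<^sub>R y) - f (x + a *\<^sub>R y)"
proof -
  let ?d = "\<lambda>s. \<Sum>i\<in>UNIV. g i (x + s *\<^sub>R y) * y $ i"
  have c: "continuous_on UNIV ?d"
    by (intro continuous_intros continuous_on_compose2[OF c1_grad_cont_grad[OF assms(1)]]) auto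
  have "(\<integral>s. ?d s \<partial>unif a b) = (\<integral>s. ?d s * indicator {a..b} s \<partial>lborel)"
    using borel_measurable_continuous_onI[OF c] 
    by (subst integral_unif) (simp_all add: set_lebesgue_integral_def mult.commute)
  also have "\<dots> = f (x + b *\<^sub>R y) - f (x + a *\<^sub>R y)"
    by (rule integral_FTC_Icc_real[OF assms(2)])
      (use c in \<open>auto intro: c1_grad_line[OF assms(1)] simp: continuous_on_eq_continuous_at\<close>)
  finally show ?thesis .
qed

lemma periodic_continuous_bounded:
  fixes f :: "real^3 \<Rightarrow> real"
  assumes "continuous_on UNIV f" "periodic f"
  obtains C where "C \<ge> 0" "\<And>x. \<bar>f x\<bar> \<le> C"
proof -
  have "compact (f ` cbox 0 1)"
    by (intro compact_continuous_image continuous_on_subset[OF assms(1)]) auto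
  then obtain C where C: "\<forall>x\<in>cbox 0 1. \<bar>f x\<bar> \<le> C"
    by (auto dest!: compact_imp_bounded simp: bounded_iff)
  have "\<bar>f x\<bar> \<le> C" for x using C wrap_in_cube[of x] periodic_wrap[OF assms(2), of x] by metis
  then show thesis using that[of "max C 0"] by (meson max.coboundedI1 max.cobounded2)
qed

text \<open>
  Integration by parts on the torus: \<open>f(x + e\<^sub>i) - f(x) = 0\<close> is the integral of \<open>\<partial>\<^sub>i f\<close> over a
  segment, and all translates of \<open>\<partial>\<^sub>i f\<close> have the same integral.
\<close>

lemma integral_tor_partial_eq_0:
  assumes "c1_grad f g" "periodic f"
  shows "(\<integral>x. g i x \<partial>tor) = 0"
proof -
  note [measurable] = c1_grad_measurable[OF assms(1)]
  have per: "periodic (g i)" by (rule c1_grad_periodic[OF assms])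
  obtain C where C: "\<And>x. \<bar>g i x\<bar> \<le> C"
    using periodic_continuous_bounded[OF c1_grad_cont_grad[OF assms(1)] per] by metis
  have "0 = f (x + 1 *\<^sub>R axis i 1) - f (x + 0 *\<^sub>R axis i 1)" for x
    using assms(2) by (simp add: periodic_def)
  also have "f (x + 1 *\<^sub>R axis i 1) - f (x + 0 *\<^sub>R axis i 1) = (\<integral>s. g i (x + s *\<^sub>R axis i 1) \<partial>unif 0 1)"
      for x
    by (subst c1_grad_FTC[OF assms(1), symmetric]) (auto simp: sum_mult_axis)
  finally have 0: "(\<integral>s. g i (x + s *\<^sub>R axis i 1) \<partial>unif 0 1) = 0" for x by simp
  have "(\<integral>x. (\<integral>s. g i (x + s *\<^sub>R axis i 1) \<partial>unif 0 1) \<partial>tor) =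
      (\<integral>s. (\<integral>x. g i (x + s *\<^sub>R axis i 1) \<partial>tor) \<partial>unif 0 (1::real))"
  proof (rule unif2.Fubini_integral)
    interpret P: finite_measure "unif 0 (1::real) \<Otimes>\<^sub>M tor"
      by (rule finite_measure_pair_measure) (auto intro: finite_measure_unif)
    show "integrable (unif 0 (1::real) \<Otimes>\<^sub>M tor) (\<lambda>(s, x). g i (x + s *\<^sub>R axis i 1))"
      by (rule P.integrable_const_bound[where B=C]) (use C in auto)
  qed
  also have "\<dots> = (\<integral>s. (\<integral>x. g i x \<partial>tor) \<partial>unif 0 (1::real))"
    by (subst integral_tor_shift[OF _ per]) auto
  also have "\<dots> = (\<integral>x. g i x \<partial>tor)"
    by (simp add: measure_def emeasure_unif)
  finally show ?thesis using 0 by simp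
qed

text \<open>
  The same for functions supported in the cube \<open>[-1,1]\<^sup>3\<close>, by translation invariance on the whole
  space.
\<close>

lemma integral_cube_partial_eq_0:
  assumes "c1_grad f g" and z: "\<And>x. x \<notin> cbox (-1) 1 \<Longrightarrow> f x = 0"
  shows "(\<integral>x. g i x \<partial>cube) = 0"
proof -
  note [measurable] = c1_grad_measurable[OF assms(1)]
  have gz: "g i x = 0" if "x \<notin> cbox (-1) 1" for x
  proof -
    have "(f has_derivative (\<lambda>h. 0)) (at x)"
    proof (rule has_derivative_transform_within_open[of "\<lambda>_. 0" _ _ "UNIV" "- cbox (-1) 1"])
      show "x \<in> - cbox (- 1) 1" using that by simp
    qed (use z in auto)
    then have "(\<lambda>h. 0) = (\<lambda>h. \<Sum>i\<in>UNIV. g i x * h $ i)"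
      using c1_gradD[OF assms(1)] by (rule has_derivative_unique)
    from fun_cong[OF this, of "axis i 1"] show ?thesis
      by (simp add: sum_mult_axis)
  qed
  have int: "integrable lborel h" if c: "continuous_on UNIV h" and hz: "\<And>x. x \<notin> cbox (-1) 1 \<Longrightarrow> h x = 0" 
    for h :: "real^3 \<Rightarrow> real"
  proof -
    have "set_integrable lborel (cbox (-1) 1) h"
      unfolding set_integrable_def by (rule borel_integrable_compact)
          (auto intro: continuous_on_subset[OF c])
    also have "?this \<longleftrightarrow> integrable lborel h"
      unfolding set_integrable_def by (rule Bochner_Integration.integrable_cong)
          (use hz in \<open>auto simp: indicator_def\<close>)
    finally show ?thesis .
  qed
  have if': "integrable lborel f" by (rule int[OF c1_grad_cont[OF assms(1)] z])
  have ig: "integrable lborel (g i)" by (rule int[OF c1_grad_cont_grad[OF assms(1)] gz])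
  have shift: "(\<integral>x. h (x + a) \<partial>lborel) = (\<integral>x. h x \<partial>lborel)"
      "integrable lborel h \<Longrightarrow> integrable lborel (\<lambda>x. h (x + a))"
    if [measurable]: "h \<in> borel_measurable borel" for h :: "real^3 \<Rightarrow> real" and a
  proof -
    have "(\<integral>x. h x \<partial>lborel) = (\<integral>x. h x \<partial>distr lborel borel ((+) a))"
      by (simp only: lborel_distr_plus)
    then show "(\<integral>x. h (x + a) \<partial>lborel) = (\<integral>x. h x \<partial>lborel)"
      by (simp add: integral_distr add.commute)
    have "integrable lborel h = integrable (distr lborel borel ((+) a)) h"
      by (simp only: lborel_distr_plus)
    then show "integrable lborel h \<Longrightarrow> integrable lborel (\<lambda>x. h (x + a))"
      by (simp add: integrable_distr_eq add.commute)
  qed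
  have F: "f (x + axis i 1) - f x = (\<integral>s. g i (x + s *\<^sub>R axis i 1) \<partial>unif 0 1)" for x
    using c1_grad_FTC[OF assms(1), of 0 1 x "axis i 1"] by (simp add: sum_mult_axis)
  have "0 = (\<integral>x. f (x + axis i 1) - f x \<partial>lborel)"
    using if' by (subst Bochner_Integration.integral_diff) (auto intro: shift simp: shift)
  also have "\<dots> = (\<integral>x. (\<integral>s. g i (x + s *\<^sub>R axis i 1) \<partial>unif 0 1) \<partial>lborel)"
    by (simp add: F)
  also have "\<dots> = (\<integral>s. (\<integral>x. g i (x + s *\<^sub>R axis i 1) \<partial>lborel) \<partial>unif 0 (1::real))"
  proof -
    interpret P: pair_sigma_finite "unif 0 (1::real)" "lborel :: (real^3) measure" ..
    show ?thesis
    proof (rule P.Fubini_integral)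
      show "integrable (unif 0 (1::real) \<Otimes>\<^sub>M lborel) (\<lambda>(s, x). g i (x + s *\<^sub>R axis i 1))"
      proof (rule P.Fubini_integrable)
        have "(\<integral>x. norm (g i (x + s *\<^sub>R axis i 1)) \<partial>lborel) = (\<integral>x. norm (g i x) \<partial>lborel)" for s
          by (rule shift(1)[of "\<lambda>x. norm (g i x)"]) measurable
        then show "integrable (unif 0 1) (\<lambda>s::real. \<integral>x. norm (case (s, x) of (s, x) \<Rightarrow> g i (x +
            s *\<^sub>R axis i 1)) \<partial>lborel)"
          by (simp add: integrable_unif_bounded)
        show "AE s in unif 0 (1::real). integrable lborel (\<lambda>x. case (s, x) of (s, x) \<Rightarrow> g i (x +
            s *\<^sub>R axis i 1))"
          using ig by (auto intro!: AE_I2 shift)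
      qed measurable
    qed
  qed
  also have "\<dots> = (\<integral>x. g i x \<partial>lborel)"
    by (subst shift) (auto simp: measure_def emeasure_unif)
  also have "\<dots> = (\<integral>x. g i x \<partial>cube)"
    by (subst integral_unif) (use gz in \<open>auto simp: set_lebesgue_integral_def indicator_def intro!:
        Bochner_Integration.integral_cong\<close>)
  finally show ?thesis by simp
qed

section \<open>Trigonometric polynomials\<close>

text \<open>
  Smoothness by coinduction: a class of differentiable functions that contains the directional
  derivatives of its members consists of smooth functions.
\<close>

lemma smooth_on_coinduct:
  assumes X: "\<And>f. f \<in> X \<Longrightarrow> \<exists>f'. (\<forall>x\<in>S. (f has_derivative f' x) (at x within S)) \<and> (\<forall>v. (\<lambda>x. f' x v) \<in> X)"
    and uniq: "\<And>(h :: 'a::euclidean_space \<Rightarrow> 'b::euclidean_space) h' h'' x. x \<in> S \<Longrightarrow>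
        (h has_derivative h') (at x within S) \<Longrightarrow> (h has_derivative h'') (at x within S) \<Longrightarrow> h' = h''"
    and f: "(f :: 'a \<Rightarrow> 'b) \<in> X"
  shows "smooth_on S f"
proof -
  have D: "\<exists>g\<in>X. \<forall>x\<in>S. iter_deriv S vs f x = g x" for vs
  proof (induction vs)
    case Nil then show ?case using f by (auto simp: iter_deriv_def)
  next
    case (Cons v vs)
    then obtain g where g: "g \<in> X" "\<And>x. x \<in> S \<Longrightarrow> iter_deriv S vs f x = g x" by auto
    from X[OF g(1)] obtain g' where g': "\<And>x. x \<in> S \<Longrightarrow> (g has_derivative g' x) (at x within S)"
        "\<And>v. (\<lambda>x. g' x v) \<in> X"
      by auto
    have "iter_deriv S (v # vs) f x = g' x v" if x: "x \<in> S" for x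
    proof -
      have d: "(iter_deriv S vs f has_derivative g' x) (at x within S)"
        by (rule has_derivative_transform[OF x _ g'(1)[OF x]]) (use g in auto)
      then have "(iter_deriv S vs f has_derivative frechet_derivative (iter_deriv S vs f)
          (at x within S)) (at x within S)"
        by (auto simp: frechet_derivative_works[symmetric] differentiable_def)
      then have "frechet_derivative (iter_deriv S vs f) (at x within S) = g' x"
        by (rule uniq[OF x _ d])
      then show ?thesis by (simp add: iter_deriv_def)
    qed
    then show ?case using g'(2) by auto
  qed
  show ?thesis unfolding smooth_on_def differentiable_on_def
  proof (intro allI ballI)
    fix vs x assume x: "x \<in> S"
    obtain g where g: "g \<in> X" "\<And>x. x \<in> S \<Longrightarrow> iter_deriv S vs f x = g x" using D by blast
    from X[OF g(1)] obtain g' where g': "\<And>x. x \<in> S \<Longrightarrow> (g has_derivative g' x) (at x within S)"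
      by auto
    have "(iter_deriv S vs f has_derivative g' x) (at x within S)"
      by (rule has_derivative_transform[OF x _ g'(1)[OF x]]) (use g in auto)
    then show "iter_deriv S vs f differentiable at x within S" by (auto simp: differentiable_def)
  qed
qed

text \<open>A plane wave; the phase \<open>b\<close> accounts for cosines and sines alike.\<close>

definition wave :: "real \<Rightarrow> real^3 \<Rightarrow> real \<Rightarrow> real^3 \<Rightarrow> real" where
  "wave c k b x = c * cos (2 * pi * (k \<bullet> x) + b)"

text \<open>Real trigonometric polynomials on the torus.\<close>

inductive_set trig :: "(real^3 \<Rightarrow> real) set" where
  trig_wave: "k \<in> lattice \<Longrightarrow> wave c k b \<in> trig"
| trig_add: "f \<in> trig \<Longrightarrow> g \<in> trig \<Longrightarrow> (\<lambda>x. f x + g x) \<in> trig"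

lemma inner_lattice_axis: "k \<in> lattice \<Longrightarrow> k \<bullet> axis i 1 \<in> \<int>"
  by (auto simp: lattice_def inner_axis)

lemma trig_periodic: "f \<in> trig \<Longrightarrow> periodic f"
proof (induction rule: trig.induct)
  case (trig_wave k c b)
  show ?case unfolding periodic_def wave_def
  proof (intro allI)
    fix x i
    obtain n where "k \<bullet> axis i 1 = of_int n" using inner_lattice_axis[OF trig_wave, of i]
      by (auto elim: Ints_cases)
    then have "2 * pi * (k \<bullet> (x + axis i 1)) + b = (2 * pi * (k \<bullet> x) + b) + 2 * pi * of_int n"
      by (simp add: inner_add_right algebra_simps)
    then show "c * cos (2 * pi * (k \<bullet> (x + axis i 1)) + b) = c * cos (2 * pi * (k \<bullet> x) + b)"
      by (simp only: cos_add[of _ "2 * pi * of_int n"]) (simp add: cos_int_2pin sin_int_2pin)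
  qed
qed (auto simp: periodic_def)

lemma c1_grad_wave: "c1_grad (wave c k b) (\<lambda>i. wave (2 * pi * c * k $ i) k (b + pi/2))"
  unfolding c1_grad_def
proof (intro conjI allI)
  fix x
  have e: "- (c * sin (2 * pi * (k \<bullet> x) + b)) = c * cos (2 * pi * (k \<bullet> x) + (b + pi/2))"
    by (simp add: add.assoc[symmetric] cos_add[of _ "pi/2"])
  have "((\<lambda>x. c * cos (2 * pi * (k \<bullet> x) + b)) has_derivative (\<lambda>h. c * (- sin (2 * pi * (k \<bullet> x) + b) * (2 * pi * (k \<bullet> h))))) (at x)"
    by (auto intro!: derivative_eq_intros)
  moreover have "(\<lambda>h. c * (- sin (2 * pi * (k \<bullet> x) + b) * (2 * pi * (k \<bullet> h)))) =
      (\<lambda>h. \<Sum>i\<in>UNIV. wave (2 * pi * c * k $ i) k (b + pi/2) x * h $ i)"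
  proof
    fix h
    have kh: "k \<bullet> h = (\<Sum>i\<in>UNIV. k $ i * h $ i)" by (simp add: inner_vec_def)
    have "c * (- sin (2 * pi * (k \<bullet> x) + b) * (2 * pi * (k \<bullet> h))) =
        2 * pi * (- (c * sin (2 * pi * (k \<bullet> x) + b))) * (k \<bullet> h)"
      by simp
    also have "\<dots> = (\<Sum>i\<in>UNIV. wave (2 * pi * c * k $ i) k (b + pi/2) x * h $ i)"
      unfolding e wave_def kh by (simp add: sum_distrib_left sum_distrib_right mult_ac)
    finally show "c * (- sin (2 * pi * (k \<bullet> x) + b) * (2 * pi * (k \<bullet> h))) =
        (\<Sum>i\<in>UNIV. wave (2 * pi * c * k $ i) k (b + pi/2) x * h $ i)" .
  qed
  ultimately show "(wave c k b has_derivative (\<lambda>h. \<Sum>i\<in>UNIV. wave (2 * pi * c * k $ i) k (b +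
      pi/2) x * h $ i)) (at x)"
    by (simp add: wave_def[abs_def])
  fix i show "continuous_on UNIV (wave (2 * pi * c * k $ i) k (b + pi/2))"
    unfolding wave_def[abs_def] by (intro continuous_intros)
qed

lemma trig_c1: "f \<in> trig \<Longrightarrow> c1_grad f (\<lambda>i. partial i f) \<and> (\<forall>i. partial i f \<in> trig)"
proof (induction rule: trig.induct)
  case (trig_wave k c b)
  have "(\<lambda>i. partial i (wave c k b)) = (\<lambda>i. wave (2 * pi * c * k $ i) k (b + pi/2))"
    by (intro ext c1_grad_partial[OF c1_grad_wave])
  then show ?case using c1_grad_wave[of c k b] trig_wave trig.trig_wave by simp metis
next
  case (trig_add f g)
  have c: "c1_grad (\<lambda>x. f x + g x) (\<lambda>i x. partial i f x + partial i g x)"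
    by (rule c1_grad_add) (use trig_add in auto)
  have p: "partial i (\<lambda>x. f x + g x) = (\<lambda>x. partial i f x + partial i g x)" for i
    by (intro ext c1_grad_partial[OF c])
  have "(\<lambda>x. partial i f x + partial i g x) \<in> trig" for i using trig_add by (intro trig.trig_add) auto
  then show ?case unfolding p using c by blast
qed

lemma trig_c1_grad: "f \<in> trig \<Longrightarrow> c1_grad f (\<lambda>i. partial i f)" using trig_c1 by blast
lemma trig_partial: "f \<in> trig \<Longrightarrow> partial i f \<in> trig" using trig_c1 by blast
lemma trig_cont: "f \<in> trig \<Longrightarrow> continuous_on UNIV f" using trig_c1_grad c1_grad_cont by blast
lemma trig_measurable: "f \<in> trig \<Longrightarrow> f \<in> borel_measurable borel"
  by (rule borel_measurable_continuous_onI[OF trig_cont])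

lemma zero_lattice: "0 \<in> lattice" by (simp add: lattice_def)

lemma trig_const: "(\<lambda>x. c) \<in> trig"
  using trig_wave[OF zero_lattice, of c 0] by (simp add: wave_def[abs_def])

lemma trig_cmult: "f \<in> trig \<Longrightarrow> (\<lambda>x. c * f x) \<in> trig"
proof (induction rule: trig.induct)
  case (trig_wave k c' b) then show ?case using trig.trig_wave[of k "c * c'" b]
    by (simp add: wave_def[abs_def] mult.assoc)
qed (auto intro: trig.trig_add simp: distrib_left)

lemma trig_uminus: "f \<in> trig \<Longrightarrow> (\<lambda>x. - f x) \<in> trig"
  using trig_cmult[of f "-1"] by simp

lemma trig_wave_mult: assumes "f \<in> trig" "k \<in> lattice" shows "(\<lambda>x. wave c k b x * f x) \<in> trig"
  using assms(1)
proof (induction rule: trig.induct)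
  case (trig_wave k' c' b')
  have eq: "(\<lambda>x. wave c k b x * wave c' k' b' x) =
      (\<lambda>x. wave (c * c' / 2) (k - k') (b - b') x + wave (c * c' / 2) (k + k') (b + b') x)"
    (is "?l = ?r")
  proof
    fix x
    have "?r x = c * c' / 2 * (cos ((2 * pi * (k \<bullet> x) + b) - (2 * pi * (k' \<bullet> x) + b')) +
        cos ((2 * pi * (k \<bullet> x) + b) + (2 * pi * (k' \<bullet> x) + b')))"
      unfolding wave_def by (simp add: inner_diff_left inner_add_left algebra_simps)
    also have "\<dots> = ?l x"
      unfolding wave_def cos_add[of "2 * pi * (k \<bullet> x) + b"] cos_diff[of "2 * pi * (k \<bullet> x) + b"] by simp
    finally show "?l x = ?r x" by simp
  qed
  have "k - k' \<in> lattice" "k + k' \<in> lattice" using assms trig_wave by (auto simp: lattice_def)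
  then show ?case unfolding eq by (intro trig.trig_add trig.trig_wave)
qed (auto intro: trig.trig_add simp: distrib_left)

lemma trig_mult: assumes "f \<in> trig" "g \<in> trig" shows "(\<lambda>x. f x * g x) \<in> trig"
  using assms(1)
  by (induction rule: trig.induct) (auto intro: trig.trig_add trig_wave_mult assms simp: distrib_right)

lemma trig_power: "f \<in> trig \<Longrightarrow> (\<lambda>x. f x ^ n) \<in> trig"
  by (induction n) (auto intro: trig_const trig_mult)

lemma trig_shift: "f \<in> trig \<Longrightarrow> (\<lambda>x. f (x - a)) \<in> trig"
proof (induction rule: trig.induct)
  case (trig_wave k c b)
  have "(\<lambda>x. wave c k b (x - a)) = wave c k (b - 2 * pi * (k \<bullet> a))"
    by (auto simp: wave_def fun_eq_iff inner_diff_right algebra_simps)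
  then show ?case using trig_wave by (simp add: trig.intros)
qed (auto intro: trig.trig_add)

lemma partial_shift: assumes "f \<in> trig" shows "partial i (\<lambda>y. f (y - a)) y = partial i f (y - a)"
proof -
  have "c1_grad (\<lambda>y. f (y - a)) (\<lambda>i y. partial i f (y - a))"
    unfolding c1_grad_def
  proof (intro conjI allI)
    fix y
    show "((\<lambda>y. f (y - a)) has_derivative (\<lambda>h. \<Sum>i\<in>UNIV. partial i f (y - a) * h $ i)) (at y)"
      by (rule has_derivative_compose[of "\<lambda>y. y - a" "\<lambda>h. h"
          y UNIV f, OF _ c1_gradD[OF trig_c1_grad[OF assms]]])
        (auto intro!: derivative_eq_intros)
    fix i show "continuous_on UNIV (\<lambda>y. partial i f (y - a))"
      by (rule continuous_on_compose2[OF trig_cont[OF trig_partial[OF assms]]])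
          (auto intro!: continuous_intros)
  qed
  then show ?thesis by (rule c1_grad_partial)
qed

lemma partial_scaleR_const: assumes "f \<in> trig"
    shows "partial i (\<lambda>y. f y *\<^sub>R (e::'a::euclidean_space)) y = partial i f y *\<^sub>R e"
proof -
  have "((\<lambda>y. f y *\<^sub>R e) has_derivative (\<lambda>h. (\<Sum>i\<in>UNIV. partial i f y * h $ i) *\<^sub>R e)) (at y)"
    by (rule has_derivative_scaleR_left[OF c1_gradD[OF trig_c1_grad[OF assms]]])
  then have "frechet_derivative (\<lambda>y. f y *\<^sub>R e) (at y) = (\<lambda>h. (\<Sum>i\<in>UNIV. partial i f y * h $ i) *\<^sub>R e)"
    by (rule frechet_derivative_at[symmetric])
  then show ?thesis by (subst partial_def) (simp add: sum_mult_axis)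
qed

lemma trig_smooth: assumes "f \<in> trig" shows "smooth_on UNIV (\<lambda>x. f x *\<^sub>R (e::'a::euclidean_space))"
proof (rule smooth_on_coinduct[of "{\<lambda>x. f x *\<^sub>R e |f. f \<in> trig}"])
  fix F assume "F \<in> {\<lambda>x. f x *\<^sub>R e |f. f \<in> trig}"
  then obtain f where f: "F = (\<lambda>x. f x *\<^sub>R e)" "f \<in> trig" by auto
  have "(F has_derivative (\<lambda>h. (\<Sum>i\<in>UNIV. partial i f x * h $ i) *\<^sub>R e)) (at x)" for x
    unfolding f(1) by (rule has_derivative_scaleR_left[OF c1_gradD[OF trig_c1_grad[OF f(2)]]])
  moreover have "(\<lambda>x. \<Sum>i\<in>UNIV. partial i f x * v $ i) \<in> trig" for v
    unfolding sum_3 by (intro trig.trig_add trig_mult trig_const trig_partial f)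
  ultimately show "\<exists>F'. (\<forall>x\<in>UNIV. (F has_derivative F' x) (at x)) \<and>
      (\<forall>v. (\<lambda>x. F' x v) \<in> {\<lambda>x. f x *\<^sub>R e |f. f \<in> trig})"
    by (intro exI[of _ "\<lambda>x h. (\<Sum>i\<in>UNIV. partial i f x * h $ i) *\<^sub>R e"]) auto
qed (use assms in \<open>auto intro: has_derivative_unique\<close>)

section \<open>Convolution\<close>

text \<open>
  Convolution of \<open>f\<close> with the reflection of \<open>J\<close>.  In this form \<open>conv J f x\<close> is \<open>f\<close> tested
  against the translate of \<open>J\<close> by \<open>x\<close>.
\<close>

definition conv :: "(real^3 \<Rightarrow> real) \<Rightarrow> (real^3 \<Rightarrow> real) \<Rightarrow> real^3 \<Rightarrow> real" where
  "conv J f x = (\<integral>y. J (y - x) * f y \<partial>tor)"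

lemma integrable_trig_mult:
  assumes "g \<in> trig" "integrable tor f"
  shows "integrable tor (\<lambda>y. g y * f y)"
proof -
  obtain C where C: "\<And>x. \<bar>g x\<bar> \<le> C"
    using periodic_continuous_bounded[OF trig_cont[OF assms(1)] trig_periodic[OF assms(1)]] by metis
  note [measurable] = trig_measurable[OF assms(1)]
  have "integrable tor (\<lambda>y. C * \<bar>f y\<bar>)" using assms(2) by auto
  then show ?thesis
  proof (rule Bochner_Integration.integrable_bound)
    show "(\<lambda>y. g y * f y) \<in> borel_measurable tor"
      using borel_measurable_integrable[OF assms(2)] by measurable
    show "AE x in tor. norm (g x * f x) \<le> norm (C * \<bar>f x\<bar>)"
      using C by (auto intro!: AE_I2 simp: abs_mult)
          (meson abs_ge_self mult_right_mono abs_ge_zero order_trans)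
  qed
qed

lemma conv_add: assumes "J \<in> trig" "J' \<in> trig" "integrable tor f"
  shows "conv (\<lambda>z. J z + J' z) f x = conv J f x + conv J' f x"
  unfolding conv_def
  by (simp add: distrib_right integrable_trig_mult[OF trig_shift] assms)

text \<open>
  Since the convolution of a wave with \<open>f\<close> is again a combination of two waves, no differentiation
  under the integral sign is needed.
\<close>

lemma conv_c1: assumes "J \<in> trig" "integrable tor f"
  shows "c1_grad (conv J f) (\<lambda>i. conv (\<lambda>z. - partial i J z) f)"
  using assms(1)
proof (induction rule: trig.induct)
  case (trig_wave k c b)
  define A where "A = (\<integral>y. wave c k b y * f y \<partial>tor)"
  define B where "B = (\<integral>y. wave c k (b - pi/2) y * f y \<partial>tor)"
  have w: "wave d k b' (y - x) = cos (2 * pi * (k \<bullet> x)) * wave d k b' y +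
      sin (2 * pi * (k \<bullet> x)) * wave d k (b' - pi/2) y" for d b' x y
  proof -
    have "wave d k b' (y - x) = d * cos ((2 * pi * (k \<bullet> y) + b') - 2 * pi * (k \<bullet> x))"
      by (simp add: wave_def inner_diff_right algebra_simps)
    moreover have "cos (2 * pi * (k \<bullet> y) + (b' - pi/2)) = sin (2 * pi * (k \<bullet> y) + b')"
      by (simp add: add_diff_eq cos_diff[of _ "pi/2"])
    ultimately show ?thesis by (simp add: cos_diff wave_def algebra_simps)
  qed
  have e: "conv (wave d k b') f x = wave (\<integral>y. wave d k b' y * f y \<partial>tor) k 0 x +
      wave (\<integral>y. wave d k (b' - pi/2) y * f y \<partial>tor) k (- pi/2) x" for d b' x
  proof -
    have "(\<lambda>y. wave d k b' (y - x) * f y) = (\<lambda>y. cos (2 * pi * (k \<bullet> x)) * (wave d k b' y * f y) +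
        sin (2 * pi * (k \<bullet> x)) * (wave d k (b' - pi/2) y * f y))"
      by (simp add: w algebra_simps)
    then have "conv (wave d k b') f x = cos (2 * pi * (k \<bullet> x)) * (\<integral>y. wave d k b' y * f y \<partial>tor) +
        sin (2 * pi * (k \<bullet> x)) * (\<integral>y. wave d k (b' - pi/2) y * f y \<partial>tor)"
      unfolding conv_def
      by (simp add: integrable_trig_mult[OF trig.trig_wave[OF trig_wave] assms(2)])
    then show ?thesis by (simp add: wave_def add_divide_distrib[symmetric] cos_diff[of _ "pi/2"])
  qed
  have g: "c1_grad (\<lambda>x. wave A k 0 x + wave B k (- pi/2) x) (\<lambda>i x. wave (2 * pi * A * k $ i) k (0 +
      pi/2) x + wave (2 * pi * B * k $ i) k (- pi/2 + pi/2) x)"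
    by (rule c1_grad_add[OF c1_grad_wave c1_grad_wave])
  have d: "wave (2 * pi * A * k $ i) k (0 + pi/2) x + wave (2 * pi * B * k $ i) k (- pi/2 + pi/2) x =
      conv (\<lambda>z. - partial i (wave c k b) z) f x" for i x
  proof -
    have p: "- partial i (wave c k b) z = wave (2 * pi * c * k $ i) k (b - pi/2) z" for z
      unfolding c1_grad_partial[OF c1_grad_wave] 
      by (simp add: wave_def add_diff_eq add.assoc[symmetric] cos_add[of _ "pi/2"]
          cos_diff[of _ "pi/2"])
    have 1: "(\<integral>y. wave (2 * pi * c * k $ i) k (b - pi/2) y * f y \<partial>tor) = 2 * pi * k $ i * B"
      unfolding B_def by (subst integral_mult_right_zero[symmetric])
          (auto simp: wave_def mult_ac intro!: Bochner_Integration.integral_cong)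
    have 2: "(\<integral>y. wave (2 * pi * c * k $ i) k (b - pi/2 - pi/2) y * f y \<partial>tor) = - (2 * pi * k $ i * A)"
    proof -
      have "wave (2 * pi * c * k $ i) k (b - pi/2 - pi/2) y * f y =
          - (2 * pi * k $ i) * (wave c k b y * f y)" for y
      proof -
        have "cos (2 * pi * (k \<bullet> y) + (b - pi/2 - pi/2)) = cos ((2 * pi * (k \<bullet> y) + b) - pi)"
          by (simp add: algebra_simps)
        also have "\<dots> = - cos (2 * pi * (k \<bullet> y) + b)" by (simp add: cos_diff)
        finally show ?thesis unfolding wave_def by simp
      qed
      then have "(\<integral>y. wave (2 * pi * c * k $ i) k (b - pi/2 - pi/2) y * f y \<partial>tor) =
          (\<integral>y. - (2 * pi * k $ i) * (wave c k b y * f y) \<partial>tor)" by simp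
      then show ?thesis unfolding A_def by simp
    qed
    show ?thesis
      unfolding p e 1 2 by (simp add: wave_def cos_add[of _ "pi/2"] cos_diff[of _ "pi/2"])
  qed
  have d0: "wave A k 0 x + wave B k (- pi/2) x = conv (wave c k b) f x" for x
    unfolding e A_def B_def ..
  show ?case by (rule c1_grad_eq[OF g d0 d])
next
  case (trig_add J J')
  have p: "partial i (\<lambda>x. J x + J' x) = (\<lambda>x. partial i J x + partial i J' x)" for i
    by (intro ext c1_grad_partial[OF c1_grad_add[OF trig_c1_grad trig_c1_grad]] trig_add)
  show ?case
  proof (rule c1_grad_eq[OF c1_grad_add[OF trig_add.IH]])
    fix i x
    show "conv (\<lambda>z. - partial i J z) f x + conv (\<lambda>z. - partial i J' z) f x =
        conv (\<lambda>z. - partial i (\<lambda>x. J x + J' x) z) f x"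
      using conv_add[OF trig_uminus[OF trig_partial[OF trig_add.hyps(1)]] trig_uminus[OF trig_partial[OF trig_add.hyps(2)]] assms(2), of i i x]
      by (simp add: p)
  qed (simp add: conv_add trig_add.hyps assms)
qed

lemma conv_periodic: "periodic J \<Longrightarrow> periodic (conv J f)"
  unfolding periodic_def conv_def
proof (intro allI)
  fix x i assume a: "\<forall>x i. J (x + axis i 1) = J x"
  have "J (y - (x + axis i 1)) = J (y - x)" for y
    using a[rule_format, of "y - (x + axis i 1)" i] by (simp add: algebra_simps)
  then show "(\<integral>y. J (y - (x + axis i 1)) * f y \<partial>tor) = (\<integral>y. J (y - x) * f y \<partial>tor)" by simp
qed

lemma conv_shift:
  assumes [measurable]: "J \<in> borel_measurable borel" "f \<in> borel_measurable borel"
      and "periodic J" "periodic f"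
  shows "conv J f x = (\<integral>z. J z * f (x + z) \<partial>tor)"
proof -
  have "periodic (\<lambda>y. J (y - x) * f y)"
    using periodic_shift[OF assms(3), of "-x"] assms(4) by (auto simp: periodic_def)
  then have "(\<integral>z. J (z + x - x) * f (z + x) \<partial>tor) = (\<integral>y. J (y - x) * f y \<partial>tor)"
    by (intro integral_tor_shift[of "\<lambda>y. J (y - x) * f y"]) measurable
  then show ?thesis by (simp add: conv_def add.commute)
qed

section \<open>Approximate identity\<close>

lemma LIMSEQ_0_ex:
  fixes X :: "nat \<Rightarrow> real"
  assumes "X \<longlonglongrightarrow> 0" "\<epsilon> > 0" obtains n where "\<bar>X n\<bar> < \<epsilon>"
  using LIMSEQ_D[OF assms] by auto

text \<open>
  A trigonometric polynomial with values in \<open>[0,1]\<close> that equals \<open>1\<close> exactly on the lattice.  Its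
  normalised powers \<open>kern n\<close> concentrate at the lattice.
\<close>

definition bump :: "real^3 \<Rightarrow> real" where
  "bump z = (\<Prod>i\<in>UNIV. (1 + cos (2 * pi * z $ i)) / 2)"

definition kern :: "nat \<Rightarrow> real^3 \<Rightarrow> real" where
  "kern n z = bump z ^ n / (\<integral>y. bump y ^ n \<partial>tor)"

lemma axis_lattice: "axis i 1 \<in> lattice"
  by (auto simp: lattice_def axis_def)

lemma bump_trig: "bump \<in> trig"
proof -
  have *: "(\<lambda>z. (1 + cos (2 * pi * z $ i)) / 2) \<in> trig" for i
  proof -
    have "(\<lambda>z. 1/2 + wave (1/2) (axis i 1) 0 z) \<in> trig"
      by (intro trig_add trig_const trig_wave axis_lattice)
    also have "(\<lambda>z. 1/2 + wave (1/2) (axis i 1) 0 z) = (\<lambda>z. (1 + cos (2 * pi * z $ i)) / 2)"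
      by (auto simp: wave_def fun_eq_iff inner_axis' add_divide_distrib)
    finally show ?thesis .
  qed
  have e: "bump = (\<lambda>z. ((1 + cos (2 * pi * z $ 1)) / 2) * (((1 + cos (2 * pi * z $ 2)) / 2) * ((1 + cos (2 * pi * z $ 3)) / 2)))"
    unfolding bump_def UNIV_3 by (rule ext) (simp add: mult.assoc)
  show ?thesis unfolding e by (rule trig_mult[OF *[of 1] trig_mult[OF *[of 2] *[of 3]]])
qed

lemma bump_bounds: "0 \<le> bump z" "bump z \<le> 1"
proof -
  have "0 \<le> 1 + cos x" for x :: real using cos_ge_minus_one[of x] by linarith
  then show "0 \<le> bump z" "bump z \<le> 1" unfolding bump_def
    by (auto intro!: prod_nonneg prod_le_1)
qed

lemma bump_0: "bump 0 = 1" by (simp add: bump_def)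

lemma bump_eq_1: assumes "bump z = 1" shows "z \<in> lattice"
  unfolding lattice_def
proof (intro CollectI allI)
  fix i
  have ge: "0 \<le> 1 + cos x" for x :: real using cos_ge_minus_one[of x] by linarith
  have "bump z = (1 + cos (2 * pi * z $ i)) / 2 * (\<Prod>i\<in>UNIV - {i}. (1 + cos (2 * pi * z $ i)) / 2)"
    unfolding bump_def by (subst prod.remove[of _ i]) auto
  also have "\<dots> \<le> (1 + cos (2 * pi * z $ i)) / 2 * 1"
    by (intro mult_left_mono prod_le_1) (auto simp: ge)
  finally have "cos (2 * pi * z $ i) \<ge> 1" using assms by simp
  then have "cos (2 * pi * z $ i) = 1" using cos_le_one[of "2 * pi * z $ i"] by linarith
  then obtain n :: int where "2 * pi * z $ i = of_int n * (2 * pi)" unfolding cos_one_2pi_int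
    by (auto simp: mult_ac)
  then have "z $ i = of_int n" by simp
  then show "z $ i \<in> \<int>" by simp
qed

lemma bump_near_0:
  assumes "q < 1"
  obtains r where "0 < r" "r \<le> 1" "\<And>z. z \<in> cbox 0 (r *\<^sub>R 1) \<Longrightarrow> bump z > q"
proof -
  have "open (bump -` {q<..})"
    by (rule open_vimage[OF open_greaterThan trig_cont[OF bump_trig]])
  moreover have "0 \<in> bump -` {q<..}" using assms by (simp add: bump_0)
  ultimately obtain e where e: "e > 0" "ball 0 e \<subseteq> bump -` {q<..}" by (meson openE)
  define r where "r = min 1 (e / 4)"
  show thesis
  proof
    show "0 < r" "r \<le> 1" using e by (auto simp: r_def)
    fix z :: "real^3" assume "z \<in> cbox 0 (r *\<^sub>R 1)"
    then have "\<bar>z $ i\<bar> \<le> e / 4" for i by (auto simp: mem_box_cart r_def)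
    then have "(\<Sum>i\<in>UNIV. \<bar>z $ i\<bar>) \<le> (\<Sum>i\<in>(UNIV::3 set). e / 4)" by (intro sum_mono) auto
    then have "norm z \<le> 3 * (e / 4)" using norm_le_l1_cart[of z] by simp
    then have "z \<in> ball 0 e" using e by simp
    then show "bump z > q" using e by auto
  qed
qed

text \<open>
  The mass of the \<open>n\<close>-th power is bounded below by a multiple of every geometric sequence with
  ratio below \<open>1\<close>.
\<close>

lemma integral_bump_lower:
  assumes "0 \<le> q" "q < 1"
  obtains m where "m > 0" "\<And>n. (\<integral>y. bump y ^ n \<partial>tor) \<ge> m * q ^ n"
proof -
  obtain r where r: "0 < r" "r \<le> 1" "\<And>z. z \<in> cbox 0 (r *\<^sub>R 1) \<Longrightarrow> bump z > q"
    using bump_near_0[OF assms(2)] by metis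
  let ?C = "cbox 0 (r *\<^sub>R (1::real^3))"
  have sub: "?C \<subseteq> cbox 0 1" using r by (auto simp: mem_box_cart) (meson order_trans)
  have one: "b \<in> Basis \<Longrightarrow> (1::real^3) \<bullet> b = 1" for b by (auto simp: Basis_vec_def inner_axis)
  have m: "measure lborel ?C = r ^ 3"
    using r by (simp add: measure_lborel_cbox_eq one)
  note [measurable] = trig_measurable[OF bump_trig]
  show thesis
  proof
    show "r ^ 3 > 0" using r by simp
    fix n
    have "r ^ 3 * q ^ n = (\<integral>y. q ^ n * indicator ?C y \<partial>lborel)"
      using m by simp
    also have "\<dots> = (\<integral>y. q ^ n * indicator ?C y \<partial>tor)"
      by (subst integral_unif) (use sub in \<open>auto simp: set_lebesgue_integral_def indicator_def intro!:
          Bochner_Integration.integral_cong\<close>)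
    also have "\<dots> \<le> (\<integral>y. bump y ^ n \<partial>tor)"
    proof (rule integral_mono)
      show "integrable tor (\<lambda>y. q ^ n * indicator ?C y)"
        by (rule integrable_unif_bounded[of _ _ _ "q ^ n"]) (use assms in \<open>auto simp: indicator_def\<close>)
      show "integrable tor (\<lambda>y. bump y ^ n)"
        by (rule integrable_unif_continuous[OF trig_cont[OF trig_power[OF bump_trig]]])
      fix y show "q ^ n * indicator ?C y \<le> bump y ^ n"
        using r(3)[of y] assms bump_bounds[of y] by (auto simp: indicator_def intro!: power_mono)
    qed
    finally show "r ^ 3 * q ^ n \<le> (\<integral>y. bump y ^ n \<partial>tor)" .
  qed
qed

lemma integral_bump_pos: "(\<integral>y. bump y ^ n \<partial>tor) > 0"
proof -
  obtain m where m: "m > 0" "\<And>n. (\<integral>y. bump y ^ n \<partial>tor) \<ge> m * (1/2) ^ n"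
    by (rule integral_bump_lower[of "1/2"]) auto
  have "0 < m * (1/2) ^ n" using m(1) by simp
  then show ?thesis using m(2)[of n] by linarith
qed

lemma kern_trig: "kern n \<in> trig"
  using trig_cmult[OF trig_power[OF bump_trig], of "1 / (\<integral>y. bump y ^ n \<partial>tor)" n]
    by (simp add: kern_def[abs_def])

lemma kern_nonneg: "0 \<le> kern n z"
  unfolding kern_def using bump_bounds[of z] integral_bump_pos[of n] by simp

lemma kern_integrable: "integrable tor (kern n)"
  by (rule integrable_unif_continuous[OF trig_cont[OF kern_trig]])

lemma kern_integral: "(\<integral>z. kern n z \<partial>tor) = 1"
  unfolding kern_def using integral_bump_pos[of n] by simp

lemma closed_lattice: "closed lattice"
proof -
  have "closed ((\<lambda>k::real^3. k $ i) -` \<int>)" for i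
    by (rule closed_vimage) (auto intro!: continuous_intros)
  then have "closed (\<Inter>i. (\<lambda>k::real^3. k $ i) -` \<int>)" by (intro closed_INT ballI)
  also have "(\<Inter>i. (\<lambda>k::real^3. k $ i) -` \<int>) = lattice" by (auto simp: lattice_def)
  finally show ?thesis .
qed

text \<open>
  Away from the lattice, \<open>bump\<close> is at most some \<open>q < 1\<close>, so that the normalised powers decay there
  like \<open>(q / p)\<^sup>n\<close> for any \<open>p\<close> between \<open>q\<close> and \<open>1\<close>.
\<close>

lemma kern_concentrates:
  fixes \<tau> :: "real^3 \<Rightarrow> real"
  assumes [measurable]: "\<tau> \<in> borel_measurable borel" and per: "periodic \<tau>"
    and b: "\<And>z. 0 \<le> \<tau> z" "\<And>z. \<tau> z \<le> M"
    and small: "\<And>\<epsilon>. \<epsilon> > 0 \<Longrightarrow> \<exists>\<delta>>0. \<forall>h. norm h < \<delta> \<longrightarrow> \<tau> h < \<epsilon>"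
  shows "(\<lambda>n. \<integral>z. kern n z * \<tau> z \<partial>tor) \<longlonglongrightarrow> 0"
proof (rule LIMSEQ_I)
  fix \<epsilon> :: real assume \<epsilon>: "\<epsilon> > 0"
  obtain \<delta> where \<delta>: "\<delta> > 0" "\<And>h. norm h < \<delta> \<Longrightarrow> \<tau> h < \<epsilon> / 2" using small[of "\<epsilon>/2"] \<epsilon> by auto
  define K where "K = cbox 0 1 \<inter> {z. infdist z lattice \<ge> \<delta>}"
  have Kc: "compact K" unfolding K_def
    by (intro compact_Int_closed compact_cbox closed_Collect_le continuous_intros continuous_on_infdist)
  have [measurable]: "K \<in> sets borel" using Kc by (simp add: borel_compact)
  have bumpK: "bump z < 1" if "z \<in> K" for z
  proof -
    have "z \<notin> lattice" using that \<delta> by (auto simp: K_def)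
    then have "bump z \<noteq> 1" using bump_eq_1 by auto
    then show ?thesis using bump_bounds[of z] by simp
  qed
  have "\<exists>q. 0 \<le> q \<and> q < 1 \<and> (\<forall>z\<in>K. bump z \<le> q)"
  proof (cases "K = {}")
    case False
    obtain w where "w \<in> K" "\<forall>z\<in>K. bump z \<le> bump w"
      using continuous_attains_sup[OF Kc False continuous_on_subset[OF trig_cont[OF bump_trig]]] by auto
    then show ?thesis using bumpK bump_bounds by blast
  qed (auto intro: exI[of _ 0])
  then obtain q where q: "0 \<le> q" "q < 1" "\<And>z. z \<in> K \<Longrightarrow> bump z \<le> q" by auto
  \<comment> \<open>the lower bound on the normalising integral needs a ratio strictly between \<open>q\<close> and \<open>1\<close>\<close>
  define p where "p = (1 + q) / 2"
  have p: "0 < p" "p < 1" "q < p" using q by (auto simp: p_def)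
  obtain m where m: "m > 0" "\<And>n. (\<integral>y. bump y ^ n \<partial>tor) \<ge> m * p ^ n"
    by (rule integral_bump_lower[of p]) (use p in auto)
  have M: "M \<ge> 0" using b order_trans by blast
  have JK: "kern n z \<le> (q / p) ^ n / m" if "z \<in> K" for z n
  proof -
    have "kern n z \<le> q ^ n / (m * p ^ n)" unfolding kern_def
      by (rule frac_le) (use q(1) q(3)[OF that] bump_bounds m p in \<open>auto intro: power_mono\<close>)
    then show ?thesis by (simp add: power_divide field_simps)
  qed
  note [measurable] = trig_measurable[OF kern_trig]
  have bound: "(\<integral>z. kern n z * \<tau> z \<partial>tor) \<le> \<epsilon> / 2 + M / m * (q / p) ^ n" for n
  proof -
    have "(\<integral>z. kern n z * \<tau> z \<partial>tor) \<le> (\<integral>z. kern n z * (\<epsilon> / 2) + M / m * (q / p) ^ n \<partial>tor)"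
    proof (rule integral_mono_AE)
      show "integrable tor (\<lambda>z. kern n z * \<tau> z)"
      proof (rule Bochner_Integration.integrable_bound[of _ "\<lambda>z. kern n z * M"])
        show "AE x in tor. norm (kern n x * \<tau> x) \<le> norm (kern n x * M)"
          using b M kern_nonneg by (auto simp: abs_mult intro!: AE_I2 mult_left_mono)
      qed (auto intro: kern_integrable)
      show "integrable tor (\<lambda>z. kern n z * (\<epsilon> / 2) + M / m * (q / p) ^ n)"
        by (intro Bochner_Integration.integrable_add integrable_mult_left kern_integrable) auto
      have "kern n z * \<tau> z \<le> kern n z * (\<epsilon> / 2) + M / m * (q / p) ^ n" if "z \<in> cbox 0 1" for z
      proof (cases "z \<in> K")
        case True
        have "kern n z * \<tau> z \<le> (q / p) ^ n / m * M"
          by (rule mult_mono) (use JK[OF True] b m p q in auto)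
        also have "\<dots> \<le> kern n z * (\<epsilon> / 2) + M / m * (q / p) ^ n"
          using kern_nonneg[of n z] \<epsilon> by (simp add: mult_ac)
        finally show ?thesis .
      next
        case False
        then have "infdist z lattice < \<delta>" using that by (auto simp: K_def)
        then obtain k where k: "k \<in> lattice" "dist z k < \<delta>"
          using zero_lattice by (auto simp: infdist_def cInf_less_iff split: if_splits)
        have "\<tau> z = \<tau> (z - k)" using periodic_lattice[OF per k(1), of "z - k"] by simp
        then have "\<tau> z \<le> \<epsilon> / 2" using \<delta>(2)[of "z - k"] k by (simp add: dist_norm)
        then have "kern n z * \<tau> z \<le> kern n z * (\<epsilon> / 2)" by (rule mult_left_mono[OF _ kern_nonneg])
        moreover have "0 \<le> M / m * (q / p) ^ n" using M m p q by simp
        ultimately show ?thesis by simp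
      qed
      then show "AE x in tor. kern n x * \<tau> x \<le> kern n x * (\<epsilon> / 2) + M / m * (q / p) ^ n"
        by (auto simp: AE_unif)
    qed
    also have "\<dots> = \<epsilon> / 2 + M / m * (q / p) ^ n"
      by (simp add: kern_integrable kern_integral measure_def)
    finally show ?thesis .
  qed
  have "(\<lambda>n. M / m * (q / p) ^ n) \<longlonglongrightarrow> 0"
    using LIMSEQ_power_zero[of "q / p"] p q by (intro tendsto_mult_right_zero) auto
  then obtain N where N: "\<And>n. n \<ge> N \<Longrightarrow> \<bar>M / m * (q / p) ^ n\<bar> < \<epsilon> / 2"
    using \<epsilon> by (metis LIMSEQ_D half_gt_zero_iff diff_zero real_norm_def)
  show "\<exists>N. \<forall>n\<ge>N. norm ((\<integral>z. kern n z * \<tau> z \<partial>tor) - 0) < \<epsilon>"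
  proof (intro exI allI impI)
    fix n assume "n \<ge> N"
    then have "M / m * (q / p) ^ n < \<epsilon> / 2" using N[of n] by linarith
    then have "(\<integral>z. kern n z * \<tau> z \<partial>tor) < \<epsilon>" using bound[of n] by linarith
    moreover have "0 \<le> (\<integral>z. kern n z * \<tau> z \<partial>tor)" using b kern_nonneg
      by (intro Bochner_Integration.integral_nonneg) auto
    ultimately show "norm ((\<integral>z. kern n z * \<tau> z \<partial>tor) - 0) < \<epsilon>" by simp
  qed
qed

text \<open>
  Continuity of translations in \<open>L\<^sup>1\<close>, first for bounded functions, which are limits almost
  everywhere of continuous functions with the same bound.
\<close>

lemma translation_continuous_bounded:
  fixes f :: "real^3 \<Rightarrow> real"
  assumes [measurable]: "f \<in> borel_measurable borel" and b: "\<And>x. \<bar>f x\<bar> \<le> M" and "\<epsilon> > 0"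
  shows "\<exists>\<delta>>0. \<forall>h. norm h < \<delta> \<longrightarrow> (\<integral>x. \<bar>f (x + h) - f x\<bar> \<partial>tor) < \<epsilon>"
proof -
  have M: "M \<ge> 0" using b order_trans abs_ge_zero by blast
  let ?big = "unif (-1) (2::real^3)"
  have "f \<in> borel_measurable lebesgue" by (rule measurable_completion) simp
  then have "f measurable_on UNIV" by (intro lebesgue_measurable_imp_measurable_on_real) auto
  then obtain N g0 where N: "negligible N" and g0: "\<And>n. continuous_on UNIV (g0 n)" 
    "\<And>x. x \<notin> N \<Longrightarrow> (\<lambda>n. g0 n x) \<longlonglongrightarrow> f x"
    unfolding measurable_on_def by auto
  define g where "g n x = max (-M) (min M (g0 n x))" for n :: nat and x
  have gc: "continuous_on UNIV (g n)" for n unfolding g_def by (intro continuous_intros g0)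
  have gb: "\<bar>g n x\<bar> \<le> M" for n x using M by (auto simp: g_def)
  have [measurable]: "g n \<in> borel_measurable borel" for n
    by (rule borel_measurable_continuous_onI[OF gc])
  have "AE x in lebesgue. x \<notin> N" using N unfolding negligible_iff_null_sets by (rule AE_not_in)
  then have aeN: "AE x in ?big. x \<notin> N" by (auto simp: AE_completion_iff intro: AE_unifI)
  have "(\<lambda>n. \<integral>x. \<bar>f x - g n x\<bar> \<partial>?big) \<longlonglongrightarrow> (\<integral>x. 0 \<partial>?big)"
  proof (rule integral_dominated_convergence)
    show "AE x in ?big. (\<lambda>n. \<bar>f x - g n x\<bar>) \<longlonglongrightarrow> 0"
      using aeN
    proof eventually_elim
      case (elim x)
      have "(\<lambda>n. \<bar>f x - g n x\<bar>) \<longlonglongrightarrow> \<bar>f x - max (-M) (min M (f x))\<bar>"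
        unfolding g_def by (intro tendsto_intros g0 elim)
      also have "max (-M) (min M (f x)) = f x" using b[of x] by auto
      finally show ?case by simp
    qed
    show "AE x in ?big. norm \<bar>f x - g n x\<bar> \<le> 2 * M" for n
    proof (rule AE_I2)
      fix x show "norm \<bar>f x - g n x\<bar> \<le> 2 * M" using gb[of n x] b[of x] unfolding real_norm_def by arith
    qed
  qed auto
  then have "(\<lambda>n. \<integral>x. \<bar>f x - g n x\<bar> \<partial>?big) \<longlonglongrightarrow> 0" by simp
  then obtain n where "\<bar>\<integral>x. \<bar>f x - g n x\<bar> \<partial>?big\<bar> < \<epsilon> / 4"
    by (rule LIMSEQ_0_ex[where \<epsilon>="\<epsilon>/4"]) (use \<open>\<epsilon> > 0\<close> in auto)
  then have gn: "(\<integral>x. \<bar>f x - g n x\<bar> \<partial>?big) < \<epsilon> / 4" by simp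
  define G where "G = g n"
  have [measurable]: "G \<in> borel_measurable borel" by (simp add: G_def)
  have fG: "\<bar>f x - G x\<bar> \<le> 2 * M" for x using b[of x] gb[of n x] unfolding G_def by arith
  have ff: "\<bar>f x - f y\<bar> \<le> 2 * M" for x y using b[of x] b[of y] by arith
  have near: "(\<integral>x. \<bar>f (x + h) - G (x + h)\<bar> \<partial>tor) < \<epsilon> / 4" if "norm h < 1" for h
  proof -
    have in': "x + h \<in> cbox (-1) 2" if "x \<in> cbox 0 1" for x
    proof -
      have "\<bar>h $ i\<bar> < 1" for i using component_le_norm_cart[of h i] \<open>norm h < 1\<close> by linarith
      moreover have "0 \<le> x $ i" "x $ i \<le> 1" for i using \<open>x \<in> cbox 0 1\<close> by (auto simp: mem_box_cart)
      ultimately have "- 1 \<le> x $ i + h $ i \<and> x $ i + h $ i \<le> 2" for i by (smt (verit))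
      then show ?thesis by (simp add: mem_box_cart)
    qed
    have nn: "(\<integral>\<^sup>+x. \<bar>f (x + h) - G (x + h)\<bar> \<partial>tor) \<le> (\<integral>\<^sup>+x. \<bar>f x - G x\<bar> \<partial>?big)"
    proof -
      have "(\<integral>\<^sup>+x. \<bar>f (x + h) - G (x + h)\<bar> \<partial>tor) \<le>
          (\<integral>\<^sup>+x. ennreal \<bar>f (x + h) - G (x + h)\<bar> * indicator (cbox (-1) 2) (x + h) \<partial>lborel)"
        by (subst nn_integral_unif) (auto intro!: nn_integral_mono simp: indicator_def in')
      also have "\<dots> = (\<integral>\<^sup>+x. ennreal \<bar>f x - G x\<bar> * indicator (cbox (-1) 2) x \<partial>lborel)"
        by (rule nn_integral_lborel_shift[of "\<lambda>x. ennreal \<bar>f x - G x\<bar> * indicator (cbox (-1) 2) x"])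
            measurable
      finally show ?thesis by (simp add: nn_integral_unif)
    qed
    have i1: "integrable tor (\<lambda>x. \<bar>f (x + h) - G (x + h)\<bar>)"
      by (rule integrable_unif_bounded[of _ _ _ "2 * M"]) (use fG in auto)
    have i2: "integrable ?big (\<lambda>x. \<bar>f x - G x\<bar>)"
      by (rule integrable_unif_bounded[of _ _ _ "2 * M"]) (use fG in auto)
    have "(\<integral>x. \<bar>f (x + h) - G (x + h)\<bar> \<partial>tor) \<le> (\<integral>x. \<bar>f x - G x\<bar> \<partial>?big)"
      using nn by (simp add: nn_integral_eq_integral i1 i2)
    then show ?thesis using gn by (simp add: G_def)
  qed
  have "uniformly_continuous_on (cbox (-1) 2) G"
    by (rule compact_uniformly_continuous) (auto simp: G_def intro: continuous_on_subset[OF gc])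
  moreover have "\<epsilon> / 4 > 0" using \<open>\<epsilon> > 0\<close> by simp
  ultimately obtain d where d: "d > 0" "\<And>x y. x \<in> cbox (-1) 2 \<Longrightarrow> y \<in> cbox (-1) 2 \<Longrightarrow> dist y x < d \<Longrightarrow>
      dist (G y) (G x) < \<epsilon> / 4"
    unfolding uniformly_continuous_on_def by meson
  show ?thesis
  proof (intro exI[of _ "min d 1"] conjI allI impI)
    show "min d 1 > 0" using d by simp
    fix h :: "real^3" assume h: "norm h < min d 1"
    have i1: "integrable tor (\<lambda>x. \<bar>f (x + h') - G (x + h')\<bar>)" for h'
      by (rule integrable_unif_bounded[of _ _ _ "2 * M"]) (use fG in auto)
    have "(\<integral>x. \<bar>f (x + h) - f x\<bar> \<partial>tor) \<le> (\<integral>x. \<bar>f (x + h) - G (x + h)\<bar> + \<epsilon> / 4 +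
        \<bar>f (x + 0) - G (x + 0)\<bar> \<partial>tor)"
    proof (rule integral_mono_AE)
      show "integrable tor (\<lambda>x. \<bar>f (x + h) - f x\<bar>)"
        by (rule integrable_unif_bounded[of _ _ _ "2 * M"]) (use ff in auto)
      show "integrable tor (\<lambda>x. \<bar>f (x + h) - G (x + h)\<bar> + \<epsilon> / 4 + \<bar>f (x + 0) - G (x + 0)\<bar>)"
        using i1[of h] i1[of 0] by auto
      have "\<bar>f (x + h) - f x\<bar> \<le> \<bar>f (x + h) - G (x + h)\<bar> + \<epsilon> / 4 + \<bar>f (x + 0) - G (x + 0)\<bar>"
          if x: "x \<in> cbox 0 1" for x
      proof -
        have hi: "\<bar>h $ i\<bar> < 1" for i using component_le_norm_cart[of h i] h by (smt (verit))
        have xi: "0 \<le> x $ i" "x $ i \<le> 1" for i using x by (auto simp: mem_box_cart)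
        have "- 1 \<le> x $ i + h $ i \<and> x $ i + h $ i \<le> 2" for i using hi[of i] xi[of i] by (smt (verit))
        then have "x + h \<in> cbox (-1) 2" by (simp add: mem_box_cart)
        moreover have "- 1 \<le> x $ i \<and> x $ i \<le> 2" for i using xi[of i] by (smt (verit))
        then have "x \<in> cbox (-1) 2" by (simp add: mem_box_cart)
        ultimately have "dist (G (x + h)) (G x) < \<epsilon> / 4" using h by (intro d) (auto simp: dist_norm)
        then show ?thesis unfolding dist_real_def add_0_right by arith
      qed
      then show "AE x in tor. \<bar>f (x + h) - f x\<bar> \<le>
          \<bar>f (x + h) - G (x + h)\<bar> + \<epsilon> / 4 + \<bar>f (x + 0) - G (x + 0)\<bar>"
        by (auto simp: AE_unif)
    qed
    also have "\<dots> = (\<integral>x. \<bar>f (x + h) - G (x + h)\<bar> \<partial>tor) + \<epsilon> / 4 + (\<integral>x. \<bar>f (x + 0) - G (x + 0)\<bar> \<partial>tor)"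
      using i1[of h] i1[of 0] by (simp add: measure_def)
    also have "\<dots> < \<epsilon>" using near[of h] near[of 0] h \<open>\<epsilon> > 0\<close> by auto
    finally show "(\<integral>x. \<bar>f (x + h) - f x\<bar> \<partial>tor) < \<epsilon>" .
  qed
qed

lemma integrable_tor_shift:
  fixes f :: "real^3 \<Rightarrow> real"
  assumes [measurable]: "f \<in> borel_measurable borel" and "periodic f" "integrable tor f"
  shows "integrable tor (\<lambda>x. f (x + a))"
proof -
  have "(\<integral>\<^sup>+x. ennreal (norm (f (x + a))) \<partial>tor) = (\<integral>\<^sup>+x. ennreal (norm (f x)) \<partial>tor)"
    using assms(2) by (intro nn_integral_tor_shift[of "\<lambda>x. ennreal (norm (f x))"])
        (auto simp: periodic_def)
  then show ?thesis using assms(3) by (simp add: integrable_iff_bounded)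
qed

lemma translation_continuous:
  fixes f :: "real^3 \<Rightarrow> real"
  assumes [measurable]: "f \<in> borel_measurable borel" and per: "periodic f" and int: "integrable tor f"
      and "\<epsilon> > 0"
  shows "\<exists>\<delta>>0. \<forall>h. norm h < \<delta> \<longrightarrow> (\<integral>x. \<bar>f (x + h) - f x\<bar> \<partial>tor) < \<epsilon>"
proof -
  define g where "g n x = max (- real n) (min (real n) (f x))" for n x
  have [measurable]: "g n \<in> borel_measurable borel" for n unfolding g_def by measurable
  have gb: "\<bar>g n x\<bar> \<le> real n" "\<bar>g n x\<bar> \<le> \<bar>f x\<bar>" for n x by (auto simp: g_def)
  have gi: "integrable tor (g n)" for n by (rule integrable_unif_bounded[of _ _ _ "real n"])
      (auto simp: gb)
  have gp: "periodic (g n)" for n using per by (simp add: periodic_def g_def)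
  have "(\<lambda>n. \<integral>x. \<bar>f x - g n x\<bar> \<partial>tor) \<longlonglongrightarrow> (\<integral>x. 0 \<partial>tor)"
  proof (rule integral_dominated_convergence)
    show "integrable tor (\<lambda>x. 2 * \<bar>f x\<bar>)" using int by auto
    show "AE x in tor. (\<lambda>n. \<bar>f x - g n x\<bar>) \<longlonglongrightarrow> 0"
    proof (rule AE_I2)
      fix x
      obtain N where N: "\<bar>f x\<bar> < real N" using reals_Archimedean2 by blast
      have "eventually (\<lambda>n. \<bar>f x - g n x\<bar> = 0) sequentially"
        using eventually_ge_at_top[of N] by eventually_elim (use N in \<open>auto simp: g_def\<close>)
      then show "(\<lambda>n. \<bar>f x - g n x\<bar>) \<longlonglongrightarrow> 0" by (rule tendsto_eventually)
    qed
    show "AE x in tor. norm \<bar>f x - g n x\<bar> \<le> 2 * \<bar>f x\<bar>" for n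
    proof (rule AE_I2)
      fix x show "norm \<bar>f x - g n x\<bar> \<le> 2 * \<bar>f x\<bar>" using gb(2)[of n x] unfolding real_norm_def by arith
    qed
  qed auto
  then have "(\<lambda>n. \<integral>x. \<bar>f x - g n x\<bar> \<partial>tor) \<longlonglongrightarrow> 0" by simp
  then obtain n where "\<bar>\<integral>x. \<bar>f x - g n x\<bar> \<partial>tor\<bar> < \<epsilon> / 3"
    by (rule LIMSEQ_0_ex[where \<epsilon>="\<epsilon>/3"]) (use \<open>\<epsilon> > 0\<close> in auto)
  then have gn: "(\<integral>x. \<bar>f x - g n x\<bar> \<partial>tor) < \<epsilon> / 3" by simp
  obtain \<delta> where \<delta>: "\<delta> > 0" "\<And>h. norm h < \<delta> \<Longrightarrow> (\<integral>x. \<bar>g n (x + h) - g n x\<bar> \<partial>tor) < \<epsilon> / 3"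
    using translation_continuous_bounded[of "g n" "real n" "\<epsilon>/3"] gb \<open>\<epsilon> > 0\<close> by auto
  show ?thesis
  proof (intro exI[of _ \<delta>] conjI allI impI \<delta>)
    fix h :: "real^3" assume h: "norm h < \<delta>"
    have ifg: "integrable tor (\<lambda>x. f x - g n x)" using int gi by auto
    have i2: "integrable tor (\<lambda>x. f (x + h) - g n (x + h))"
      by (rule integrable_tor_shift[of "\<lambda>x. f x - g n x"])
          (use ifg per gp[of n] in \<open>auto simp: periodic_def\<close>)
    have e2: "(\<integral>x. \<bar>f (x + h) - g n (x + h)\<bar> \<partial>tor) = (\<integral>x. \<bar>f x - g n x\<bar> \<partial>tor)"
      by (rule integral_tor_shift[of "\<lambda>x. \<bar>f x - g n x\<bar>"])
          (use per gp[of n] in \<open>auto simp: periodic_def\<close>)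
    have "(\<integral>x. \<bar>f (x + h) - f x\<bar> \<partial>tor) \<le> (\<integral>x. \<bar>f (x + h) - g n (x + h)\<bar> + \<bar>g n (x + h) - g n x\<bar> +
        \<bar>f x - g n x\<bar> \<partial>tor)"
      by (rule integral_mono) (use ifg i2 integrable_tor_shift[OF _ per int,
          of h] integrable_tor_shift[OF _ gp gi, of n h] int gi in auto)
    also have "\<dots> = (\<integral>x. \<bar>f (x + h) - g n (x + h)\<bar> \<partial>tor) + (\<integral>x. \<bar>g n (x + h) - g n x\<bar> \<partial>tor) +
        (\<integral>x. \<bar>f x - g n x\<bar> \<partial>tor)"
      using ifg i2 integrable_tor_shift[OF _ gp gi, of n h] gi[of n] by simp
    also have "\<dots> < \<epsilon>" unfolding e2 using gn \<delta>(2)[OF h] by simp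
    finally show "(\<integral>x. \<bar>f (x + h) - f x\<bar> \<partial>tor) < \<epsilon>" .
  qed
qed

lemma conv_kern_nn_bound:
  assumes [measurable]: "f \<in> borel_measurable borel" and per: "periodic f" and int: "integrable tor f"
  shows "ennreal \<bar>conv (kern n) f x - c\<bar> \<le> (\<integral>\<^sup>+z. ennreal (kern n z) * ennreal \<bar>f (x + z) - c\<bar> \<partial>tor)"
proof -
  note [measurable] = trig_measurable[OF kern_trig]
  have i: "integrable tor (\<lambda>z. f (x + z))" using integrable_tor_shift[OF assms, of x]
    by (simp add: add.commute)
  have i1: "integrable tor (\<lambda>z. kern n z * f (x + z))" by (rule integrable_trig_mult[OF kern_trig i])
  have i2: "integrable tor (\<lambda>z. kern n z * c)" by (auto intro: kern_integrable)
  have "conv (kern n) f x - c = (\<integral>z. kern n z * f (x + z) - kern n z * c \<partial>tor)"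
    using i1 i2 by (simp add: conv_shift[OF _ _ trig_periodic[OF kern_trig] per] kern_integral)
  also have "\<bar>\<dots>\<bar> \<le> (\<integral>z. \<bar>kern n z * f (x + z) - kern n z * c\<bar> \<partial>tor)"
    by (rule integral_abs_bound)
  also have "\<dots> = (\<integral>z. kern n z * \<bar>f (x + z) - c\<bar> \<partial>tor)"
    by (rule Bochner_Integration.integral_cong)
        (auto simp: right_diff_distrib[symmetric] abs_mult kern_nonneg)
  finally have "ennreal \<bar>conv (kern n) f x - c\<bar> \<le> ennreal (\<integral>z. kern n z * \<bar>f (x + z) - c\<bar> \<partial>tor)"
    by (rule ennreal_leI)
  also have "\<dots> = (\<integral>\<^sup>+z. ennreal (kern n z * \<bar>f (x + z) - c\<bar>) \<partial>tor)"
    by (rule nn_integral_eq_integral[symmetric]) 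
      (use i in \<open>auto intro!: integrable_trig_mult[OF kern_trig] AE_I2 simp: kern_nonneg\<close>)
  finally show ?thesis by (simp add: ennreal_mult kern_nonneg)
qed

lemma conv_measurable: assumes "integrable tor f" shows "conv (kern n) f \<in> borel_measurable borel"
  by (rule borel_measurable_continuous_onI[OF c1_grad_cont[OF conv_c1[OF kern_trig assms]]])

text \<open>
  The \<open>L\<^sup>1\<close> error of the mollification is a \<open>kern n\<close>-weighted mean of the moduli of continuity
  of \<open>f\<close> under translations.
\<close>

lemma conv_kern_L1:
  assumes [measurable]: "f \<in> borel_measurable borel" and per: "periodic f" and int: "integrable tor f"
  shows "(\<lambda>n. \<integral>\<^sup>+x. ennreal \<bar>conv (kern n) f x - f x\<bar> \<partial>tor) \<longlonglongrightarrow> 0"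
proof -
  note [measurable] = trig_measurable[OF kern_trig]
  define \<tau> where "\<tau> z = (\<integral>x. \<bar>f (x + z) - f x\<bar> \<partial>tor)" for z
  have ii: "integrable tor (\<lambda>x. f (x + z))" for z by (rule integrable_tor_shift[OF assms])
  have \<tau>m [measurable]: "\<tau> \<in> borel_measurable borel" unfolding \<tau>_def by measurable
  have \<tau>nn: "(\<integral>\<^sup>+x. ennreal \<bar>f (x + z) - f x\<bar> \<partial>tor) = ennreal (\<tau> z)" for z
    unfolding \<tau>_def by (rule nn_integral_eq_integral) (use ii[of z] int in auto)
  have \<tau>0: "0 \<le> \<tau> z" for z by (simp add: \<tau>_def)
  have \<tau>b: "\<tau> z \<le> 2 * (\<integral>x. \<bar>f x\<bar> \<partial>tor)" for z
  proof -
    have "\<tau> z \<le> (\<integral>x. \<bar>f (x + z)\<bar> + \<bar>f x\<bar> \<partial>tor)" unfolding \<tau>_def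
      by (rule integral_mono) (use ii[of z] int in auto)
    also have "\<dots> = (\<integral>x. \<bar>f (x + z)\<bar> \<partial>tor) + (\<integral>x. \<bar>f x\<bar> \<partial>tor)" using ii[of z] int by simp
    also have "(\<integral>x. \<bar>f (x + z)\<bar> \<partial>tor) = (\<integral>x. \<bar>f x\<bar> \<partial>tor)"
      by (rule integral_tor_shift[of "\<lambda>x. \<bar>f x\<bar>"]) (use per in \<open>auto simp: periodic_def\<close>)
    finally show ?thesis by simp
  qed
  have \<tau>p: "periodic \<tau>" unfolding periodic_def \<tau>_def
  proof (intro allI)
    fix z i
    have "f (x + (z + axis i 1)) = f (x + z)" for x using per by (metis add.assoc periodic_def)
    then show "(\<integral>x. \<bar>f (x + (z + axis i 1)) - f x\<bar> \<partial>tor) = (\<integral>x. \<bar>f (x + z) - f x\<bar> \<partial>tor)" by simp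
  qed
  have lim: "(\<lambda>n. \<integral>z. kern n z * \<tau> z \<partial>tor) \<longlonglongrightarrow> 0"
  proof (rule kern_concentrates[OF \<tau>m \<tau>p _ \<tau>b])
    fix \<epsilon> :: real assume "\<epsilon> > 0"
    then show "\<exists>\<delta>>0. \<forall>h. norm h < \<delta> \<longrightarrow> \<tau> h < \<epsilon>" unfolding \<tau>_def
      by (rule translation_continuous[OF assms])
  qed (simp add: \<tau>_def)
  have le: "(\<integral>\<^sup>+x. ennreal \<bar>conv (kern n) f x - f x\<bar> \<partial>tor) \<le> ennreal (\<integral>z. kern n z * \<tau> z \<partial>tor)" for n
  proof -
    have "(\<integral>\<^sup>+x. ennreal \<bar>conv (kern n) f x - f x\<bar> \<partial>tor) \<le>
        (\<integral>\<^sup>+x. \<integral>\<^sup>+z. ennreal (kern n z) * ennreal \<bar>f (x + z) - f x\<bar> \<partial>tor \<partial>tor)"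
      by (intro nn_integral_mono conv_kern_nn_bound assms)
    also have "\<dots> = (\<integral>\<^sup>+z. \<integral>\<^sup>+x. ennreal (kern n z) * ennreal \<bar>f (x + z) - f x\<bar> \<partial>tor \<partial>tor)"
      by (rule unif2.Fubini') measurable
    also have "\<dots> = (\<integral>\<^sup>+z. ennreal (kern n z * \<tau> z) \<partial>tor)"
      by (intro nn_integral_cong) (simp add: nn_integral_cmult \<tau>nn ennreal_mult kern_nonneg \<tau>0)
    also have "\<dots> = ennreal (\<integral>z. kern n z * \<tau> z \<partial>tor)"
    proof (rule nn_integral_eq_integral)
      show "integrable tor (\<lambda>z. kern n z * \<tau> z)"
        by (rule integrable_trig_mult[OF kern_trig], rule integrable_unif_bounded[OF \<tau>m, of _ _ "2 *
            (\<integral>x. \<bar>f x\<bar> \<partial>tor)"])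
          (use \<tau>b \<tau>0 in simp)
    qed (simp add: kern_nonneg \<tau>0)
    finally show ?thesis .
  qed
  have lim': "(\<lambda>n. ennreal (\<integral>z. kern n z * \<tau> z \<partial>tor)) \<longlonglongrightarrow> 0"
    using tendsto_ennrealI[OF lim] by simp
  show ?thesis
    by (rule tendsto_sandwich[OF always_eventually always_eventually tendsto_const lim'])
        (use le in auto)
qed

lemma AE_eq_0_if_conv_eq_0:
  assumes [measurable]: "f \<in> borel_measurable borel" and per: "periodic f" and int: "integrable tor f"
    and z: "\<And>n x. conv (kern n) f x = 0"
  shows "AE x in tor. f x = 0"
proof -
  have "(\<lambda>n::nat. \<integral>\<^sup>+x. ennreal \<bar>f x\<bar> \<partial>tor) \<longlonglongrightarrow> 0" using conv_kern_L1[OF assms(1-3)] by (simp add: z)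
  then have "(\<integral>\<^sup>+x. ennreal \<bar>f x\<bar> \<partial>tor) = 0" by (simp add: LIMSEQ_const_iff)
  then show ?thesis by (simp add: nn_integral_0_iff_AE)
qed

lemma measurable_vec_nth [measurable (raw)]:
  fixes f :: "'a \<Rightarrow> real^'n"
  assumes "f \<in> borel_measurable M" shows "(\<lambda>x. f x $ i) \<in> borel_measurable M"
  by (rule measurable_compose[OF assms borel_measurable_continuous_onI]) (intro continuous_intros)

section \<open>Pointwise control of a divergence-free field by its curl\<close>

text \<open>
  A radial weight \<open>eta\<close> and a potential \<open>Psi\<close> of it, supported in the unit ball, with
  \<open>\<partial>\<^sub>j Psi (y) = - y\<^sub>j eta (y)\<close>.
\<close>

definition eta :: "real^3 \<Rightarrow> real" where "eta y = 4 * max 0 (1 - y \<bullet> y)"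
definition Psi :: "real^3 \<Rightarrow> real" where "Psi y = (max 0 (1 - y \<bullet> y))\<^sup>2"

lemma DERIV_max0_square: "((\<lambda>t::real. (max 0 t)\<^sup>2) has_real_derivative 2 * max 0 t) (at t)"
proof -
  consider "t > 0" | "t < 0" | "t = 0" by linarith
  then show ?thesis
  proof cases
    case 1
    have "((\<lambda>t::real. t\<^sup>2) has_real_derivative 2 * t) (at t)" by (auto intro!: derivative_eq_intros)
    then show ?thesis using 1
      by (subst DERIV_cong_ev[OF refl _ refl, where g="\<lambda>t. t\<^sup>2"])
        (auto intro: eventually_mono[OF eventually_gt_at_top] simp: eventually_nhds intro!:
            exI[of _ "{0<..}"])
  next
    case 2
    have "((\<lambda>t::real. 0) has_real_derivative 0) (at t)" by auto
    then show ?thesis using 2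
      by (subst DERIV_cong_ev[OF refl _ refl, where g="\<lambda>t. 0"])
        (auto simp: eventually_nhds intro!: exI[of _ "{..<0}"])
  next
    case 3
    have "((\<lambda>h::real. (max 0 h)\<^sup>2 / h) \<longlongrightarrow> 0) (at 0)"
    proof (rule Lim_null_comparison)
      show "\<forall>\<^sub>F h::real in at 0. norm ((max 0 h)\<^sup>2 / h) \<le> \<bar>h\<bar>"
        by (intro always_eventually allI) (auto simp: max_def power2_eq_square)
      show "((\<lambda>h::real. \<bar>h\<bar>) \<longlongrightarrow> 0) (at 0)" by (auto intro!: tendsto_eq_intros)
    qed
    then show ?thesis using 3 by (simp add: DERIV_def)
  qed
qed

lemma Psi_c1: "c1_grad Psi (\<lambda>j y. - (y $ j * eta y))"
  unfolding c1_grad_def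
proof (intro conjI allI)
  fix y
  have "((\<lambda>y::real^3. 1 - y \<bullet> y) has_derivative (\<lambda>h. - (2 * (y \<bullet> h)))) (at y)"
    by (auto intro!: derivative_eq_intros simp: inner_commute)
  from has_derivative_compose[OF this, of "\<lambda>t. (max 0 t)\<^sup>2",
      OF DERIV_max0_square[THEN has_field_derivative_imp_has_derivative]]
  have "(Psi has_derivative (\<lambda>h. 2 * max 0 (1 - y \<bullet> y) * - (2 * (y \<bullet> h)))) (at y)"
    by (simp add: Psi_def[abs_def])
  moreover have "(\<lambda>h. 2 * max 0 (1 - y \<bullet> y) * - (2 * (y \<bullet> h))) =
      (\<lambda>h. \<Sum>j\<in>UNIV. - (y $ j * eta y) * h $ j)"
  proof
    fix h :: "real^3"
    have k: "y \<bullet> h = (\<Sum>j\<in>UNIV. y $ j * h $ j)" by (simp add: inner_vec_def)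
    show "2 * max 0 (1 - y \<bullet> y) * - (2 * (y \<bullet> h)) = (\<Sum>j\<in>UNIV. - (y $ j * eta y) * h $ j)"
      unfolding k eta_def by (simp add: sum_3 algebra_simps)
  qed
  ultimately show "(Psi has_derivative (\<lambda>h. \<Sum>j\<in>UNIV. - (y $ j * eta y) * h $ j)) (at y)" by simp
  fix j show "continuous_on UNIV (\<lambda>y. - (y $ j * eta y))"
    unfolding eta_def by (intro continuous_intros)
qed

lemma Psi_support: assumes "y \<notin> cbox (-1) (1::real^3)" shows "Psi y = 0"
proof -
  obtain i where "\<not> (-1 \<le> y $ i \<and> y $ i \<le> 1)" using assms by (auto simp: mem_box_cart)
  then have "\<bar>y $ i\<bar> > 1" by auto
  then have "norm y > 1" using component_le_norm_cart[of y i] by linarith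
  then have "y \<bullet> y > 1" by (simp add: one_less_power flip: power2_norm_eq_inner)
  then show ?thesis by (simp add: Psi_def)
qed

lemma eta_bounds: "0 \<le> eta y" "eta y \<le> 4" "\<bar>y $ j * eta y\<bar> \<le> 4"
proof -
  show 1: "0 \<le> eta y" "eta y \<le> 4" by (auto simp: eta_def)
  show "\<bar>y $ j * eta y\<bar> \<le> 4"
  proof (cases "norm y \<le> 1")
    case True
    then have "\<bar>y $ j\<bar> \<le> 1" using component_le_norm_cart[of y j] by linarith
    then have "\<bar>y $ j * eta y\<bar> \<le> 1 * 4" unfolding abs_mult using 1 by (intro mult_mono) auto
    then show ?thesis by simp
  next
    case False
    then have "y \<bullet> y > 1" by (simp add: one_less_power flip: power2_norm_eq_inner)
    then show ?thesis by (simp add: eta_def)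
  qed
qed

lemma eta_cont: "continuous_on UNIV eta" unfolding eta_def[abs_def] by (intro continuous_intros)
lemma eta_measurable [measurable]: "eta \<in> borel_measurable borel"
  by (rule borel_measurable_continuous_onI[OF eta_cont])

lemma integral_eta: "(\<integral>y. eta y \<partial>cube) \<ge> 1/8"
proof -
  let ?C = "cbox 0 ((1/2) *\<^sub>R (1::real^3))"
  have one: "b \<in> Basis \<Longrightarrow> (1::real^3) \<bullet> b = 1" for b by (auto simp: Basis_vec_def inner_axis)
  have sub: "y \<in> cbox (-1) 1" if "y \<in> ?C" for y
  proof -
    have "0 \<le> y $ i" "y $ i \<le> 1/2" for i using that by (auto simp: mem_box_cart)
    then have "-1 \<le> y $ i \<and> y $ i \<le> 1" for i by (smt (verit) field_sum_of_halves)
    then show ?thesis by (simp add: mem_box_cart)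
  qed
  have "1/8 = measure lborel ?C" by (simp add: measure_lborel_cbox_eq one power3_eq_cube)
  also have "\<dots> = (\<integral>y. indicator ?C y \<partial>cube)"
  proof -
    have "(\<integral>y. indicator ?C y \<partial>cube) = (\<integral>y. indicator ?C y \<partial>lborel :: real)"
    proof (subst integral_unif)
      show "(LINT y:cbox (-1) 1|lborel. indicator ?C y) = (\<integral>y. indicator ?C y \<partial>lborel :: real)"
        unfolding set_lebesgue_integral_def using sub
        by (intro Bochner_Integration.integral_cong) (auto simp del: mem_box_cart simp: indicator_def)
    qed auto
    then show ?thesis by simp
  qed
  also have "\<dots> \<le> (\<integral>y. eta y \<partial>cube)"
  proof (rule integral_mono)
    show "integrable cube (\<lambda>y. indicator ?C y :: real)"
      by (rule integrable_unif_bounded[of _ _ _ 1]) (auto simp: indicator_def)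
    show "integrable cube eta" by (rule integrable_unif_continuous[OF eta_cont])
    fix y :: "real^3"
    show "indicator ?C y \<le> eta y"
    proof (cases "y \<in> ?C")
      case True
      have "(y $ i)\<^sup>2 \<le> (1/2)\<^sup>2" for i using True by (intro power_mono) (auto simp: mem_box_cart)
      then have "y \<bullet> y \<le> (\<Sum>i\<in>(UNIV::3 set). 1/4)"
        unfolding inner_vec_def by (intro sum_mono) (simp add: power2_eq_square)
      then show ?thesis using True by (simp add: eta_def)
    qed (simp add: eta_bounds)
  qed
  finally show ?thesis .
qed

lemma c1_grad_affine:
  assumes "c1_grad f g" shows "c1_grad (\<lambda>y. f (x + s *\<^sub>R y)) (\<lambda>j y. s * g j (x + s *\<^sub>R y))"
  unfolding c1_grad_def
proof (intro conjI allI)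
  fix y
  have "((\<lambda>y. f (x + s *\<^sub>R y)) has_derivative (\<lambda>h. \<Sum>i\<in>UNIV. g i (x + s *\<^sub>R y) * (s *\<^sub>R h) $ i)) (at y)"
    by (rule has_derivative_compose[of "\<lambda>y. x + s *\<^sub>R y" "\<lambda>h. s *\<^sub>R h"
        y UNIV f, OF _ c1_gradD[OF assms]])
      (auto intro!: derivative_eq_intros)
  then show "((\<lambda>y. f (x + s *\<^sub>R y)) has_derivative (\<lambda>h. \<Sum>i\<in>UNIV. s * g i (x + s *\<^sub>R y) * h $ i)) (at y)"
    by (simp add: mult_ac)
  fix j show "continuous_on UNIV (\<lambda>y. s * g j (x + s *\<^sub>R y))"
    by (intro continuous_intros continuous_on_compose2[OF c1_grad_cont_grad[OF assms]]) auto
qed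

text \<open>
  Biot-Savart estimate without a fundamental solution; \<open>D j i\<close> stands for \<open>\<partial>\<^sub>j v\<^sub>i\<close> and \<open>E j k\<close> for
  \<open>\<partial>\<^sub>k \<partial>\<^sub>i v\<^sub>j\<close>.  In the derivative \<open>\<Sum>\<^sub>j \<integral> y\<^sub>j eta(y) \<partial>\<^sub>j v\<^sub>i(x + s y) dy\<close> of the weighted mean of \<open>v\<^sub>i\<close>
  at scale \<open>s\<close>, the indices \<open>i\<close> and \<open>j\<close> may be exchanged up to the curl, and the exchanged term
  vanishes after an integration by parts, because \<open>v\<close> is divergence free.
\<close>

lemma solenoidal_field_bound:
  fixes v :: "3 \<Rightarrow> real^3 \<Rightarrow> real"
  assumes v: "c1_grad (v i) (\<lambda>j. D j i)" and D: "\<And>j. c1_grad (D i j) (E j)"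
    and div: "\<And>x. (\<Sum>j\<in>UNIV. E j j x) = 0"
    and per: "periodic (v i)" "\<And>j. periodic (D i j)" and e: "0 \<le> e"
  shows "ennreal \<bar>v i x\<bar> \<le> 32 * (\<integral>\<^sup>+y. ennreal \<bar>v i (x + e *\<^sub>R y)\<bar> \<partial>cube) +
    32 * (\<Sum>j\<in>UNIV. \<integral>\<^sup>+s. \<integral>\<^sup>+y. ennreal \<bar>D j i (x + s *\<^sub>R y) - D i j (x + s *\<^sub>R y)\<bar> \<partial>cube \<partial>unif 0 e)"
proof -
  note [measurable] = c1_grad_measurable[OF v] c1_grad_measurable[OF D]
  have perD: "periodic (D j i)" for j by (rule c1_grad_periodic[OF v per(1)])
  have "\<exists>C. \<forall>x. \<bar>D j i x\<bar> \<le> C" for j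
    using periodic_continuous_bounded[OF c1_grad_cont_grad[OF v] perD] by metis
  then obtain C1 where C1: "\<And>j x. \<bar>D j i x\<bar> \<le> C1 j" by metis
  have "\<exists>C. \<forall>x. \<bar>D i j x\<bar> \<le> C" for j
    using periodic_continuous_bounded[OF c1_grad_cont[OF D] per(2)] by metis
  then obtain C2 where C2: "\<And>j x. \<bar>D i j x\<bar> \<le> C2 j" by metis
  obtain C0 where C0: "\<And>x. \<bar>v i x\<bar> \<le> C0"
    using periodic_continuous_bounded[OF c1_grad_cont[OF v] per(1)] by metis
  define c where "c = (\<integral>y. eta y \<partial>cube)"
  define W where "W j x = D j i x - D i j x" for j x
  have [measurable]: "W j \<in> borel_measurable borel" for j unfolding W_def by measurable
  have Wb: "\<bar>W j x\<bar> \<le> C1 j + C2 j" for j x using C1[of j x] C2[of j x] unfolding W_def by arith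
  have ye: "\<bar>y $ j * eta y * a\<bar> \<le> 4 * b" if "\<bar>a\<bar> \<le> b" for y j a b
    unfolding abs_mult[of _ a] by (rule mult_mono) (use that eta_bounds in auto)
  have iP: "integrable (unif 0 e \<Otimes>\<^sub>M cube) F"
      if "F \<in> borel_measurable (unif 0 e \<Otimes>\<^sub>M cube)" "\<And>p. \<bar>F p\<bar> \<le> b" for F :: "real \<times> (real^3) \<Rightarrow> real"
      and b
  proof -
    interpret P: finite_measure "unif 0 e \<Otimes>\<^sub>M cube"
      by (rule finite_measure_pair_measure) (auto intro: finite_measure_unif)
    show ?thesis by (rule P.integrable_const_bound[where B=b]) (use that in auto)
  qed
  have inner: "(\<integral>y. eta y * (\<Sum>j\<in>UNIV. D j i (x + s *\<^sub>R y) * y $ j) \<partial>cube) =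
      (\<integral>y. (\<Sum>j\<in>UNIV. y $ j * eta y * W j (x + s *\<^sub>R y)) \<partial>cube)" for s
  proof -
    have iW: "integrable cube (\<lambda>y. y $ j * eta y * W j (x + s *\<^sub>R y))" for j
      by (rule integrable_unif_bounded[of _ _ _ "4 * (C1 j + C2 j)"]) (use ye[OF Wb] in auto)
    have iD: "integrable cube (\<lambda>y. y $ j * eta y * D i j (x + s *\<^sub>R y))" for j
      by (rule integrable_unif_bounded[of _ _ _ "4 * C2 j"]) (use ye[OF C2] in auto)
    have cE: "continuous_on UNIV (\<lambda>y. Psi y * (s * E j k (x + s *\<^sub>R y)))" for j k
      by (intro continuous_intros c1_grad_cont[OF Psi_c1] continuous_on_compose2[OF c1_grad_cont_grad[OF D]]) auto
    \<comment> \<open>\<open>y\<^sub>j eta = - \<partial>\<^sub>j Psi\<close>, and the derivative falls on \<open>D i j\<close>\<close>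
    have zero: "(\<integral>y. y $ j * eta y * D i j (x + s *\<^sub>R y) \<partial>cube) =
        (\<integral>y. Psi y * (s * E j j (x + s *\<^sub>R y)) \<partial>cube)" for j
    proof -
      have "(\<integral>y. Psi y * (s * E j j (x + s *\<^sub>R y)) + - (y $ j * eta y) * D i j (x + s *\<^sub>R y) \<partial>cube) = 0"
        by (rule integral_cube_partial_eq_0[OF c1_grad_mult[OF Psi_c1 c1_grad_affine[OF D]]])
          (simp add: Psi_support)
      then show ?thesis using iD[of j] integrable_unif_continuous[OF cE, of "-1" 1 j j] by simp
    qed
    have "(\<integral>y. (\<Sum>j\<in>UNIV. y $ j * eta y * D i j (x + s *\<^sub>R y)) \<partial>cube) =
        (\<integral>y. (\<Sum>j\<in>UNIV. Psi y * (s * E j j (x + s *\<^sub>R y))) \<partial>cube)"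
      using iD integrable_unif_continuous[OF cE] by (simp add: zero)
    also have "\<dots> = (\<integral>y. Psi y * (s * (\<Sum>j\<in>UNIV. E j j (x + s *\<^sub>R y))) \<partial>cube)"
      by (simp add: sum_distrib_left)
    also have "\<dots> = 0" by (simp add: div)
    finally have z: "(\<integral>y. (\<Sum>j\<in>UNIV. y $ j * eta y * D i j (x + s *\<^sub>R y)) \<partial>cube) = 0" .
    have "(\<integral>y. eta y * (\<Sum>j\<in>UNIV. D j i (x + s *\<^sub>R y) * y $ j) \<partial>cube) = 
      (\<integral>y. (\<Sum>j\<in>UNIV. y $ j * eta y * W j (x + s *\<^sub>R y)) +
          (\<Sum>j\<in>UNIV. y $ j * eta y * D i j (x + s *\<^sub>R y)) \<partial>cube)"
      by (rule Bochner_Integration.integral_cong) (auto simp: W_def sum_3 algebra_simps)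
    also have "\<dots> = (\<integral>y. (\<Sum>j\<in>UNIV. y $ j * eta y * W j (x + s *\<^sub>R y)) \<partial>cube)"
      using iW iD z by (subst Bochner_Integration.integral_add) auto
    finally show ?thesis .
  qed
  have iv: "integrable cube (\<lambda>y. eta y * v i (x + e *\<^sub>R y))"
    by (intro integrable_unif_continuous continuous_intros eta_cont continuous_on_compose2[OF c1_grad_cont[OF v]]) auto
  have ic: "integrable cube (\<lambda>y. eta y * v i x)"
    by (intro integrable_unif_continuous continuous_intros eta_cont)
  have "c * v i x = (\<integral>y. eta y * v i (x + e *\<^sub>R y) \<partial>cube) -
      (\<integral>y. eta y * (v i (x + e *\<^sub>R y) - v i (x + 0 *\<^sub>R y)) \<partial>cube)"
    using iv ic by (simp add: right_diff_distrib c_def)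
  also have "(\<integral>y. eta y * (v i (x + e *\<^sub>R y) - v i (x + 0 *\<^sub>R y)) \<partial>cube) =
      (\<integral>y. (\<integral>s. eta y * (\<Sum>j\<in>UNIV. D j i (x + s *\<^sub>R y) * y $ j) \<partial>unif 0 e) \<partial>cube)"
    by (subst c1_grad_FTC[OF v e, symmetric]) simp
  also have "\<dots> = (\<integral>s. (\<integral>y. eta y * (\<Sum>j\<in>UNIV. D j i (x + s *\<^sub>R y) * y $ j) \<partial>cube) \<partial>unif 0 e)"
  proof (rule unif2.Fubini_integral)
    have "\<bar>eta y * (\<Sum>j\<in>UNIV. D j i (x + s *\<^sub>R y) * y $ j)\<bar> \<le> (\<Sum>j\<in>UNIV. 4 * C1 j)" for s :: real and y
    proof -
      have "eta y * (\<Sum>j\<in>UNIV. D j i (x + s *\<^sub>R y) * y $ j) =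
          (\<Sum>j\<in>UNIV. y $ j * eta y * D j i (x + s *\<^sub>R y))"
        by (simp add: sum_distrib_left mult_ac)
      also have "\<bar>\<dots>\<bar> \<le> (\<Sum>j\<in>UNIV. 4 * C1 j)"
        by (intro order_trans[OF sum_abs] sum_mono ye C1)
      finally show ?thesis .
    qed
    moreover have "(\<lambda>(s, y). eta y * (\<Sum>j\<in>UNIV. D j i (x + s *\<^sub>R y) * y $ j)) \<in> borel_measurable
        (unif 0 e \<Otimes>\<^sub>M cube)"
      by measurable
    ultimately show "integrable (unif 0 e \<Otimes>\<^sub>M cube)
        (\<lambda>(s, y). eta y * (\<Sum>j\<in>UNIV. D j i (x + s *\<^sub>R y) * y $ j))"
      by (intro iP[of _ "\<Sum>j\<in>UNIV. 4 * C1 j"]) auto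
  qed
  also have "\<dots> = (\<integral>s. (\<integral>y. (\<Sum>j\<in>UNIV. y $ j * eta y * W j (x + s *\<^sub>R y)) \<partial>cube) \<partial>unif 0 e)"
    by (simp add: inner)
  finally have eq: "c * v i x = (\<integral>y. eta y * v i (x +
      e *\<^sub>R y) \<partial>cube) - (\<integral>s. (\<integral>y. (\<Sum>j\<in>UNIV. y $ j * eta y * W j (x + s *\<^sub>R y)) \<partial>cube) \<partial>unif 0 e)" .
  have c: "c \<ge> 1/8" using integral_eta by (simp add: c_def)
  have t1: "ennreal \<bar>\<integral>y. eta y * v i (x + e *\<^sub>R y) \<partial>cube\<bar> \<le>
      4 * (\<integral>\<^sup>+y. ennreal \<bar>v i (x + e *\<^sub>R y)\<bar> \<partial>cube)"
  proof -
    have "ennreal \<bar>\<integral>y. eta y * v i (x + e *\<^sub>R y) \<partial>cube\<bar> \<le>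
        (\<integral>\<^sup>+y. ennreal \<bar>eta y * v i (x + e *\<^sub>R y)\<bar> \<partial>cube)"
      using integral_norm_bound_ennreal[OF iv] by simp
    also have "\<dots> \<le> (\<integral>\<^sup>+y. 4 * ennreal \<bar>v i (x + e *\<^sub>R y)\<bar> \<partial>cube)"
    proof (rule nn_integral_mono)
      fix y
      have "\<bar>eta y * v i (x + e *\<^sub>R y)\<bar> \<le> 4 * \<bar>v i (x + e *\<^sub>R y)\<bar>"
        unfolding abs_mult using eta_bounds[of y] by (intro mult_right_mono) auto
      then have "ennreal \<bar>eta y * v i (x + e *\<^sub>R y)\<bar> \<le> ennreal (4 * \<bar>v i (x + e *\<^sub>R y)\<bar>)"
        by (rule ennreal_leI)
      then show "ennreal \<bar>eta y * v i (x + e *\<^sub>R y)\<bar> \<le> 4 * ennreal \<bar>v i (x + e *\<^sub>R y)\<bar>"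
        by (simp add: ennreal_mult)
    qed
    finally show ?thesis by (simp add: nn_integral_cmult)
  qed
  have t2: "ennreal \<bar>\<integral>s. (\<integral>y. (\<Sum>j\<in>UNIV. y $ j * eta y * W j (x + s *\<^sub>R y)) \<partial>cube) \<partial>unif 0 e\<bar>
     \<le> 4 * (\<Sum>j\<in>UNIV. \<integral>\<^sup>+s. \<integral>\<^sup>+y. ennreal \<bar>W j (x + s *\<^sub>R y)\<bar> \<partial>cube \<partial>unif 0 e)"
  proof -
    define b where "b = (\<Sum>j\<in>UNIV. 4 * (C1 j + C2 j))"
    have bb: "\<bar>\<Sum>j\<in>UNIV. y $ j * eta y * W j (x + s *\<^sub>R y)\<bar> \<le> b" for s :: real and y
      unfolding b_def by (intro order_trans[OF sum_abs] sum_mono ye Wb)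
    have i1: "integrable cube (\<lambda>y. \<Sum>j\<in>UNIV. y $ j * eta y * W j (x + s *\<^sub>R y))" for s :: real
      by (rule integrable_unif_bounded[of _ _ _ b]) (use bb in auto)
    have i2: "integrable (unif 0 e) (\<lambda>s. \<integral>y. (\<Sum>j\<in>UNIV. y $ j * eta y * W j (x + s *\<^sub>R y)) \<partial>cube)"
    proof (rule unif2.integrable_fst'[of 0 e "-1"
        1 "\<lambda>(s, y). \<Sum>j\<in>UNIV. y $ j * eta y * W j (x + s *\<^sub>R y)", simplified])
      show "integrable (unif 0 e \<Otimes>\<^sub>M cube) (\<lambda>(s, y). \<Sum>j\<in>UNIV. y $ j * eta y * W j (x + s *\<^sub>R y))"
      proof (rule iP[of _ b])
        show "(\<lambda>(s, y). \<Sum>j\<in>UNIV. y $ j * eta y * W j (x + s *\<^sub>R y)) \<in> borel_measurable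
            (unif 0 e \<Otimes>\<^sub>M cube)"
          by measurable
      qed (use bb in auto)
    qed
    have "ennreal \<bar>\<integral>s. (\<integral>y. (\<Sum>j\<in>UNIV. y $ j * eta y * W j (x + s *\<^sub>R y)) \<partial>cube) \<partial>unif 0 e\<bar>
      \<le> (\<integral>\<^sup>+s. ennreal \<bar>\<integral>y. (\<Sum>j\<in>UNIV. y $ j * eta y * W j (x + s *\<^sub>R y)) \<partial>cube\<bar> \<partial>unif 0 e)"
      using integral_norm_bound_ennreal[OF i2] by simp
    also have "\<dots> \<le> (\<integral>\<^sup>+s. \<integral>\<^sup>+y. ennreal \<bar>\<Sum>j\<in>UNIV. y $ j * eta y * W j (x + s *\<^sub>R y)\<bar> \<partial>cube \<partial>unif 0 e)"
      using integral_norm_bound_ennreal[OF i1] by (intro nn_integral_mono) simp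
    also have "\<dots> \<le> (\<integral>\<^sup>+s. \<integral>\<^sup>+y. 4 * (\<Sum>j\<in>UNIV. ennreal \<bar>W j (x + s *\<^sub>R y)\<bar>) \<partial>cube \<partial>unif 0 e)"
    proof (intro nn_integral_mono)
      fix s y
      have "\<bar>\<Sum>j\<in>UNIV. y $ j * eta y * W j (x + s *\<^sub>R y)\<bar> \<le> 4 * (\<Sum>j\<in>UNIV. \<bar>W j (x + s *\<^sub>R y)\<bar>)"
        unfolding sum_distrib_left by (intro order_trans[OF sum_abs] sum_mono ye) auto
      then have "ennreal \<bar>\<Sum>j\<in>UNIV. y $ j * eta y * W j (x + s *\<^sub>R y)\<bar> \<le>
          ennreal (4 * (\<Sum>j\<in>UNIV. \<bar>W j (x + s *\<^sub>R y)\<bar>))"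
        by (rule ennreal_leI)
      then show "ennreal \<bar>\<Sum>j\<in>UNIV. y $ j * eta y * W j (x + s *\<^sub>R y)\<bar> \<le>
          4 * (\<Sum>j\<in>UNIV. ennreal \<bar>W j (x + s *\<^sub>R y)\<bar>)"
        by (simp add: ennreal_mult sum_nonneg)
    qed
    also have "\<dots> = 4 * (\<Sum>j\<in>UNIV. \<integral>\<^sup>+s. \<integral>\<^sup>+y. ennreal \<bar>W j (x + s *\<^sub>R y)\<bar> \<partial>cube \<partial>unif 0 e)"
      by (simp add: nn_integral_cmult nn_integral_sum del: sum_ennreal)
    finally show ?thesis .
  qed
  \<comment> \<open>the factor \<open>32\<close> is \<open>8\<close>, from \<open>c \<ge> 1/8\<close>, times \<open>4\<close>, the bound on \<open>eta\<close> and \<open>y\<^sub>j eta\<close>\<close>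
  have "\<bar>v i x\<bar> \<le> 8 * \<bar>c * v i x\<bar>"
  proof -
    have "1 * \<bar>v i x\<bar> \<le> (8 * c) * \<bar>v i x\<bar>" using c by (intro mult_right_mono) auto
    then show ?thesis using c by (simp add: abs_mult)
  qed
  also have "\<dots> \<le> 8 * (\<bar>\<integral>y. eta y * v i (x + e *\<^sub>R y) \<partial>cube\<bar> +
      \<bar>\<integral>s. (\<integral>y. (\<Sum>j\<in>UNIV. y $ j * eta y * W j (x + s *\<^sub>R y)) \<partial>cube) \<partial>unif 0 e\<bar>)"
    unfolding eq by (intro mult_left_mono abs_triangle_ineq4) auto
  finally have "ennreal \<bar>v i x\<bar> \<le> ennreal \<dots>" by (rule ennreal_leI)
  also have "\<dots> = 8 * (ennreal \<bar>\<integral>y. eta y * v i (x + e *\<^sub>R y) \<partial>cube\<bar> +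
      ennreal \<bar>\<integral>s. (\<integral>y. (\<Sum>j\<in>UNIV. y $ j * eta y * W j (x + s *\<^sub>R y)) \<partial>cube) \<partial>unif 0 e\<bar>)"
    by (simp add: ennreal_mult ennreal_plus)
  also have "\<dots> \<le> 8 * (4 * (\<integral>\<^sup>+y. ennreal \<bar>v i (x + e *\<^sub>R y)\<bar> \<partial>cube) +
      4 * (\<Sum>j\<in>UNIV. \<integral>\<^sup>+s. \<integral>\<^sup>+y. ennreal \<bar>W j (x + s *\<^sub>R y)\<bar> \<partial>cube \<partial>unif 0 e))"
    by (intro mult_left_mono add_mono t1 t2) auto
  finally show ?thesis unfolding W_def by (simp add: distrib_left mult.assoc[symmetric])
qed

section \<open>The averaging operator\<close>

text \<open>
  The operator \<open>K\<^sub>e g (x) = \<integral>\<^sub>0\<^sup>e \<integral> g(x + s y) dy ds\<close> (not normalised).  Substituting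
  \<open>z = s y\<close> shows that its kernel is comparable to \<open>\<bar>z\<bar>\<^sup>-\<^sup>2\<close> near \<open>0\<close>.
\<close>

definition avg :: "real \<Rightarrow> (real^3 \<Rightarrow> ennreal) \<Rightarrow> real^3 \<Rightarrow> ennreal" where
  "avg e g x = (\<integral>\<^sup>+s. \<integral>\<^sup>+y. g (x + s *\<^sub>R y) \<partial>cube \<partial>unif 0 e)"

lemma avg_measurable [measurable]:
  assumes [measurable]: "g \<in> borel_measurable borel"
  shows "avg e g \<in> borel_measurable borel"
  unfolding avg_def by measurable

lemma avg_mono: "(\<And>x. g x \<le> h x) \<Longrightarrow> avg e g x \<le> avg e h x"
  unfolding avg_def by (intro nn_integral_mono) auto

lemma avg_add:
  assumes [measurable]: "g \<in> borel_measurable borel" "h \<in> borel_measurable borel"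
  shows "avg e (\<lambda>x. g x + h x) x = avg e g x + avg e h x"
  unfolding avg_def by (simp add: nn_integral_add)

lemma avg_cmult:
  assumes [measurable]: "g \<in> borel_measurable borel"
  shows "avg e (\<lambda>x. c * g x) x = c * avg e g x"
  unfolding avg_def by (simp add: nn_integral_cmult)

lemma nn_integral_cube_uminus:
  fixes h :: "real^3 \<Rightarrow> ennreal"
  assumes [measurable]: "h \<in> borel_measurable borel"
  shows "(\<integral>\<^sup>+y. h (- y) \<partial>cube) = (\<integral>\<^sup>+y. h y \<partial>cube)"
proof -
  have i: "- y \<in> cbox (-1) (1::real^3) \<longleftrightarrow> y \<in> cbox (-1) 1" for y by (auto simp: mem_box_cart)
  have U: "distr lborel borel uminus = (lborel :: (real^3) measure)"
    by (subst lborel_affine[of "-1" 0]) (auto simp: density_1 one_ennreal_def[symmetric])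
  have "(\<integral>\<^sup>+y. h y \<partial>cube) = (\<integral>\<^sup>+y. h y * indicator (cbox (-1) 1) y \<partial>distr lborel borel uminus)"
    unfolding nn_integral_unif[OF assms] U ..
  also have "\<dots> = (\<integral>\<^sup>+y. h (- y) * indicator (cbox (-1) 1) y \<partial>lborel)"
    by (subst nn_integral_distr) (auto simp: indicator_def i)
  finally show ?thesis by (simp add: nn_integral_unif)
qed

text \<open>The operator is symmetric because the cube is invariant under \<open>y \<mapsto> - y\<close>.\<close>

lemma avg_symmetric:
  assumes [measurable]: "f \<in> borel_measurable borel" "g \<in> borel_measurable borel"
    and per: "periodic f" "periodic g"
  shows "(\<integral>\<^sup>+x. f x * avg e g x \<partial>tor) = (\<integral>\<^sup>+x. g x * avg e f x \<partial>tor)"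
proof -
  have swap: "(\<integral>\<^sup>+x. h x * avg e k x \<partial>tor) = (\<integral>\<^sup>+s. \<integral>\<^sup>+y. \<integral>\<^sup>+x. h x * k (x +
      s *\<^sub>R y) \<partial>tor \<partial>cube \<partial>unif 0 e)"
    if [measurable]: "h \<in> borel_measurable borel" "k \<in> borel_measurable borel"
        for h k :: "real^3 \<Rightarrow> ennreal"
  proof -
    have "(\<integral>\<^sup>+x. h x * avg e k x \<partial>tor) = (\<integral>\<^sup>+x. \<integral>\<^sup>+s. \<integral>\<^sup>+y. h x * k (x + s *\<^sub>R y) \<partial>cube \<partial>unif 0 e \<partial>tor)"
      unfolding avg_def by (simp add: nn_integral_cmult)
    also have "\<dots> = (\<integral>\<^sup>+s. \<integral>\<^sup>+x. \<integral>\<^sup>+y. h x * k (x + s *\<^sub>R y) \<partial>cube \<partial>tor \<partial>unif 0 e)"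
      by (rule unif2.Fubini') measurable
    also have "\<dots> = (\<integral>\<^sup>+s. \<integral>\<^sup>+y. \<integral>\<^sup>+x. h x * k (x + s *\<^sub>R y) \<partial>tor \<partial>cube \<partial>unif 0 e)"
      by (intro nn_integral_cong unif2.Fubini') measurable
    finally show ?thesis .
  qed
  have "(\<integral>\<^sup>+x. f x * avg e g x \<partial>tor) = (\<integral>\<^sup>+s. \<integral>\<^sup>+y. \<integral>\<^sup>+x. f x * g (x + s *\<^sub>R y) \<partial>tor \<partial>cube \<partial>unif 0 e)"
    by (rule swap) measurable
  also have "\<dots> = (\<integral>\<^sup>+s. \<integral>\<^sup>+y. \<integral>\<^sup>+x. g x * f (x + s *\<^sub>R - y) \<partial>tor \<partial>cube \<partial>unif 0 e)"
  proof (rule nn_integral_cong, rule nn_integral_cong)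
    fix s :: real and y :: "real^3"
    have "periodic (\<lambda>x. g x * f (x + s *\<^sub>R - y))"
      using per(2) periodic_shift[OF per(1), of "s *\<^sub>R - y"] by (simp add: periodic_def)
    then have "(\<integral>\<^sup>+x. g (x + s *\<^sub>R y) * f (x + s *\<^sub>R y + s *\<^sub>R - y) \<partial>tor) =
        (\<integral>\<^sup>+x. g x * f (x + s *\<^sub>R - y) \<partial>tor)"
      by (intro nn_integral_tor_shift[of "\<lambda>x. g x * f (x + s *\<^sub>R - y)"]) measurable
    then show "(\<integral>\<^sup>+x. f x * g (x + s *\<^sub>R y) \<partial>tor) = (\<integral>\<^sup>+x. g x * f (x + s *\<^sub>R - y) \<partial>tor)"
      by (simp add: mult.commute)
  qed
  also have "\<dots> = (\<integral>\<^sup>+s. \<integral>\<^sup>+y. \<integral>\<^sup>+x. g x * f (x + s *\<^sub>R y) \<partial>tor \<partial>cube \<partial>unif 0 e)"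
    by (intro nn_integral_cong nn_integral_cube_uminus[of "\<lambda>y. \<integral>\<^sup>+x. g x * f (x + s *\<^sub>R y) \<partial>tor"
        for s]) measurable
  also have "\<dots> = (\<integral>\<^sup>+x. g x * avg e f x \<partial>tor)"
    by (rule swap[symmetric]) measurable
  finally show ?thesis .
qed

lemma avg_const: assumes "e \<ge> 0" shows "avg e (\<lambda>_. c) x = 8 * ennreal e * c"
proof -
  have "emeasure (unif 0 e) UNIV = ennreal e" using assms by (simp add: emeasure_unif)
  then show ?thesis by (simp add: avg_def mult_ac)
qed

lemma nn_integral_avg:
  assumes [measurable]: "f \<in> borel_measurable borel" and per: "periodic f" and "e \<ge> 0"
  shows "(\<integral>\<^sup>+x. avg e f x \<partial>tor) = 8 * ennreal e * (\<integral>\<^sup>+x. f x \<partial>tor)"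
proof -
  have "(\<integral>\<^sup>+x. avg e f x \<partial>tor) = (\<integral>\<^sup>+x. 1 * avg e f x \<partial>tor)" by simp
  also have "\<dots> = (\<integral>\<^sup>+x. f x * avg e (\<lambda>_. 1) x \<partial>tor)"
    by (rule avg_symmetric) (auto simp: per periodic_def[of "\<lambda>_. 1::ennreal"])
  also have "\<dots> = 8 * ennreal e * (\<integral>\<^sup>+x. f x \<partial>tor)"
    by (simp add: avg_const[OF \<open>e \<ge> 0\<close>] nn_integral_multc mult.commute)
  finally show ?thesis .
qed

section \<open>Beltrami fields with a coefficient in a Kato class\<close>

lemma integrable_from_square:
  fixes f :: "'a::euclidean_space \<Rightarrow> real"
  assumes [measurable]: "f \<in> borel_measurable borel" and i: "integrable (unif a b) (\<lambda>x. (f x)\<^sup>2)"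
  shows "integrable (unif a b) f"
proof (rule Bochner_Integration.integrable_bound)
  show "integrable (unif a b) (\<lambda>x. (f x)\<^sup>2 + 1)" using i by auto
  show "AE x in unif a b. norm (f x) \<le> norm ((f x)\<^sup>2 + 1)"
  proof (rule AE_I2)
    fix x
    have "0 \<le> (\<bar>f x\<bar> - 1)\<^sup>2" by simp
    then have "2 * \<bar>f x\<bar> \<le> (f x)\<^sup>2 + 1" by (simp add: power2_eq_square algebra_simps)
    then show "norm (f x) \<le> norm ((f x)\<^sup>2 + 1)" unfolding real_norm_def by arith
  qed
qed simp

lemma integrable_product_from_squares:
  fixes f :: "'a::euclidean_space \<Rightarrow> real"
  assumes [measurable]: "f \<in> borel_measurable borel" "g \<in> borel_measurable borel"
   and i: "integrable (unif a b) (\<lambda>x. (f x)\<^sup>2)" "integrable (unif a b) (\<lambda>x. (g x)\<^sup>2)"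
  shows "integrable (unif a b) (\<lambda>x. f x * g x)"
proof (rule Bochner_Integration.integrable_bound)
  show "integrable (unif a b) (\<lambda>x. (f x)\<^sup>2 + (g x)\<^sup>2)" using i by auto
  show "AE x in unif a b. norm (f x * g x) \<le> norm ((f x)\<^sup>2 + (g x)\<^sup>2)"
  proof (rule AE_I2)
    fix x
    have "0 \<le> (\<bar>f x\<bar> - \<bar>g x\<bar>)\<^sup>2" by simp
    then have "2 * (\<bar>f x\<bar> * \<bar>g x\<bar>) \<le> (f x)\<^sup>2 + (g x)\<^sup>2" by (simp add: power2_eq_square algebra_simps)
    moreover have "0 \<le> \<bar>f x\<bar> * \<bar>g x\<bar>" by simp
    ultimately show "norm (f x * g x) \<le> norm ((f x)\<^sup>2 + (g x)\<^sup>2)" unfolding real_norm_def abs_mult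
      by arith
  qed
qed simp

lemma nn_integral_powr:
  assumes "\<alpha> < 1" "0 < e"
  shows "(\<integral>\<^sup>+s. ennreal (s powr - \<alpha>) \<partial>unif 0 e) = ennreal (e powr (1 - \<alpha>) / (1 - \<alpha>))"
proof -
  have "((\<lambda>s. s powr - \<alpha>) has_integral (e powr (- \<alpha> + 1) / (- \<alpha> + 1))) {0..e}"
    by (rule has_integral_powr_from_0) (use assms in auto)
  then have "(\<integral>\<^sup>+s. ennreal (indicator {0..e} s * s powr - \<alpha>) \<partial>lborel) =
      ennreal (e powr (- \<alpha> + 1) / (- \<alpha> + 1))"
    by (intro nn_integral_has_integral_lebesgue) auto
  moreover have "(\<integral>\<^sup>+s. ennreal (s powr - \<alpha>) \<partial>unif 0 e) =
      (\<integral>\<^sup>+s. ennreal (indicator {0..e} s * s powr - \<alpha>) \<partial>lborel)"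
    by (subst nn_integral_unif) (auto intro!: nn_integral_cong simp: indicator_def)
  ultimately show ?thesis by (simp add: add.commute)
qed

text \<open>Uniform integrability of a single integrable function.\<close>

lemma tail_integral_small:
  fixes b :: "'a::euclidean_space \<Rightarrow> real"
  assumes [measurable]: "b \<in> borel_measurable borel" and i: "integrable (unif p q) b" and "\<epsilon> > 0"
  obtains A where "A \<ge> 0" "(\<integral>x. \<bar>b x\<bar> * indicator {x. \<bar>b x\<bar> > A} x \<partial>unif p q) < \<epsilon>"
proof -
  have "(\<lambda>n. \<integral>x. \<bar>b x\<bar> * indicator {x. \<bar>b x\<bar> > real n} x \<partial>unif p q) \<longlonglongrightarrow> (\<integral>x. 0 \<partial>unif p q)"
  proof (rule integral_dominated_convergence)
    show "integrable (unif p q) (\<lambda>x. \<bar>b x\<bar>)" using i by auto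
    show "AE x in unif p q. (\<lambda>n. \<bar>b x\<bar> * indicator {x. \<bar>b x\<bar> > real n} x) \<longlonglongrightarrow> 0"
    proof (rule AE_I2)
      fix x
      obtain N where N: "\<bar>b x\<bar> < real N" using reals_Archimedean2 by blast
      have "eventually (\<lambda>n. \<bar>b x\<bar> * indicator {x. \<bar>b x\<bar> > real n} x = 0) sequentially"
        using eventually_ge_at_top[of N] by eventually_elim (use N in auto)
      then show "(\<lambda>n. \<bar>b x\<bar> * indicator {x. \<bar>b x\<bar> > real n} x) \<longlonglongrightarrow> 0" by (rule tendsto_eventually)
    qed
  qed (auto simp: indicator_def)
  then have "(\<lambda>n. \<integral>x. \<bar>b x\<bar> * indicator {x. \<bar>b x\<bar> > real n} x \<partial>unif p q) \<longlonglongrightarrow> 0" by simp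
  then obtain n where "\<bar>\<integral>x. \<bar>b x\<bar> * indicator {x. \<bar>b x\<bar> > real n} x \<partial>unif p q\<bar> < \<epsilon>"
    by (rule LIMSEQ_0_ex[OF _ \<open>\<epsilon> > 0\<close>])
  then show thesis using that[of "real n"] by auto
qed

text \<open>
  Products of a bounded \<open>L\<^sup>1\<close>-convergent sequence with an \<open>L\<^sup>1\<close>-convergent one converge weakly.  In
  the term \<open>\<bar>a\<^sub>n - a\<bar> \<bar>b\<bar>\<close> the factor \<open>b\<close> is split into a bounded part and a part that is small
  in \<open>L\<^sup>1\<close>.
\<close>

lemma integral_triple_product_limit:
  fixes a b \<psi> :: "'a::euclidean_space \<Rightarrow> real"
  assumes [measurable]: "a \<in> borel_measurable borel" "b \<in> borel_measurable borel"
      "\<psi> \<in> borel_measurable borel"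
     "\<And>n. an n \<in> borel_measurable borel" "\<And>n. bn n \<in> borel_measurable borel"
    and ib: "integrable (unif p q) b" "\<And>n. integrable (unif p q) (bn n)"
    and M: "AE x in unif p q. \<bar>a x\<bar> \<le> M" "\<And>n. AE x in unif p q. \<bar>an n x\<bar> \<le> M" "M \<ge> 0"
    and K: "\<And>x. \<bar>\<psi> x\<bar> \<le> K"
    and la: "(\<lambda>n. \<integral>x. \<bar>an n x - a x\<bar> \<partial>unif p q) \<longlonglongrightarrow> 0"
    and lb: "(\<lambda>n. \<integral>x. \<bar>bn n x - b x\<bar> \<partial>unif p q) \<longlonglongrightarrow> 0"
  shows "(\<lambda>n. \<integral>x. an n x * bn n x * \<psi> x \<partial>unif p q) \<longlonglongrightarrow> (\<integral>x. a x * b x * \<psi> x \<partial>unif p q)"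
proof (rule LIMSEQ_I)
  fix \<epsilon> :: real assume "\<epsilon> > 0"
  have K0: "K \<ge> 0" using K order_trans abs_ge_zero by blast
  obtain A where A: "A \<ge> 0" "(\<integral>x. \<bar>b x\<bar> * indicator {x. \<bar>b x\<bar> > A} x \<partial>unif p q) < \<epsilon> / 2 / (2 * M * K +
      1)"
    by (rule tail_integral_small[OF _ ib(1), of "\<epsilon> / 2 / (2 * M * K + 1)"])
        (use \<open>\<epsilon> > 0\<close> M K0 in \<open>auto intro!: divide_pos_pos add_nonneg_pos\<close>)
  define t where "t = (\<integral>x. \<bar>b x\<bar> * indicator {x. \<bar>b x\<bar> > A} x \<partial>unif p q)"
  have t0: "t \<ge> 0" unfolding t_def by (intro Bochner_Integration.integral_nonneg) auto
  have t1: "2 * M * K * t < \<epsilon> / 2"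
  proof -
    have p: "2 * M * K + 1 > 0" using M K0 by (intro add_nonneg_pos) auto
    have "(2 * M * K + 1) * t < \<epsilon> / 2" using A(2) p unfolding t_def[symmetric]
      by (simp add: field_simps)
    then show ?thesis using t0 by (simp add: distrib_right)
  qed
  have ia: "integrable (unif p q) a" "\<And>n. integrable (unif p q) (an n)"
    by (rule unif.integrable_const_bound[where B=M]; use M in auto)+
  have it: "integrable (unif p q) (\<lambda>x. \<bar>b x\<bar> * indicator {x. \<bar>b x\<bar> > A} x)"
    by (rule Bochner_Integration.integrable_bound[OF ib(1)]) (auto simp: indicator_def)
  have prod: "integrable (unif p q) (\<lambda>x. f x * g x * \<psi> x)"
      if [measurable]: "f \<in> borel_measurable borel" "g \<in> borel_measurable borel" 
      and "AE x in unif p q. \<bar>f x\<bar> \<le> M" "integrable (unif p q) g" for f g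
  proof (rule Bochner_Integration.integrable_bound)
    show "integrable (unif p q) (\<lambda>x. M * \<bar>g x\<bar> * K)" using that by auto
    show "AE x in unif p q. norm (f x * g x * \<psi> x) \<le> norm (M * \<bar>g x\<bar> * K)"
      using that(3) by eventually_elim (use M K K0 in \<open>auto simp: abs_mult intro!: mult_mono\<close>)
  qed simp
  have main: "\<bar>(\<integral>x. an n x * bn n x * \<psi> x \<partial>unif p q) - (\<integral>x. a x * b x * \<psi> x \<partial>unif p q)\<bar>
     \<le> M * K * (\<integral>x. \<bar>bn n x - b x\<bar> \<partial>unif p q) + A * K * (\<integral>x. \<bar>an n x - a x\<bar> \<partial>unif p q) +
         2 * M * K * t" for n
  proof -
    have "\<bar>(\<integral>x. an n x * bn n x * \<psi> x \<partial>unif p q) - (\<integral>x. a x * b x * \<psi> x \<partial>unif p q)\<bar>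
      = \<bar>\<integral>x. an n x * bn n x * \<psi> x - a x * b x * \<psi> x \<partial>unif p q\<bar>"
      by (subst Bochner_Integration.integral_diff) (use prod M ib in auto)
    also have "\<dots> \<le> (\<integral>x. \<bar>an n x * bn n x * \<psi> x - a x * b x * \<psi> x\<bar> \<partial>unif p q)"
      by (rule integral_abs_bound)
    also have "\<dots> \<le> (\<integral>x. M * K * \<bar>bn n x - b x\<bar> + A * K * \<bar>an n x - a x\<bar> +
        2 * M * K * (\<bar>b x\<bar> * indicator {x. \<bar>b x\<bar> > A} x) \<partial>unif p q)"
    proof (rule integral_mono_AE)
      show "integrable (unif p q) (\<lambda>x. \<bar>an n x * bn n x * \<psi> x - a x * b x * \<psi> x\<bar>)"
        using prod M ib by auto
      show "integrable (unif p q) (\<lambda>x. M * K * \<bar>bn n x - b x\<bar> + A * K * \<bar>an n x - a x\<bar> +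
          2 * M * K * (\<bar>b x\<bar> * indicator {x. \<bar>b x\<bar> > A} x))"
        using ib ia it by auto
      show "AE x in unif p q. \<bar>an n x * bn n x * \<psi> x - a x * b x * \<psi> x\<bar> \<le>
          M * K * \<bar>bn n x - b x\<bar> + A * K * \<bar>an n x - a x\<bar> +
          2 * M * K * (\<bar>b x\<bar> * indicator {x. \<bar>b x\<bar> > A} x)"
        using M(1) M(2)[of n]
      proof eventually_elim
        case (elim x)
        have e: "an n x * bn n x * \<psi> x - a x * b x * \<psi> x =
            (an n x * (bn n x - b x) + (an n x - a x) * b x) * \<psi> x"
          by (simp add: algebra_simps)
        have p1: "\<bar>an n x * (bn n x - b x)\<bar> \<le> M * \<bar>bn n x - b x\<bar>"
          unfolding abs_mult using elim by (intro mult_right_mono) auto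
        have p2: "\<bar>(an n x - a x) * b x\<bar> \<le> A * \<bar>an n x - a x\<bar> +
            2 * M * (\<bar>b x\<bar> * indicator {x. \<bar>b x\<bar> > A} x)"
        proof (cases "\<bar>b x\<bar> > A")
          case True
          have "\<bar>an n x - a x\<bar> \<le> 2 * M" using elim by arith
          then have "\<bar>(an n x - a x) * b x\<bar> \<le> 2 * M * \<bar>b x\<bar>" unfolding abs_mult
            by (intro mult_right_mono) auto
          moreover have "0 \<le> A * \<bar>an n x - a x\<bar>" using A by simp
          ultimately show ?thesis using True by simp
        next
          case False
          then have "\<bar>(an n x - a x) * b x\<bar> \<le> \<bar>an n x - a x\<bar> * A" unfolding abs_mult
            by (intro mult_left_mono) auto
          then show ?thesis using False by (simp add: mult.commute)
        qed
        have "\<bar>an n x * bn n x * \<psi> x - a x * b x * \<psi> x\<bar> \<le>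
            (M * \<bar>bn n x - b x\<bar> + (A * \<bar>an n x - a x\<bar> + 2 * M * (\<bar>b x\<bar> * indicator {x. \<bar>b x\<bar> > A} x))) *
            K"
          unfolding e abs_mult[of _ "\<psi> x"]
          by (rule mult_mono[OF order_trans[OF abs_triangle_ineq add_mono[OF p1 p2]] K])
              (use M A in auto)
        also have "\<dots> = M * K * \<bar>bn n x - b x\<bar> + A * K * \<bar>an n x - a x\<bar> +
            2 * M * K * (\<bar>b x\<bar> * indicator {x. \<bar>b x\<bar> > A} x)"
          by (simp add: algebra_simps)
        finally show ?case .
      qed
    qed
    also have "\<dots> = M * K * (\<integral>x. \<bar>bn n x - b x\<bar> \<partial>unif p q) + A * K * (\<integral>x. \<bar>an n x - a x\<bar> \<partial>unif p q) +
        2 * M * K * t"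
      unfolding t_def using ib ia it by simp
    finally show ?thesis .
  qed
  have "(\<lambda>n. M * K * (\<integral>x. \<bar>bn n x - b x\<bar> \<partial>unif p q) + A * K * (\<integral>x. \<bar>an n x - a x\<bar> \<partial>unif p q)) \<longlonglongrightarrow>
      M * K * 0 + A * K * 0"
    by (intro tendsto_intros la lb)
  from LIMSEQ_D[OF this, of "\<epsilon>/2"] \<open>\<epsilon> > 0\<close> obtain N where
    N: "\<And>n. n \<ge> N \<Longrightarrow> \<bar>M * K * (\<integral>x. \<bar>bn n x - b x\<bar> \<partial>unif p q) +
        A * K * (\<integral>x. \<bar>an n x - a x\<bar> \<partial>unif p q)\<bar> < \<epsilon> / 2"
    by auto
  show "\<exists>no. \<forall>n\<ge>no. norm ((\<integral>x. an n x * bn n x * \<psi> x \<partial>unif p q) - (\<integral>x. a x * b x * \<psi> x \<partial>unif p q)) < \<epsilon>"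
    unfolding real_norm_def using main N t1 by (intro exI[of _ N] allI impI)
        (smt (verit) field_sum_of_halves)
qed

text \<open>
  A field \<open>u \<in> L\<^sup>2\<close> on the torus, given by Borel measurable components, with weak divergence
  zero and weak curl \<open>l u\<close>.  The curl enters through the antisymmetric matrix
  \<open>Om i j = \<partial>\<^sub>i u\<^sub>j - \<partial>\<^sub>j u\<^sub>i\<close>.  Of the relation between curl and \<open>u\<close> only the bound by \<open>\<bar>l\<bar> \<bar>u\<bar>\<close> and the
  identity \<open>\<Sum>\<^sub>i u\<^sub>i Om i j = 0\<close> are kept; the latter says that curl and \<open>u\<close> are parallel.  The last
  assumption is the Kato condition on \<open>l\<close>.
\<close>

locale beltrami =
  fixes u :: "3 \<Rightarrow> real^3 \<Rightarrow> real" and l :: "real^3 \<Rightarrow> real" and Om :: "3 \<Rightarrow> 3 \<Rightarrow> real^3 \<Rightarrow> real"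
      and \<alpha> C :: real
  assumes um [measurable]: "\<And>i. u i \<in> borel_measurable borel" and up: "\<And>i. periodic (u i)"
    and u2: "\<And>i. integrable tor (\<lambda>x. (u i x)\<^sup>2)"
    and lm [measurable]: "l \<in> borel_measurable borel" and lp: "periodic l"
    and l2: "integrable tor (\<lambda>x. (l x)\<^sup>2)"
    and om [measurable]: "\<And>i j. Om i j \<in> borel_measurable borel" and op: "\<And>i j. periodic (Om i j)"
    and Ob: "\<And>i j x. \<bar>Om i j x\<bar> \<le> \<bar>l x\<bar> * (\<Sum>k\<in>UNIV. \<bar>u k x\<bar>)"
    and On: "\<And>j x. (\<Sum>i\<in>UNIV. u i x * Om i j x) = 0"
    and wdiv: "\<And>g. g \<in> trig \<Longrightarrow> (\<Sum>i\<in>UNIV. \<integral>x. partial i g x * u i x \<partial>tor) = 0"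
    and wcurl: "\<And>g i j. g \<in> trig \<Longrightarrow> (\<integral>x. partial i g x * u j x \<partial>tor) - (\<integral>x. partial j g x * u i x \<partial>tor) =
        - (\<integral>x. g x * Om i j x \<partial>tor)"
    and \<alpha>: "\<alpha> < 1" and C: "0 \<le> C"
    and kato: "\<And>x s. 0 < s \<Longrightarrow> s \<le> 1/2 \<Longrightarrow> (cube_mass l x s) \<le> ennreal (C * s powr - \<alpha>)"
begin

text \<open>The \<open>\<ell>\<^sup>1\<close> length of \<open>u\<close>.\<close>

definition U where "U x = (\<Sum>k\<in>UNIV. \<bar>u k x\<bar>)"

lemma U_meas [measurable]: "U \<in> borel_measurable borel" unfolding U_def by measurable
lemma U_nonneg: "0 \<le> U x" unfolding U_def by (simp add: sum_nonneg)
lemma U_per: "periodic U" using up by (simp add: U_def periodic_def)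

lemma ui: "integrable tor (u i)" by (rule integrable_from_square[OF um u2])
lemma li: "integrable tor l" by (rule integrable_from_square[OF lm l2])
lemma lUi: "integrable tor (\<lambda>x. \<bar>l x\<bar> * U x)"
proof -
  have "integrable tor (\<lambda>x. \<bar>l x * u k x\<bar>)" for k
    using integrable_product_from_squares[OF lm um l2 u2] by auto
  then have "integrable tor (\<lambda>x. \<Sum>k\<in>UNIV. \<bar>l x * u k x\<bar>)" by auto
  then show ?thesis by (simp add: U_def sum_distrib_left abs_mult)
qed
lemma Oi: "integrable tor (Om i j)"
  by (rule Bochner_Integration.integrable_bound[OF lUi]) (use Ob in \<open>auto simp: U_def abs_mult\<close>)

text \<open>
  The mollified field \<open>V\<close>, its first derivatives \<open>DV n i j = \<partial>\<^sub>i V\<^sub>j\<close> and second derivatives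
  \<open>E n i j k = \<partial>\<^sub>k \<partial>\<^sub>i V\<^sub>j\<close>.
\<close>

definition V where "V n i = conv (kern n) (u i)"
definition DV where "DV n i j = conv (\<lambda>z. - partial i (kern n) z) (u j)"
definition E where "E n i j k = conv (\<lambda>z. - partial k (\<lambda>z. - partial i (kern n) z) z) (u j)"

lemma V_c1: "c1_grad (V n i) (\<lambda>j. DV n j i)"
  unfolding V_def DV_def by (rule conv_c1[OF kern_trig ui])
lemma DV_c1: "c1_grad (DV n i j) (E n i j)"
  using conv_c1[OF trig_uminus[OF trig_partial[OF kern_trig]] ui] by (simp add: DV_def E_def[abs_def])
lemma V_per: "periodic (V n i)" unfolding V_def by (rule conv_periodic[OF trig_periodic[OF kern_trig]])
lemma DV_per: "periodic (DV n i j)" unfolding DV_def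
  by (rule conv_periodic[OF trig_periodic[OF trig_uminus[OF trig_partial[OF kern_trig]]]])

lemma conv_div: assumes "h \<in> trig" shows "(\<Sum>i\<in>UNIV. conv (\<lambda>z. - partial i h z) (u i) x) = 0"
proof -
  have "conv (\<lambda>z. - partial i h z) (u i) x = - (\<integral>y. partial i (\<lambda>y. h (y - x)) y * u i y \<partial>tor)" for i
    by (simp add: conv_def partial_shift[OF assms])
  then show ?thesis using wdiv[OF trig_shift[OF assms]] by (simp add: sum_negf)
qed

lemma div_DV: "(\<Sum>i\<in>UNIV. DV n i i x) = 0"
  unfolding DV_def by (rule conv_div[OF kern_trig])
lemma div_E: "(\<Sum>j\<in>UNIV. E n i j j x) = 0"
  unfolding E_def by (rule conv_div[OF trig_uminus[OF trig_partial[OF kern_trig]]])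

lemma curl_DV: "DV n i j x - DV n j i x = conv (kern n) (Om i j) x"
proof -
  have "DV n i j x = - (\<integral>y. partial i (\<lambda>y. kern n (y - x)) y * u j y \<partial>tor)" for i j
    by (simp add: DV_def conv_def partial_shift[OF kern_trig])
  then show ?thesis using wcurl[OF trig_shift[OF kern_trig], of i n x j] by (simp add: conv_def)
qed

lemma V_L1: "(\<lambda>n. \<integral>\<^sup>+x. ennreal \<bar>V n i x - u i x\<bar> \<partial>tor) \<longlonglongrightarrow> 0"
  unfolding V_def by (rule conv_kern_L1[OF um up ui])
lemma O_L1: "(\<lambda>n. \<integral>\<^sup>+x. ennreal \<bar>conv (kern n) (Om i j) x - Om i j x\<bar> \<partial>tor) \<longlonglongrightarrow> 0"
  by (rule conv_kern_L1[OF om op Oi])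

lemma V_meas [measurable]: "V n i \<in> borel_measurable borel" unfolding V_def
  by (rule conv_measurable[OF ui])
lemma O_meas [measurable]: "conv (kern n) (Om i j) \<in> borel_measurable borel"
  by (rule conv_measurable[OF Oi])

text \<open>The estimate \<open>solenoidal_field_bound\<close> applied to the mollified fields, in the limit.\<close>

lemma rep_bound:
  assumes e: "0 < e" "e \<le> 1/2"
  shows "AE x in tor. ennreal \<bar>u i x\<bar> \<le> 32 * (ennreal (1 / e^3) * (\<integral>\<^sup>+x. ennreal \<bar>u i x\<bar> \<partial>tor))
     + 32 * (\<Sum>j\<in>UNIV. avg e (\<lambda>x. ennreal \<bar>Om j i x\<bar>) x)"
proof -
  define R where "R x = 32 * (ennreal (1 / e^3) * (\<integral>\<^sup>+x. ennreal \<bar>u i x\<bar> \<partial>tor))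
     + 32 * (\<Sum>j\<in>UNIV. avg e (\<lambda>x. ennreal \<bar>Om j i x\<bar>) x)" for x
  have [measurable]: "R \<in> borel_measurable borel" unfolding R_def by measurable
  define \<delta> where "\<delta> n = (\<integral>\<^sup>+x. ennreal \<bar>V n i x - u i x\<bar> \<partial>tor)" for n
  define \<delta>' where "\<delta>' n j = (\<integral>\<^sup>+x. ennreal \<bar>conv (kern n) (Om j i) x - Om j i x\<bar> \<partial>tor)" for n j
  \<comment> \<open>the error made when \<open>u\<close> and \<open>Om\<close> are replaced by their mollifications; its integral tends to zero\<close>
  define G where "G n x = ennreal \<bar>V n i x - u i x\<bar> + 32 * (ennreal (1 / e^3) * \<delta> n) + 
    32 * (\<Sum>j\<in>UNIV. avg e (\<lambda>x. ennreal \<bar>conv (kern n) (Om j i) x - Om j i x\<bar>) x)" for n x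
  have tri: "ennreal \<bar>a\<bar> \<le> ennreal \<bar>b\<bar> + ennreal \<bar>a - b\<bar>" for a b :: real
  proof -
    have "\<bar>a\<bar> \<le> \<bar>b\<bar> + \<bar>a - b\<bar>" by arith
    then have "ennreal \<bar>a\<bar> \<le> ennreal (\<bar>b\<bar> + \<bar>a - b\<bar>)" by (rule ennreal_leI)
    then show ?thesis by (subst (asm) ennreal_plus) auto
  qed
  have le: "ennreal \<bar>u i x\<bar> \<le> R x + G n x" for n x
  proof -
    have a1: "(\<integral>\<^sup>+y. ennreal \<bar>V n i (x + e *\<^sub>R y)\<bar> \<partial>cube) \<le>
        ennreal (1 / e^3) * (\<integral>\<^sup>+x. ennreal \<bar>u i x\<bar> \<partial>tor) + ennreal (1 / e^3) * \<delta> n"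
    proof -
      have "(\<integral>\<^sup>+y. ennreal \<bar>V n i (x + e *\<^sub>R y)\<bar> \<partial>cube) \<le>
          ennreal (1 / e^3) * (\<integral>\<^sup>+z. ennreal \<bar>V n i z\<bar> \<partial>tor)"
        by (rule nn_integral_small_cube_le[of "\<lambda>z. ennreal \<bar>V n i z\<bar>"])
            (use V_per[of n i] e in \<open>auto simp: periodic_def\<close>)
      also have "\<dots> \<le> ennreal (1 / e^3) * (\<integral>\<^sup>+z. ennreal \<bar>u i z\<bar> + ennreal \<bar>V n i z - u i z\<bar> \<partial>tor)"
        by (intro mult_left_mono nn_integral_mono tri) auto
      also have "\<dots> = ennreal (1 / e^3) * (\<integral>\<^sup>+x. ennreal \<bar>u i x\<bar> \<partial>tor) + ennreal (1 / e^3) * \<delta> n"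
        by (subst nn_integral_add) (auto simp: distrib_left \<delta>_def)
      finally show ?thesis .
    qed
    have a2: "(\<integral>\<^sup>+s. \<integral>\<^sup>+y. ennreal \<bar>DV n j i (x + s *\<^sub>R y) - DV n i j (x + s *\<^sub>R y)\<bar> \<partial>cube \<partial>unif 0 e)
       \<le> avg e (\<lambda>x. ennreal \<bar>Om j i x\<bar>) x + avg e (\<lambda>x. ennreal \<bar>conv (kern n) (Om j i) x - Om j i x\<bar>) x"
           for j
    proof -
      have "(\<integral>\<^sup>+s. \<integral>\<^sup>+y. ennreal \<bar>DV n j i (x + s *\<^sub>R y) - DV n i j (x + s *\<^sub>R y)\<bar> \<partial>cube \<partial>unif 0 e) =
          avg e (\<lambda>x. ennreal \<bar>conv (kern n) (Om j i) x\<bar>) x"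
        by (simp add: curl_DV avg_def)
      also have "\<dots> \<le> avg e (\<lambda>x. ennreal \<bar>Om j i x\<bar> + ennreal \<bar>conv (kern n) (Om j i) x - Om j i x\<bar>) x"
        by (intro avg_mono tri)
      also have "\<dots> = avg e (\<lambda>x. ennreal \<bar>Om j i x\<bar>) x +
          avg e (\<lambda>x. ennreal \<bar>conv (kern n) (Om j i) x - Om j i x\<bar>) x"
        by (rule avg_add) auto
      finally show ?thesis .
    qed
    have "ennreal \<bar>u i x\<bar> \<le> ennreal \<bar>V n i x\<bar> + ennreal \<bar>V n i x - u i x\<bar>"
      using tri[of "u i x" "V n i x"] by (simp add: abs_minus_commute)
    also have "ennreal \<bar>V n i x\<bar> \<le> 32 * (\<integral>\<^sup>+y. ennreal \<bar>V n i (x + e *\<^sub>R y)\<bar> \<partial>cube) +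
      32 * (\<Sum>j\<in>UNIV. \<integral>\<^sup>+s. \<integral>\<^sup>+y. ennreal \<bar>DV n j i (x + s *\<^sub>R y) - DV n i j (x +
          s *\<^sub>R y)\<bar> \<partial>cube \<partial>unif 0 e)"
      by (rule solenoidal_field_bound[OF V_c1 DV_c1 div_E V_per DV_per]) (use e in auto)
    also have "\<dots> \<le> 32 * (ennreal (1 / e^3) * (\<integral>\<^sup>+x. ennreal \<bar>u i x\<bar> \<partial>tor) + ennreal (1 / e^3) * \<delta> n) + 
       32 * (\<Sum>j\<in>UNIV. avg e (\<lambda>x. ennreal \<bar>Om j i x\<bar>) x +
           avg e (\<lambda>x. ennreal \<bar>conv (kern n) (Om j i) x - Om j i x\<bar>) x)"
      by (intro add_mono mult_left_mono sum_mono a1 a2) auto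
    also have "\<dots> + ennreal \<bar>V n i x - u i x\<bar> = R x + G n x"
      by (simp add: R_def G_def distrib_left sum.distrib add_ac)
    finally show ?thesis by (simp add: add_mono)
  qed
  have intG: "(\<integral>\<^sup>+x. G n x \<partial>tor) = \<delta> n + 32 * (ennreal (1 / e^3) * \<delta> n) +
      32 * (\<Sum>j\<in>UNIV. 8 * ennreal e * \<delta>' n j)" for n
  proof -
    have "periodic (\<lambda>x. ennreal \<bar>conv (kern n) (Om j i) x - Om j i x\<bar>)" for j
      using op[of j i] conv_periodic[OF trig_periodic[OF kern_trig], of n "Om j i"]
        by (simp add: periodic_def)
    then have "(\<integral>\<^sup>+x. avg e (\<lambda>x. ennreal \<bar>conv (kern n) (Om j i) x - Om j i x\<bar>) x \<partial>tor) =
        8 * ennreal e * \<delta>' n j" for j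
      unfolding \<delta>'_def by (intro nn_integral_avg) (use e in auto)
    then show ?thesis unfolding G_def
      by (simp add: nn_integral_add nn_integral_cmult nn_integral_sum \<delta>_def[symmetric])
  qed
  have "(\<lambda>n. \<delta> n + 32 * (ennreal (1 / e^3) * \<delta> n) + 32 * (\<Sum>j\<in>UNIV. 8 * ennreal e * \<delta>' n j)) \<longlonglongrightarrow>
      0 + 32 * (ennreal (1 / e^3) * 0) + 32 * (\<Sum>j\<in>(UNIV::3 set). 8 * ennreal e * 0)"
    unfolding \<delta>_def \<delta>'_def
    by (intro tendsto_add ennreal_tendsto_cmult tendsto_sum V_L1 O_L1)
        (auto simp: ennreal_mult_less_top)
  then have lim: "(\<lambda>n. \<integral>\<^sup>+x. G n x \<partial>tor) \<longlonglongrightarrow> 0" by (simp add: intG)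
  have "(\<integral>\<^sup>+x. ennreal \<bar>u i x\<bar> - R x \<partial>tor) \<le> (\<integral>\<^sup>+x. G n x \<partial>tor)" for n
    by (intro nn_integral_mono) (use le[of _ n] in \<open>auto simp: ennreal_minus_le_iff\<close>)
  then have "(\<integral>\<^sup>+x. ennreal \<bar>u i x\<bar> - R x \<partial>tor) \<le> 0"
    by (intro LIMSEQ_le_const[OF lim]) auto
  then have "(\<integral>\<^sup>+x. ennreal \<bar>u i x\<bar> - R x \<partial>tor) = 0" by simp
  then have "AE x in tor. ennreal \<bar>u i x\<bar> - R x = 0" by (subst (asm) nn_integral_0_iff_AE) auto
  then show ?thesis by eventually_elim (metis R_def ennreal_minus_eq_0)
qed


lemma avg_l: assumes "0 < e" "e \<le> 1/2" shows "avg e (\<lambda>x. ennreal \<bar>l x\<bar>) x \<le>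
    ennreal (C * e powr (1 - \<alpha>) / (1 - \<alpha>))"
proof -
  have "avg e (\<lambda>x. ennreal \<bar>l x\<bar>) x \<le> (\<integral>\<^sup>+s. ennreal C * ennreal (s powr - \<alpha>) \<partial>unif 0 e)"
    unfolding avg_def
  proof (rule nn_integral_mono_AE)
    have "AE s in lborel. s \<noteq> (0::real)" by (rule AE_lborel_singleton)
    then show "AE s in unif 0 e. (cube_mass l x s) \<le> ennreal C * ennreal (s powr - \<alpha>)"
      unfolding AE_unif
    proof eventually_elim
      case (elim s)
      then show ?case using kato[of s x] assms C by (auto simp: ennreal_mult)
    qed
  qed
  also have "\<dots> = ennreal (C * e powr (1 - \<alpha>) / (1 - \<alpha>))"
    using assms C \<alpha> by (simp add: nn_integral_cmult nn_integral_powr)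
        (simp add: ennreal_mult'[symmetric])
  finally show ?thesis .
qed

lemma small_scale: obtains e where "0 < e" "e \<le> 1/2" "288 * (C * e powr (1 - \<alpha>) / (1 - \<alpha>)) \<le> 1/2"
proof -
  have "((\<lambda>e. 288 * (C * e powr (1 - \<alpha>) / (1 - \<alpha>))) \<longlongrightarrow> 288 * (C * 0 / (1 - \<alpha>))) (at_right 0)"
  proof (intro tendsto_intros)
    show "((\<lambda>e::real. e powr (1 - \<alpha>)) \<longlongrightarrow> 0) (at_right 0)"
      by (rule tendsto_eq_rhs[OF tendsto_powr'[OF tendsto_ident_at tendsto_const]])
          (use \<alpha> in \<open>auto simp: eventually_at_right_less intro: eventually_at_right_less[THEN eventually_mono]\<close>)
  qed (use \<alpha> in auto)
  then have "eventually (\<lambda>e. 288 * (C * e powr (1 - \<alpha>) / (1 - \<alpha>)) < 1/2) (at_right 0)"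
    by (rule order_tendstoD) simp
  moreover have "eventually (\<lambda>e::real. e \<in> {0<..<1/2}) (at_right 0)"
    by (rule eventually_at_right_real) simp
  ultimately have "eventually (\<lambda>e. 288 * (C * e powr (1 - \<alpha>) / (1 - \<alpha>)) < 1/2 \<and>
      e \<in> {0<..<1/2}) (at_right 0)"
    by (rule eventually_conj)
  then have "\<exists>e. 288 * (C * e powr (1 - \<alpha>) / (1 - \<alpha>)) < 1/2 \<and> e \<in> {0<..<1/2}"
    using eventually_happens[of _ "at_right (0::real)"] trivial_limit_at_right_real[of "0::real"]
      by (metis (no_types, lifting))
  then show thesis using that by fastforce
qed

text \<open>
  With \<open>\<bar>u\<bar> \<le> H + K (\<bar>l\<bar> \<bar>u\<bar>)\<close> and \<open>K \<bar>l\<bar> \<le> 1/2\<close> put \<open>M = 2 H\<close> and \<open>v = (\<bar>u\<bar> - M)\<^sup>+\<close>.  Inserting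
  \<open>\<bar>u\<bar> \<le> M + v\<close> on the right gives \<open>v \<le> K (\<bar>l\<bar> v)\<close>; integrating against \<open>\<bar>l\<bar>\<close> and moving \<open>K\<close> to the
  other factor gives \<open>\<integral> \<bar>l\<bar> v \<le> (1/2) \<integral> \<bar>l\<bar> v\<close>, so that \<open>\<bar>l\<bar> v = 0\<close> and then \<open>v = 0\<close>.
\<close>

lemma u_bounded: obtains M where "M \<ge> 0" "AE x in tor. U x \<le> M"
proof -
  obtain e where e: "0 < e" "e \<le> 1/2" and small: "288 * (C * e powr (1 - \<alpha>) / (1 - \<alpha>)) \<le> 1/2"
    by (rule small_scale)
  \<comment> \<open>the sum over \<open>i\<close> of the first terms in \<open>rep_bound\<close>\<close>
  define H where "H = 32 / e^3 * (\<Sum>i\<in>UNIV. \<integral>x. \<bar>u i x\<bar> \<partial>tor)"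
  have H0: "H \<ge> 0" unfolding H_def using e by (intro mult_nonneg_nonneg sum_nonneg
      Bochner_Integration.integral_nonneg) auto
  define M where "M = 2 * H"
  have M0: "M \<ge> 0" using H0 by (simp add: M_def)
  define v where "v x = max 0 (U x - M)" for x
  have [measurable]: "v \<in> borel_measurable borel" unfolding v_def by measurable
  have v0: "0 \<le> v x" for x by (simp add: v_def)
  have vU: "v x \<le> U x" for x using U_nonneg[of x] M0 by (simp add: v_def)
  have avgl: "288 * avg e (\<lambda>x. ennreal \<bar>l x\<bar>) x \<le> ennreal (1/2)" for x
  proof -
    have "288 * avg e (\<lambda>x. ennreal \<bar>l x\<bar>) x \<le> ennreal 288 * ennreal (C * e powr (1 - \<alpha>) / (1 - \<alpha>))"
      using avg_l[OF e, of x] by (simp add: mult_left_mono)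
    also have "\<dots> = ennreal (288 * (C * e powr (1 - \<alpha>) / (1 - \<alpha>)))"
      using C \<alpha> by (intro ennreal_mult[symmetric]) auto
    also have "\<dots> \<le> ennreal (1/2)" by (rule ennreal_leI[OF small])
    finally show ?thesis .
  qed
  have main: "AE x in tor. ennreal (U x) \<le> ennreal H + 288 * avg e (\<lambda>x. ennreal (\<bar>l x\<bar> * U x)) x"
  proof -
    have "AE x in tor. \<forall>i\<in>UNIV. ennreal \<bar>u i x\<bar> \<le>
        32 * (ennreal (1 / e^3) * (\<integral>\<^sup>+x. ennreal \<bar>u i x\<bar> \<partial>tor))
     + 32 * (\<Sum>j\<in>UNIV. avg e (\<lambda>x. ennreal \<bar>Om j i x\<bar>) x)"
      by (intro AE_finite_allI rep_bound e) auto
    then show ?thesis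
    proof eventually_elim
      case (elim x)
      have "ennreal (U x) = (\<Sum>i\<in>UNIV. ennreal \<bar>u i x\<bar>)" by (simp add: U_def)
      also have "\<dots> \<le> (\<Sum>i\<in>UNIV. 32 * (ennreal (1 / e^3) * (\<integral>\<^sup>+x. ennreal \<bar>u i x\<bar> \<partial>tor))
          + 32 * (\<Sum>j\<in>UNIV. avg e (\<lambda>x. ennreal \<bar>Om j i x\<bar>) x))"
        by (rule sum_mono) (use elim in auto)
      also have "\<dots> \<le> (\<Sum>i\<in>UNIV. 32 * (ennreal (1 / e^3) * (\<integral>\<^sup>+x. ennreal \<bar>u i x\<bar> \<partial>tor))
          + 32 * (\<Sum>j\<in>(UNIV::3 set). avg e (\<lambda>x. ennreal (\<bar>l x\<bar> * U x)) x))"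
        by (intro sum_mono add_mono mult_left_mono avg_mono ennreal_leI) (auto simp: Ob U_def)
      \<comment> \<open>there are \<open>9\<close> pairs of indices, and \<open>288 = 9 \<cdot> 32\<close>\<close>
      also have "\<dots> = ennreal H + 288 * avg e (\<lambda>x. ennreal (\<bar>l x\<bar> * U x)) x"
      proof -
        have i: "(\<integral>\<^sup>+x. ennreal \<bar>u i x\<bar> \<partial>tor) = ennreal (\<integral>x. \<bar>u i x\<bar> \<partial>tor)" for i
          by (rule nn_integral_eq_integral) (use ui in auto)
        have "(\<Sum>i\<in>UNIV. 32 * (ennreal (1 / e^3) * (\<integral>\<^sup>+x. ennreal \<bar>u i x\<bar> \<partial>tor))) = ennreal H"
        proof -
          have "32 * (ennreal (1 / e^3) * (\<integral>\<^sup>+x. ennreal \<bar>u i x\<bar> \<partial>tor)) =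
              ennreal (32 / e^3 * (\<integral>x. \<bar>u i x\<bar> \<partial>tor))" for i
          proof -
            have "32 * (ennreal (1 / e^3) * (\<integral>\<^sup>+x. ennreal \<bar>u i x\<bar> \<partial>tor)) =
                ennreal 32 * ennreal (1 / e^3) * ennreal (\<integral>x. \<bar>u i x\<bar> \<partial>tor)"
              by (simp add: i mult.assoc)
            also have "\<dots> = ennreal (32 * (1 / e^3) * (\<integral>x. \<bar>u i x\<bar> \<partial>tor))"
              using e by (subst ennreal_mult[symmetric], simp, simp)+ simp
            finally show ?thesis by simp
          qed
          then show ?thesis unfolding H_def using e by (simp add: sum_distrib_left)
        qed
        then show ?thesis by (simp add: sum.distrib mult.assoc[symmetric])
      qed
      finally show ?case .
    qed
  qed
  have vle: "AE x in tor. ennreal (v x) \<le> 288 * avg e (\<lambda>x. ennreal (\<bar>l x\<bar> * v x)) x"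
    using main
  proof eventually_elim
    case (elim x)
    let ?A = "288 * avg e (\<lambda>x. ennreal (\<bar>l x\<bar> * v x)) x"
    have "288 * avg e (\<lambda>x. ennreal (\<bar>l x\<bar> * U x)) x \<le>
        288 * avg e (\<lambda>x. ennreal M * ennreal \<bar>l x\<bar> + ennreal (\<bar>l x\<bar> * v x)) x"
    proof (intro mult_left_mono avg_mono)
      fix x
      have "\<bar>l x\<bar> * U x \<le> \<bar>l x\<bar> * (M + v x)" by (intro mult_left_mono) (auto simp: v_def)
      then have "ennreal (\<bar>l x\<bar> * U x) \<le> ennreal (M * \<bar>l x\<bar> + \<bar>l x\<bar> * v x)"
        by (intro ennreal_leI) (simp add: algebra_simps)
      then show "ennreal (\<bar>l x\<bar> * U x) \<le> ennreal M * ennreal \<bar>l x\<bar> + ennreal (\<bar>l x\<bar> * v x)"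
        using M0 v0[of x] by (simp add: ennreal_mult ennreal_plus)
    qed simp
    also have "\<dots> = ennreal M * (288 * avg e (\<lambda>x. ennreal \<bar>l x\<bar>) x) + ?A"
      by (simp add: avg_add avg_cmult distrib_left mult_ac)
    also have "\<dots> \<le> ennreal M * ennreal (1/2) + ?A"
      by (intro add_mono mult_left_mono avgl) auto
    also have "ennreal M * ennreal (1/2) = ennreal H" using M0
      by (subst ennreal_mult[symmetric]) (auto simp: M_def)
    finally have "ennreal (U x) \<le> ennreal H + (ennreal H + ?A)" using elim
      by (meson add_left_mono order_trans)
    also have "\<dots> = ennreal M + ?A" using H0 by (simp add: M_def add.assoc[symmetric]
        ennreal_plus[symmetric] del: ennreal_plus)
    finally have "ennreal (U x) - ennreal M \<le> ?A" by (simp add: ennreal_minus_le_iff)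
    moreover have "ennreal (v x) = ennreal (U x) - ennreal M"
      using M0 by (auto simp: v_def ennreal_minus max_def ennreal_neg)
    ultimately show ?case by simp
  qed
  define N where "N = (\<integral>\<^sup>+x. ennreal (\<bar>l x\<bar> * v x) \<partial>tor)"
  have vper: "periodic (\<lambda>x. ennreal (\<bar>l x\<bar> * v x))" using lp U_per by (simp add: periodic_def v_def)
  have "N \<le> (\<integral>\<^sup>+x. ennreal (\<bar>l x\<bar> * U x) \<partial>tor)" unfolding N_def
    by (intro nn_integral_mono ennreal_leI mult_left_mono vU) auto
  also have "\<dots> < \<infinity>" using lUi U_nonneg by (subst nn_integral_eq_integral) auto
  finally have Nfin: "N < \<infinity>" .
  have "N \<le> (\<integral>\<^sup>+x. ennreal \<bar>l x\<bar> * (288 * avg e (\<lambda>x. ennreal (\<bar>l x\<bar> * v x)) x) \<partial>tor)" unfolding N_def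
    by (rule nn_integral_mono_AE, use vle in eventually_elim) (simp add: ennreal_mult v0 mult_left_mono)
  also have "\<dots> = 288 * (\<integral>\<^sup>+x. ennreal \<bar>l x\<bar> * avg e (\<lambda>x. ennreal (\<bar>l x\<bar> * v x)) x \<partial>tor)"
    by (subst nn_integral_cmult[symmetric]) (auto simp: mult_ac)
  also have "(\<integral>\<^sup>+x. ennreal \<bar>l x\<bar> * avg e (\<lambda>x. ennreal (\<bar>l x\<bar> * v x)) x \<partial>tor) =
      (\<integral>\<^sup>+x. ennreal (\<bar>l x\<bar> * v x) * avg e (\<lambda>x. ennreal \<bar>l x\<bar>) x \<partial>tor)"
    by (rule avg_symmetric) (use vper lp in \<open>auto simp: periodic_def\<close>)
  also have "288 * \<dots> = (\<integral>\<^sup>+x. ennreal (\<bar>l x\<bar> * v x) * (288 * avg e (\<lambda>x. ennreal \<bar>l x\<bar>) x) \<partial>tor)"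
    by (subst nn_integral_cmult[symmetric]) (auto simp: mult_ac)
  also have "\<dots> \<le> (\<integral>\<^sup>+x. ennreal (\<bar>l x\<bar> * v x) * ennreal (1/2) \<partial>tor)"
    by (intro nn_integral_mono mult_left_mono avgl) auto
  also have "\<dots> = N * ennreal (1/2)" unfolding N_def by (rule nn_integral_multc) measurable
  finally have "N \<le> N * ennreal (1/2)" .
  then have N0: "N = 0"
  proof -
    obtain r where r: "N = ennreal r" "r \<ge> 0" using Nfin by (cases N) auto
    then have "ennreal r \<le> ennreal (r * (1/2))" using \<open>N \<le> N * ennreal (1/2)\<close>
      by (subst ennreal_mult) auto
    then have "r \<le> r * (1/2)" using r by (subst (asm) ennreal_le_iff) auto
    then show ?thesis using r by simp
  qed
  have "(\<integral>\<^sup>+x. avg e (\<lambda>x. ennreal (\<bar>l x\<bar> * v x)) x \<partial>tor) = 0"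
    using N0 e by (subst nn_integral_avg[OF _ vper]) (auto simp: N_def[symmetric])
  then have "AE x in tor. avg e (\<lambda>x. ennreal (\<bar>l x\<bar> * v x)) x = 0"
    by (subst (asm) nn_integral_0_iff_AE) auto
  with vle have "AE x in tor. U x \<le> M"
  proof eventually_elim
    case (elim x)
    then have "v x = 0" using v0[of x] by (simp add: ennreal_eq_0_iff)
    then show ?case by (simp add: v_def max_def split: if_splits)
  qed
  with M0 show thesis by (rule that)
qed

lemma V_bounded: assumes "AE x in tor. U x \<le> M" shows "\<bar>V n i x\<bar> \<le> M"
proof -
  have [measurable]: "kern n \<in> borel_measurable borel" by (rule trig_measurable[OF kern_trig])
  have M0: "M \<ge> 0"
  proof (rule ccontr)
    assume "\<not> M \<ge> 0"
    then have "AE x in tor. False" using assms U_nonneg by (auto elim!: eventually_mono) (smt (verit))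
    then have "emeasure tor UNIV = 0" by (simp add: AE_iff_null null_sets_def)
    then show False by simp
  qed
  have ae: "AE z in tor. U (x + z) \<le> M"
  proof -
    have "(\<integral>\<^sup>+z. indicator {z. U z > M} (z + x) \<partial>tor) = (\<integral>\<^sup>+z. indicator {z. U z > M} z \<partial>tor)"
      by (rule nn_integral_tor_shift) (use U_per in \<open>auto simp: periodic_def indicator_def\<close>)
    also have "\<dots> = 0" using assms by (subst nn_integral_0_iff_AE)
        (auto simp: indicator_def elim!: eventually_mono)
    finally show ?thesis by (subst (asm) nn_integral_0_iff_AE)
        (auto simp: indicator_def add.commute elim!: eventually_mono split: if_splits)
  qed
  have "ennreal \<bar>V n i x\<bar> \<le> (\<integral>\<^sup>+z. ennreal (kern n z) * ennreal \<bar>u i (x + z)\<bar> \<partial>tor)"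
    using conv_kern_nn_bound[OF um up ui, of n i x 0] by (simp add: V_def)
  also have "\<dots> \<le> (\<integral>\<^sup>+z. ennreal (kern n z) * ennreal M \<partial>tor)"
  proof (rule nn_integral_mono_AE, use ae in eventually_elim)
    fix z assume "U (x + z) \<le> M"
    moreover have "\<bar>u i (x + z)\<bar> \<le> U (x + z)" unfolding U_def by (rule member_le_sum) auto
    ultimately show "ennreal (kern n z) * ennreal \<bar>u i (x + z)\<bar> \<le> ennreal (kern n z) * ennreal M"
      by (intro mult_left_mono ennreal_leI) auto
  qed
  also have "\<dots> = ennreal M"
  proof -
    have "(\<integral>\<^sup>+z. ennreal (kern n z) \<partial>tor) = 1"
      by (subst nn_integral_eq_integral[OF kern_integrable]) (auto simp: kern_integral kern_nonneg)
    then show ?thesis by (simp add: nn_integral_multc)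
  qed
  finally show ?thesis using M0 by simp
qed

lemma real_L1:
  assumes [measurable]: "\<And>n. F n \<in> borel_measurable borel" and i: "\<And>n. integrable tor (F n)"
    and l: "(\<lambda>n. \<integral>\<^sup>+x. ennreal \<bar>F n x\<bar> \<partial>tor) \<longlonglongrightarrow> 0"
  shows "(\<lambda>n. \<integral>x. \<bar>F n x\<bar> \<partial>tor) \<longlonglongrightarrow> 0"
proof -
  have "(\<integral>\<^sup>+x. ennreal \<bar>F n x\<bar> \<partial>tor) = ennreal (\<integral>x. \<bar>F n x\<bar> \<partial>tor)" for n
    by (rule nn_integral_eq_integral) (use i in auto)
  with l have "(\<lambda>n. ennreal (\<integral>x. \<bar>F n x\<bar> \<partial>tor)) \<longlonglongrightarrow> ennreal 0" by simp
  then show ?thesis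
    by (subst (asm) tendsto_ennreal_iff) (auto intro!: always_eventually Bochner_Integration.integral_nonneg)
qed

text \<open>
  For the mollified field two integrations by parts give
  \<open>\<integral> V\<^sub>i V\<^sub>j \<partial>\<^sub>i \<phi>\<^sub>j = - \<integral> V\<^sub>i (\<partial>\<^sub>i V\<^sub>j - \<partial>\<^sub>j V\<^sub>i) \<phi>\<^sub>j\<close> (summed over \<open>i, j\<close>).  Both sides pass to the limit,
  as \<open>u\<close> is bounded, and the limit of the right side is zero pointwise.
\<close>

lemma flux_zero:
  assumes \<phi>: "\<And>j. \<phi> j \<in> trig" and div: "\<And>x. (\<Sum>j\<in>UNIV. partial j (\<phi> j) x) = 0"
  shows "(\<Sum>i\<in>UNIV. \<Sum>j\<in>UNIV. \<integral>x. u i x * u j x * partial i (\<phi> j) x \<partial>tor) = 0"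
proof -
  obtain M where M: "M \<ge> 0" "AE x in tor. U x \<le> M" by (rule u_bounded)
  have Vb: "\<bar>V n i x\<bar> \<le> M" for n i x by (rule V_bounded[OF M(2)])
  have ub: "AE x in tor. \<bar>u i x\<bar> \<le> M" for i
    using M(2)
  proof eventually_elim
    case (elim x)
    moreover have "\<bar>u i x\<bar> \<le> U x" unfolding U_def by (rule member_le_sum) auto
    ultimately show ?case by simp
  qed
  have \<phi>b: "\<exists>K. \<forall>x. \<bar>\<phi> j x\<bar> \<le> K" "\<exists>K. \<forall>x. \<bar>partial i (\<phi> j) x\<bar> \<le> K" for i j
    using periodic_continuous_bounded[OF trig_cont[OF \<phi>] trig_periodic[OF \<phi>]]
      periodic_continuous_bounded[OF trig_cont[OF trig_partial[OF \<phi>]] trig_periodic[OF trig_partial[OF \<phi>]]] by metis+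
  note [measurable] = trig_measurable[OF \<phi>] trig_measurable[OF trig_partial[OF \<phi>]]
  define W where "W n i j = conv (kern n) (Om i j)" for n i j
  have iV: "integrable tor (V n i)" for n i by (rule integrable_unif_continuous[OF c1_grad_cont[OF V_c1]])
  have Wc: "continuous_on UNIV (W n i j)" for n i j unfolding W_def
    by (rule c1_grad_cont[OF conv_c1[OF kern_trig Oi]])
  have iW: "integrable tor (W n i j)" for n i j by (rule integrable_unif_continuous[OF Wc])
  have [measurable]: "W n i j \<in> borel_measurable borel" for n i j by (simp add: W_def)
  have VL: "(\<lambda>n. \<integral>x. \<bar>V n i x - u i x\<bar> \<partial>tor) \<longlonglongrightarrow> 0" for i
    by (rule real_L1[OF _ _ V_L1]) (use iV ui in auto)
  have WL: "(\<lambda>n. \<integral>x. \<bar>W n i j x - Om i j x\<bar> \<partial>tor) \<longlonglongrightarrow> 0" for i j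
    by (rule real_L1) (use iW Oi O_L1[of i j] in \<open>auto simp: W_def\<close>)
  have lim1: "(\<lambda>n. \<integral>x. V n i x * V n j x * partial i (\<phi> j) x \<partial>tor) \<longlonglongrightarrow>
      (\<integral>x. u i x * u j x * partial i (\<phi> j) x \<partial>tor)" for i j
  proof -
    obtain K where "\<And>x. \<bar>partial i (\<phi> j) x\<bar> \<le> K" using \<phi>b(2) by metis
    then show ?thesis
      by (intro integral_triple_product_limit[where M=M and K=K] ui iV ub M VL) (auto simp: Vb)
  qed
  have lim2: "(\<lambda>n. \<integral>x. V n i x * W n i j x * \<phi> j x \<partial>tor) \<longlonglongrightarrow> (\<integral>x. u i x * Om i j x * \<phi> j x \<partial>tor)" for i j
  proof -
    obtain K where "\<And>x. \<bar>\<phi> j x\<bar> \<le> K" using \<phi>b(1) by metis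
    then show ?thesis
      by (intro integral_triple_product_limit[where M=M and K=K] Oi iW ub M VL WL) (auto simp: Vb)
  qed
  have identity: "(\<Sum>i\<in>UNIV. \<Sum>j\<in>UNIV. \<integral>x. V n i x * V n j x * partial i (\<phi> j) x \<partial>tor) =
      - (\<Sum>i\<in>UNIV. \<Sum>j\<in>UNIV. \<integral>x. V n i x * W n i j x * \<phi> j x \<partial>tor)" for n
  proof -
    have cV: "continuous_on UNIV (V n i)" for i by (rule c1_grad_cont[OF V_c1])
    have cD: "continuous_on UNIV (DV n i j)" for i j by (rule c1_grad_cont[OF DV_c1])
    have c\<phi>: "continuous_on UNIV (\<phi> j)" "continuous_on UNIV (partial i (\<phi> j))" for i j
      by (rule trig_cont[OF \<phi>], rule trig_cont[OF trig_partial[OF \<phi>]])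
    note cc = integrable_unif_continuous[of _ 0 "1::real^3"] continuous_intros cV cD c\<phi>
    \<comment> \<open>the derivatives \<open>\<partial>\<^sub>i (V\<^sub>i V\<^sub>j \<phi>\<^sub>j)\<close> and \<open>\<partial>\<^sub>j (V\<^sub>i V\<^sub>i \<phi>\<^sub>j)\<close> integrate to zero\<close>
    have 1: "(\<integral>x. V n i x * (V n j x * partial i (\<phi> j) x + DV n i j x * \<phi> j x) +
        DV n i i x * (V n j x * \<phi> j x) \<partial>tor) = 0" for i j
    proof (rule integral_tor_partial_eq_0[OF c1_grad_mult[OF V_c1 c1_grad_mult[OF V_c1 trig_c1_grad[OF \<phi>]]]])
      show "periodic (\<lambda>x. V n i x * (V n j x * \<phi> j x))" using V_per trig_periodic[OF \<phi>]
        by (simp add: periodic_def)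
    qed
    have 2: "(\<integral>x. V n i x * (V n i x * partial j (\<phi> j) x + DV n j i x * \<phi> j x) +
        DV n j i x * (V n i x * \<phi> j x) \<partial>tor) = 0" for i j
    proof (rule integral_tor_partial_eq_0[OF c1_grad_mult[OF V_c1 c1_grad_mult[OF V_c1 trig_c1_grad[OF \<phi>]]]])
      show "periodic (\<lambda>x. V n i x * (V n i x * \<phi> j x))" using V_per trig_periodic[OF \<phi>]
        by (simp add: periodic_def)
    qed
    have iX: "integrable tor (\<lambda>x. V n i x * (V n j x * partial i (\<phi> j) x + DV n i j x * \<phi> j x) +
        DV n i i x * (V n j x * \<phi> j x))"
      and iY: "integrable tor (\<lambda>x. V n i x * (V n i x * partial j (\<phi> j) x + DV n j i x * \<phi> j x) +
          DV n j i x * (V n i x * \<phi> j x))" for i j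
      by (intro cc)+
    have "(\<Sum>i\<in>UNIV. \<Sum>j\<in>UNIV. \<integral>x. V n i x * (V n j x * partial i (\<phi> j) x + DV n i j x * \<phi> j x) +
        DV n i i x * (V n j x * \<phi> j x) \<partial>tor) = 0"
      by (simp add: 1)
    also have "(\<Sum>i\<in>UNIV. \<Sum>j\<in>UNIV. \<integral>x. V n i x * (V n j x * partial i (\<phi> j) x + DV n i j x * \<phi> j x) +
        DV n i i x * (V n j x * \<phi> j x) \<partial>tor)
      = (\<integral>x. (\<Sum>i\<in>UNIV. \<Sum>j\<in>UNIV. V n i x * (V n j x * partial i (\<phi> j) x + DV n i j x * \<phi> j x) +
          DV n i i x * (V n j x * \<phi> j x)) \<partial>tor)"
      using iX by (simp only: Bochner_Integration.integral_sum Bochner_Integration.integrable_sum)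
    also have "\<dots> = (\<integral>x. (\<Sum>i\<in>UNIV. \<Sum>j\<in>UNIV. V n i x * (V n j x * partial i (\<phi> j) x + DV n i j x * \<phi> j x))
        \<partial>tor)"
    proof (rule Bochner_Integration.integral_cong[OF refl])
      fix x
      have "(\<Sum>i\<in>UNIV. \<Sum>j\<in>UNIV. DV n i i x * (V n j x * \<phi> j x)) =
          (\<Sum>i\<in>UNIV. DV n i i x) * (\<Sum>j\<in>UNIV. V n j x * \<phi> j x)"
        by (simp add: sum_product)
      also have "\<dots> = 0" by (simp add: div_DV)
      finally show "(\<Sum>i\<in>UNIV. \<Sum>j\<in>UNIV. V n i x * (V n j x * partial i (\<phi> j) x + DV n i j x * \<phi> j x) +
          DV n i i x * (V n j x * \<phi> j x)) = (\<Sum>i\<in>UNIV. \<Sum>j\<in>UNIV. V n i x * (V n j x * partial i (\<phi> j) x +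
          DV n i j x * \<phi> j x))"
        by (simp add: sum.distrib)
    qed
    finally have A: "(\<integral>x. (\<Sum>i\<in>UNIV. \<Sum>j\<in>UNIV. V n i x * (V n j x * partial i (\<phi> j) x +
        DV n i j x * \<phi> j x)) \<partial>tor) = 0" .
    have "(\<Sum>i\<in>UNIV. \<Sum>j\<in>UNIV. \<integral>x. V n i x * (V n i x * partial j (\<phi> j) x + DV n j i x * \<phi> j x) +
        DV n j i x * (V n i x * \<phi> j x) \<partial>tor) = 0"
      by (simp add: 2)
    also have "(\<Sum>i\<in>UNIV. \<Sum>j\<in>UNIV. \<integral>x. V n i x * (V n i x * partial j (\<phi> j) x + DV n j i x * \<phi> j x) +
        DV n j i x * (V n i x * \<phi> j x) \<partial>tor)
      = (\<integral>x. (\<Sum>i\<in>UNIV. \<Sum>j\<in>UNIV. V n i x * (V n i x * partial j (\<phi> j) x + DV n j i x * \<phi> j x) +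
          DV n j i x * (V n i x * \<phi> j x)) \<partial>tor)"
      using iY by (simp only: Bochner_Integration.integral_sum Bochner_Integration.integrable_sum)
    also have "\<dots> = (\<integral>x. 2 * (\<Sum>i\<in>UNIV. \<Sum>j\<in>UNIV. V n i x * DV n j i x * \<phi> j x) \<partial>tor)"
    proof (rule Bochner_Integration.integral_cong[OF refl])
      fix x
      have "(\<Sum>i\<in>UNIV. \<Sum>j\<in>UNIV. V n i x * (V n i x * partial j (\<phi> j) x)) =
          (\<Sum>i\<in>UNIV. V n i x * V n i x * (\<Sum>j\<in>UNIV. partial j (\<phi> j) x))"
        by (simp add: sum_distrib_left mult.assoc)
      also have "\<dots> = 0" by (simp add: div)
      finally have z: "(\<Sum>i\<in>UNIV. \<Sum>j\<in>UNIV. V n i x * (V n i x * partial j (\<phi> j) x)) = 0" .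
      have "(\<Sum>i\<in>UNIV. \<Sum>j\<in>UNIV. V n i x * (V n i x * partial j (\<phi> j) x + DV n j i x * \<phi> j x) +
          DV n j i x * (V n i x * \<phi> j x)) = 
        (\<Sum>i\<in>UNIV. \<Sum>j\<in>UNIV. V n i x * (V n i x * partial j (\<phi> j) x)) +
            2 * (\<Sum>i\<in>UNIV. \<Sum>j\<in>UNIV. V n i x * DV n j i x * \<phi> j x)"
        by (simp add: sum.distrib[symmetric] sum_distrib_left algebra_simps)
      then show "(\<Sum>i\<in>UNIV. \<Sum>j\<in>UNIV. V n i x * (V n i x * partial j (\<phi> j) x + DV n j i x * \<phi> j x) +
          DV n j i x * (V n i x * \<phi> j x)) = 2 * (\<Sum>i\<in>UNIV. \<Sum>j\<in>UNIV. V n i x * DV n j i x * \<phi> j x)"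
        unfolding z by simp
    qed
    finally have B: "(\<integral>x. (\<Sum>i\<in>UNIV. \<Sum>j\<in>UNIV. V n i x * DV n j i x * \<phi> j x) \<partial>tor) = 0" by simp
    have iA: "integrable tor (\<lambda>x. \<Sum>i\<in>UNIV. \<Sum>j\<in>UNIV. V n i x * (V n j x * partial i (\<phi> j) x +
        DV n i j x * \<phi> j x))"
      and iB: "integrable tor (\<lambda>x. \<Sum>i\<in>UNIV. \<Sum>j\<in>UNIV. V n i x * DV n j i x * \<phi> j x)"
      and i1: "\<And>i j. integrable tor (\<lambda>x. V n i x * V n j x * partial i (\<phi> j) x)"
      and i2: "\<And>i j. integrable tor (\<lambda>x. V n i x * W n i j x * \<phi> j x)"
      by (intro cc Wc)+
    have "0 = (\<integral>x. (\<Sum>i\<in>UNIV. \<Sum>j\<in>UNIV. V n i x * (V n j x * partial i (\<phi> j) x + DV n i j x * \<phi> j x)) -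
        (\<Sum>i\<in>UNIV. \<Sum>j\<in>UNIV. V n i x * DV n j i x * \<phi> j x) \<partial>tor)"
      using A B iA iB by simp
    also have "\<dots> = (\<integral>x. (\<Sum>i\<in>UNIV. \<Sum>j\<in>UNIV. V n i x * V n j x * partial i (\<phi> j) x +
        V n i x * W n i j x * \<phi> j x) \<partial>tor)"
      by (rule Bochner_Integration.integral_cong)
          (auto simp: W_def curl_DV[symmetric] sum_subtractf[symmetric] algebra_simps)
    also have "\<dots> = (\<Sum>i\<in>UNIV. \<Sum>j\<in>UNIV. \<integral>x. V n i x * V n j x * partial i (\<phi> j) x \<partial>tor) +
        (\<Sum>i\<in>UNIV. \<Sum>j\<in>UNIV. \<integral>x. V n i x * W n i j x * \<phi> j x \<partial>tor)"
      using i1 i2 by (simp add: sum.distrib)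
    finally show ?thesis by simp
  qed
  have zero: "(\<Sum>i\<in>UNIV. \<Sum>j\<in>UNIV. \<integral>x. u i x * Om i j x * \<phi> j x \<partial>tor) = 0"
  proof -
    have i: "integrable tor (\<lambda>x. u i x * Om i j x * \<phi> j x)" for i j
    proof -
      obtain K where K: "\<And>x. \<bar>\<phi> j x\<bar> \<le> K" using \<phi>b(1) by metis
      have "integrable tor (\<lambda>x. M * \<bar>Om i j x\<bar> * K)" using Oi[of i j] by auto
      then show ?thesis
      proof (rule Bochner_Integration.integrable_bound)
        show "AE x in tor. norm (u i x * Om i j x * \<phi> j x) \<le> norm (M * \<bar>Om i j x\<bar> * K)"
          using ub[of i]
        proof eventually_elim
          case (elim x)
          have "\<bar>u i x * Om i j x * \<phi> j x\<bar> \<le> M * \<bar>Om i j x\<bar> * K"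
            unfolding abs_mult using elim K[of x] M by (intro mult_mono) auto
          then show ?case by simp
        qed
      qed simp
    qed
    have "(\<Sum>i\<in>UNIV. \<Sum>j\<in>UNIV. \<integral>x. u i x * Om i j x * \<phi> j x \<partial>tor) =
        (\<integral>x. (\<Sum>i\<in>UNIV. \<Sum>j\<in>UNIV. u i x * Om i j x * \<phi> j x) \<partial>tor)"
      using i by simp
    also have "\<dots> = (\<integral>x. (\<Sum>j\<in>UNIV. (\<Sum>i\<in>UNIV. u i x * Om i j x) * \<phi> j x) \<partial>tor)"
      by (subst sum.swap) (simp add: sum_distrib_right)
    also have "\<dots> = 0" by (simp add: On)
    finally show ?thesis .
  qed
  have "(\<lambda>n. \<Sum>i\<in>UNIV. \<Sum>j\<in>UNIV. \<integral>x. V n i x * V n j x * partial i (\<phi> j) x \<partial>tor) \<longlonglongrightarrow>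
      (\<Sum>i\<in>UNIV. \<Sum>j\<in>UNIV. \<integral>x. u i x * u j x * partial i (\<phi> j) x \<partial>tor)"
    by (intro tendsto_sum lim1)
  moreover have "(\<lambda>n. \<Sum>i\<in>UNIV. \<Sum>j\<in>UNIV. \<integral>x. V n i x * V n j x * partial i (\<phi> j) x \<partial>tor) \<longlonglongrightarrow>
      - (\<Sum>i\<in>UNIV. \<Sum>j\<in>UNIV. \<integral>x. u i x * Om i j x * \<phi> j x \<partial>tor)"
    unfolding identity by (intro tendsto_minus tendsto_sum lim2)
  ultimately show ?thesis using zero LIMSEQ_unique by fastforce
qed

end

section \<open>Sobolev functions of order above one half are of Kato class\<close>

text \<open>An increment of order \<open>s\<^sup>-\<^sup>\<alpha>\<close> in each halving of the scale adds up to order \<open>s\<^sup>-\<^sup>\<alpha>\<close>.\<close>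

lemma dyadic_growth:
  fixes m :: "real \<Rightarrow> ennreal"
  assumes base: "\<And>s. 1/4 \<le> s \<Longrightarrow> s \<le> 1/2 \<Longrightarrow> m s \<le> ennreal A0"
    and step: "\<And>s. 0 < s \<Longrightarrow> s \<le> 1/4 \<Longrightarrow> m s \<le> m (2 * s) + ennreal (E * s powr - \<alpha>)"
    and \<alpha>: "0 < \<alpha>" and E: "0 \<le> E" and A0: "0 \<le> A0"
    and s: "0 < s" "s \<le> 1/2"
  shows "m s \<le> ennreal (max A0 (E / (1 - 2 powr - \<alpha>)) * s powr - \<alpha>)"
proof -
  define A where "A = max A0 (E / (1 - 2 powr - \<alpha>))"
  have p1: "1 - 2 powr - \<alpha> > 0" using \<alpha> by (simp add: powr_less_one)
  have A: "A0 \<le> A" "0 \<le> A" "A * 2 powr - \<alpha> + E \<le> A"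
  proof -
    show "A0 \<le> A" "0 \<le> A" using A0 by (auto simp: A_def)
    have "E / (1 - 2 powr - \<alpha>) \<le> A" by (simp add: A_def)
    then have "E \<le> A * (1 - 2 powr - \<alpha>)" using p1 by (simp add: pos_divide_le_eq)
    then show "A * 2 powr - \<alpha> + E \<le> A" by (simp add: algebra_simps)
  qed
  have big: "m s \<le> ennreal (A * s powr - \<alpha>)" if "1/4 \<le> s" "s \<le> 1/2" for s
  proof -
    have "1 \<le> s powr - \<alpha>"
    proof -
      have "s powr \<alpha> \<le> 1" using that \<alpha> by (intro powr_le1) auto
      moreover have "0 < s powr \<alpha>" using that by simp
      ultimately show ?thesis by (simp add: powr_minus one_le_inverse_iff)
    qed
    then have "A0 * 1 \<le> A * s powr - \<alpha>" using A A0 by (intro mult_mono) auto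
    then show ?thesis using base[OF that] by (simp add: order_trans[OF _ ennreal_leI])
  qed
  have "\<And>s. 0 < s \<Longrightarrow> s \<le> 1/2 \<Longrightarrow> 1/4 \<le> 2 ^ n * s \<Longrightarrow> m s \<le> ennreal (A * s powr - \<alpha>)" for n
  proof (induction n)
    case 0 then show ?case using big by simp
  next
    case (Suc n)
    show ?case
    proof (cases "1/4 \<le> s")
      case True then show ?thesis using big Suc.prems by simp
    next
      case False
      have "m s \<le> m (2 * s) + ennreal (E * s powr - \<alpha>)" using False Suc.prems by (intro step) auto
      also have "m (2 * s) \<le> ennreal (A * (2 * s) powr - \<alpha>)" using False Suc.prems
        by (intro Suc.IH) (auto simp: mult_ac)
      also have "ennreal (A * (2 * s) powr - \<alpha>) + ennreal (E * s powr - \<alpha>) =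
          ennreal ((A * 2 powr - \<alpha> + E) * s powr - \<alpha>)"
        using A E Suc.prems by (subst ennreal_plus[symmetric]) (auto simp: powr_mult algebra_simps)
      also have "\<dots> \<le> ennreal (A * s powr - \<alpha>)"
        using A by (intro ennreal_leI mult_right_mono) auto
      finally show ?thesis by (simp add: add_right_mono)
    qed
  qed
  moreover obtain n where "1/4 / s < 2 ^ n" using real_arch_pow[of 2 "1/4/s"] by auto
  then have "1/4 \<le> 2 ^ n * s" using s by (simp add: divide_less_eq)
  ultimately show ?thesis using s by (simp add: A_def)
qed

text \<open>Used with \<open>t\<close> equal to the expected size of \<open>\<bar>d\<bar>\<close>, this replaces the Cauchy-Schwarz inequality.\<close>

lemma young_ennreal: assumes "t > 0" shows "ennreal \<bar>d\<bar> \<le>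
    ennreal (t / 2) + ennreal (1 / (2 * t)) * ennreal (d\<^sup>2)"
proof -
  have "0 \<le> (\<bar>d\<bar> - t)\<^sup>2" by simp
  then have "2 * t * \<bar>d\<bar> \<le> t * t + d\<^sup>2" by (simp add: power2_eq_square algebra_simps)
  then have "\<bar>d\<bar> \<le> (t * t + d\<^sup>2) / (2 * t)" using assms by (simp add: pos_le_divide_eq mult.commute)
  also have "\<dots> = t / 2 + 1 / (2 * t) * d\<^sup>2" using assms by (simp add: add_divide_distrib)
  finally have "ennreal \<bar>d\<bar> \<le> ennreal (t / 2 + 1 / (2 * t) * d\<^sup>2)" by (rule ennreal_leI)
  then show ?thesis using assms by (simp add: ennreal_plus ennreal_mult del: times_divide_eq_left)
qed

lemma small_cube_L1_bound:
  fixes l :: "real^3 \<Rightarrow> real"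
  assumes [measurable]: "l \<in> borel_measurable borel" and per: "periodic l" and s: "1/4 \<le> s" "s \<le> 1/2"
      and i: "integrable tor l"
  shows "(cube_mass l x s) \<le> ennreal (64 * (\<integral>x. \<bar>l x\<bar> \<partial>tor))"
proof -
  have "(cube_mass l x s) \<le> ennreal (1 / s^3) * (\<integral>\<^sup>+x. ennreal \<bar>l x\<bar> \<partial>tor)"
    by (rule nn_integral_small_cube_le[of "\<lambda>x. ennreal \<bar>l x\<bar>"]) (use per s in \<open>auto simp: periodic_def\<close>)
  also have "(\<integral>\<^sup>+x. ennreal \<bar>l x\<bar> \<partial>tor) = ennreal (\<integral>x. \<bar>l x\<bar> \<partial>tor)"
    by (rule nn_integral_eq_integral) (use i in auto)
  also have "ennreal (1 / s^3) * \<dots> \<le> ennreal 64 * \<dots>"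
  proof (intro mult_right_mono ennreal_leI)
    have "(1/4)^3 \<le> s^3" using s by (intro power_mono) auto
    then have "1 / s^3 \<le> 1 / (1/4)^3" using s by (intro divide_left_mono) auto
    then show "1 / s^3 \<le> 64" by (simp add: power3_eq_cube)
  qed auto
  also have "\<dots> = ennreal (64 * (\<integral>x. \<bar>l x\<bar> \<partial>tor))" by (rule ennreal_mult[symmetric]) auto
  finally show ?thesis .
qed

lemma lattice_shift_image: "(\<lambda>k. k + axis i 1) ` lattice = lattice"
proof
  show "(\<lambda>k. k + axis i 1) ` lattice \<subseteq> lattice" using axis_lattice[of i] by (auto simp: lattice_def)
  show "lattice \<subseteq> (\<lambda>k. k + axis i 1) ` lattice"
  proof
    fix k assume "k \<in> lattice"
    then have "k - axis i 1 \<in> lattice" using axis_lattice[of i] by (auto simp: lattice_def)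
    then show "k \<in> (\<lambda>k. k + axis i 1) ` lattice" by (intro image_eqI[of _ _ "k - axis i 1"]) auto
  qed
qed

lemma infdist_lattice_periodic: "infdist (z + axis i 1) lattice = infdist z lattice"
proof -
  have "infdist (z + axis i 1) lattice = infdist (z + axis i 1) ((\<lambda>k. k + axis i 1) ` lattice)"
    by (simp add: lattice_shift_image)
  also have "\<dots> = infdist z lattice"
    using zero_lattice by (auto simp: infdist_def image_image dist_norm)
  finally show ?thesis .
qed

lemma torus_dist_lattice: "torus_dist x y = infdist (x - y) lattice"
  by (simp add: torus_dist_def lattice_def)

lemma torus_dist_periodic: "torus_dist (x + axis i 1) y = torus_dist x y"
    "torus_dist x (y + axis i 1) = torus_dist x y"
proof -
  show "torus_dist (x + axis i 1) y = torus_dist x y"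
    using infdist_lattice_periodic[of "x - y" i] by (simp add: torus_dist_lattice algebra_simps)
  show "torus_dist x (y + axis i 1) = torus_dist x y"
    using infdist_lattice_periodic[of "x - y - axis i 1" i]
      by (simp add: torus_dist_lattice algebra_simps)
qed

lemma torus_dist_le: "torus_dist x y \<le> norm (x - y)"
  unfolding torus_dist_lattice using infdist_le[OF zero_lattice, of "x - y"] by simp

lemma torus_dist_eq_0: "torus_dist x y = 0 \<Longrightarrow> x - y \<in> lattice"
  unfolding torus_dist_lattice using in_closed_iff_infdist_zero[OF closed_lattice] zero_lattice by blast

lemma torus_dist_measurable [measurable]:
  assumes [measurable]: "f \<in> borel_measurable M" "g \<in> borel_measurable M"
  shows "(\<lambda>x. torus_dist (f x) (g x)) \<in> borel_measurable M"
proof -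
  have "continuous_on UNIV (\<lambda>z::real^3. infdist z lattice)"
    by (intro continuous_intros continuous_on_infdist)
  from borel_measurable_continuous_onI[OF this] have [measurable]: "(\<lambda>z::real^3. infdist z lattice) \<in>
      borel_measurable borel" .
  show ?thesis unfolding torus_dist_lattice by measurable
qed

lemma norm_cube_le: assumes "y \<in> cbox (-1) (1::real^3)" shows "norm y \<le> 2"
proof -
  have "(y $ i)\<^sup>2 \<le> 1" for i
  proof -
    have "\<bar>y $ i\<bar> \<le> 1" using assms by (auto simp: mem_box_cart abs_le_iff minus_le_iff)
    then show ?thesis by (simp add: abs_square_le_1)
  qed
  then have "y \<bullet> y \<le> (\<Sum>i\<in>(UNIV::3 set). 1)" unfolding inner_vec_def
    by (intro sum_mono) (simp add: power2_eq_square)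
  then have "(norm y)\<^sup>2 \<le> 2\<^sup>2" by (simp add: power2_norm_eq_inner)
  then show ?thesis by (rule power2_le_imp_le) simp
qed

text \<open>
  Comparing the masses of the cubes of half-width \<open>s\<close> and \<open>2 s\<close> costs
  \<open>\<integral>\<integral> \<bar>l(x + s y) - l(x + 2 s z)\<bar> dy dz\<close>.  Two points of these cubes are at distance at most \<open>6 s\<close>, so
  the square of the integrand is at most \<open>(6 s)\<^bsup>3 + 2\<theta>\<^esup>\<close> times the Gagliardo integrand; the two changes
  of variables contribute \<open>s\<^sup>-\<^sup>6\<close>.
\<close>

lemma kato_gagliardo:
  fixes l :: "real^3 \<Rightarrow> real"
  assumes [measurable]: "l \<in> borel_measurable borel" and per: "periodic l" and i: "integrable tor l"
    and \<theta>: "1/2 < \<theta>" "\<theta> < 1"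
    and fin: "(\<integral>\<^sup>+x. \<integral>\<^sup>+y. ennreal (\<bar>l x - l y\<bar>\<^sup>2 / torus_dist x y powr (3 + 2 * \<theta>)) \<partial>tor \<partial>tor) < \<infinity>"
  obtains C where "C \<ge> 0" "\<And>x s. 0 < s \<Longrightarrow> s \<le> 1/2 \<Longrightarrow> (cube_mass l x s) \<le> ennreal (C * s powr - (3/2 - \<theta>))"
proof -
  define N where "N p q = ennreal (\<bar>l p - l q\<bar>\<^sup>2 / torus_dist p q powr (3 + 2 * \<theta>))" for p q
  have [measurable]: "(\<lambda>x. N (f x) (g x)) \<in> borel_measurable M"
      if [measurable]: "f \<in> borel_measurable M" "g \<in> borel_measurable M" for f g and M :: "'z measure"
    unfolding N_def by measurable
  have [measurable]: "(\<lambda>(x, y). N (f x) (g y)) \<in> borel_measurable (M \<Otimes>\<^sub>M M')"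
      if [measurable]: "f \<in> borel_measurable M" "g \<in> borel_measurable M'" for f g and M :: "'z measure"
      and M' :: "'w measure"
    unfolding N_def by measurable
  obtain G where G: "(\<integral>\<^sup>+x. \<integral>\<^sup>+y. N x y \<partial>tor \<partial>tor) = ennreal G" "G \<ge> 0"
    using fin unfolding N_def by (cases rule: ennreal_cases) auto
  define \<alpha> where "\<alpha> = 3/2 - \<theta>"
  \<comment> \<open>\<open>c s\<^bsup>-2\<alpha>\<^esup>\<close> bounds the integral of the squared differences; Young's inequality with
    \<open>t = s\<^sup>-\<^sup>\<alpha>\<close> then gives \<open>8 E s\<^sup>-\<^sup>\<alpha>\<close>, where \<open>8\<close> is the volume of the reference cube\<close>
  define c where "c = 6 powr (3 + 2 * \<theta>) / 8 * G"
  define E where "E = (32 + c / 2) / 8"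
  have c0: "c \<ge> 0" using G by (simp add: c_def)
  have pN1: "periodic (\<lambda>p. N p q)" and pN2: "periodic (\<lambda>q. N p q)" for p q
    using per by (auto simp: periodic_def N_def torus_dist_periodic)
  have step: "(cube_mass l x s) \<le> (cube_mass l x (2 * s)) + ennreal (E * s powr - \<alpha>)"
    if s: "0 < s" "s \<le> 1/4" for x s
  proof -
    define m where "m s = (cube_mass l x s)" for s
    have F2: "(\<integral>\<^sup>+y. \<integral>\<^sup>+z. ennreal ((l (x + s *\<^sub>R y) - l (x + (2 * s) *\<^sub>R z))\<^sup>2) \<partial>cube \<partial>cube) \<le>
        ennreal (c * s powr (- 2 * \<alpha>))"
    proof -
      have pt: "ennreal ((l (x + s *\<^sub>R y) - l (x + (2 * s) *\<^sub>R z))\<^sup>2) \<le>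
          ennreal ((6 * s) powr (3 + 2 * \<theta>)) * N (x + s *\<^sub>R y) (x + (2 * s) *\<^sub>R z)"
        if y: "y \<in> cbox (-1) 1" and z: "z \<in> cbox (-1) 1" for y z
      proof -
        let ?p = "x + s *\<^sub>R y" and ?q = "x + (2 * s) *\<^sub>R z"
        have "torus_dist ?p ?q \<le> norm (?p - ?q)" by (rule torus_dist_le)
        also have "?p - ?q = s *\<^sub>R y - (2 * s) *\<^sub>R z" by simp
        also have "norm \<dots> \<le> norm (s *\<^sub>R y) + norm ((2 * s) *\<^sub>R z)" by (rule norm_triangle_ineq4)
        also have "\<dots> = s * norm y + 2 * s * norm z" using s by simp
        also have "\<dots> \<le> s * 2 + 2 * s * 2" using s norm_cube_le[OF y] norm_cube_le[OF z]
          by (intro add_mono mult_left_mono) auto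
        finally have td: "torus_dist ?p ?q \<le> 6 * s" by simp
        have td0: "0 \<le> torus_dist ?p ?q" by (simp add: torus_dist_lattice infdist_nonneg)
        have "(l ?p - l ?q)\<^sup>2 \<le> (6 * s) powr (3 +
            2 * \<theta>) * (\<bar>l ?p - l ?q\<bar>\<^sup>2 / torus_dist ?p ?q powr (3 + 2 * \<theta>))"
        proof (cases "torus_dist ?p ?q = 0")
          \<comment> \<open>here the quotient has the default value \<open>0\<close>, which is correct by periodicity\<close>
          case True
          then have "?p - ?q \<in> lattice" by (rule torus_dist_eq_0)
          from periodic_lattice[OF per this, of ?q] have "l ?p = l ?q" by simp
          then show ?thesis by simp
        next
          case False
          then have p: "0 < torus_dist ?p ?q powr (3 + 2 * \<theta>)" using td0 by simp
          have "torus_dist ?p ?q powr (3 + 2 * \<theta>) \<le> (6 * s) powr (3 + 2 * \<theta>)"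
            using td td0 \<theta> by (intro powr_mono2) auto
          then have "torus_dist ?p ?q powr (3 + 2 * \<theta>) * (l ?p - l ?q)\<^sup>2 \<le>
              (6 * s) powr (3 + 2 * \<theta>) * (l ?p - l ?q)\<^sup>2"
            by (rule mult_right_mono) simp
          then show ?thesis using p by (simp add: pos_le_divide_eq mult.commute)
        qed
        then have "ennreal ((l ?p - l ?q)\<^sup>2) \<le>
            ennreal ((6 * s) powr (3 + 2 * \<theta>) * (\<bar>l ?p - l ?q\<bar>\<^sup>2 / torus_dist ?p ?q powr (3 + 2 * \<theta>)))"
            by (rule ennreal_leI)
        also have "\<dots> = ennreal ((6 * s) powr (3 + 2 * \<theta>)) * N ?p ?q" unfolding N_def
          by (rule ennreal_mult) auto
        finally show ?thesis .
      qed
      have "(\<integral>\<^sup>+y. \<integral>\<^sup>+z. ennreal ((l (x + s *\<^sub>R y) - l (x + (2 * s) *\<^sub>R z))\<^sup>2) \<partial>cube \<partial>cube) \<le> 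
         (\<integral>\<^sup>+y. \<integral>\<^sup>+z. ennreal ((6 * s) powr (3 + 2 * \<theta>)) * N (x + s *\<^sub>R y) (x +
             (2 * s) *\<^sub>R z) \<partial>cube \<partial>cube)"
      proof (rule nn_integral_mono_AE)
        have "(\<integral>\<^sup>+z. ennreal ((l (x + s *\<^sub>R y) - l (x + (2 * s) *\<^sub>R z))\<^sup>2) \<partial>cube) \<le>
            (\<integral>\<^sup>+z. ennreal ((6 * s) powr (3 + 2 * \<theta>)) * N (x + s *\<^sub>R y) (x + (2 * s) *\<^sub>R z) \<partial>cube)"
          if "y \<in> cbox (-1) 1" for y
          by (rule nn_integral_mono_AE) (use pt that in \<open>auto simp: AE_unif\<close>)
        then show "AE y in cube. (\<integral>\<^sup>+z. ennreal ((l (x + s *\<^sub>R y) - l (x + (2 * s) *\<^sub>R z))\<^sup>2) \<partial>cube) \<le>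
            (\<integral>\<^sup>+z. ennreal ((6 * s) powr (3 + 2 * \<theta>)) * N (x + s *\<^sub>R y) (x + (2 * s) *\<^sub>R z) \<partial>cube)"
          by (auto simp: AE_unif)
      qed
      also have "\<dots> = ennreal ((6 * s) powr (3 + 2 * \<theta>)) * (\<integral>\<^sup>+y. \<integral>\<^sup>+z. N (x + s *\<^sub>R y) (x +
          (2 * s) *\<^sub>R z) \<partial>cube \<partial>cube)"
        by (simp add: nn_integral_cmult)
      also have "\<dots> \<le> ennreal ((6 * s) powr (3 +
          2 * \<theta>)) * (\<integral>\<^sup>+y. ennreal (1 / (2 * s)^3) * (\<integral>\<^sup>+q. N (x + s *\<^sub>R y) q \<partial>tor) \<partial>cube)"
        by (intro mult_left_mono nn_integral_mono nn_integral_small_cube_le pN2) (use s in auto)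
      also have "\<dots> = ennreal ((6 * s) powr (3 +
          2 * \<theta>)) * (ennreal (1 / (2 * s)^3) * (\<integral>\<^sup>+y. (\<integral>\<^sup>+q. N (x + s *\<^sub>R y) q \<partial>tor) \<partial>cube))"
        by (simp add: nn_integral_cmult)
      also have "\<dots> \<le> ennreal ((6 * s) powr (3 +
          2 * \<theta>)) * (ennreal (1 / (2 * s)^3) * (ennreal (1 / s^3) * (\<integral>\<^sup>+p. (\<integral>\<^sup>+q. N p q \<partial>tor) \<partial>tor)))"
      proof (intro mult_left_mono nn_integral_small_cube_le[of "\<lambda>p. \<integral>\<^sup>+q. N p q \<partial>tor"])
        show "periodic (\<lambda>p. \<integral>\<^sup>+q. N p q \<partial>tor)" using pN1 unfolding periodic_def
          by (intro allI nn_integral_cong) auto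
      qed (use s in auto)
      also have "\<dots> = ennreal ((6 * s) powr (3 + 2 * \<theta>) * (1 / (2 * s)^3 * (1 / s^3 * G)))"
        unfolding G(1) using s G(2) by (subst ennreal_mult[symmetric], simp, simp)+ simp
      also have "(6 * s) powr (3 + 2 * \<theta>) * (1 / (2 * s)^3 * (1 / s^3 * G)) = c * s powr (- 2 * \<alpha>)"
      proof -
        have "s powr (- 2 * \<alpha>) = s powr ((3 + 2 * \<theta>) - 6)" by (simp add: \<alpha>_def algebra_simps)
        also have "\<dots> = s powr (3 + 2 * \<theta>) / s powr 6" by (rule powr_diff)
        also have "s powr 6 = s ^ 6" using s powr_realpow[of s 6] by simp
        finally have e: "s powr (- 2 * \<alpha>) = s powr (3 + 2 * \<theta>) / s ^ 6" .
        have "(6 * s) powr (3 + 2 * \<theta>) = 6 powr (3 + 2 * \<theta>) * s powr (3 + 2 * \<theta>)" using s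
          by (simp add: powr_mult)
        moreover have "(2 * s)^3 * s^3 = 8 * s^6" by (simp add: power_mult_distrib power_add[symmetric])
        ultimately show ?thesis unfolding c_def e using s by (simp add: field_simps)
      qed
      finally show ?thesis .
    qed
    have sp: "s powr - \<alpha> > 0" using s by simp
    have "8 * m s = (\<integral>\<^sup>+y. \<integral>\<^sup>+z. ennreal \<bar>l (x + s *\<^sub>R y)\<bar> \<partial>cube \<partial>cube)"
      by (simp add: m_def nn_integral_cmult mult.commute)
    also have "\<dots> \<le> (\<integral>\<^sup>+y. \<integral>\<^sup>+z. ennreal \<bar>l (x + (2 * s) *\<^sub>R z)\<bar> +
        (ennreal (s powr - \<alpha> / 2) + ennreal (1 / (2 * s powr - \<alpha>)) * ennreal ((l (x + s *\<^sub>R y) - l (x + (2 * s) *\<^sub>R z))\<^sup>2)) \<partial>cube \<partial>cube)"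
    proof (intro nn_integral_mono)
      fix y z
      have "\<bar>l (x + s *\<^sub>R y)\<bar> \<le> \<bar>l (x + (2 * s) *\<^sub>R z)\<bar> + \<bar>l (x + s *\<^sub>R y) - l (x + (2 * s) *\<^sub>R z)\<bar>"
        by arith
      then have "ennreal \<bar>l (x + s *\<^sub>R y)\<bar> \<le> ennreal (\<bar>l (x + (2 * s) *\<^sub>R z)\<bar> +
          \<bar>l (x + s *\<^sub>R y) - l (x + (2 * s) *\<^sub>R z)\<bar>)" by (rule ennreal_leI)
      also have "\<dots> = ennreal \<bar>l (x + (2 * s) *\<^sub>R z)\<bar> +
          ennreal \<bar>l (x + s *\<^sub>R y) - l (x + (2 * s) *\<^sub>R z)\<bar>" by (rule ennreal_plus) auto
      finally show "ennreal \<bar>l (x + s *\<^sub>R y)\<bar> \<le>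
          ennreal \<bar>l (x + (2 * s) *\<^sub>R z)\<bar> + (ennreal (s powr - \<alpha> / 2) +
          ennreal (1 / (2 * s powr - \<alpha>)) * ennreal ((l (x + s *\<^sub>R y) - l (x + (2 * s) *\<^sub>R z))\<^sup>2))"
        by (rule order_trans[OF _ add_left_mono[OF young_ennreal[OF sp]]])
    qed
    also have "\<dots> = 8 * m (2 * s) + (64 * ennreal (s powr - \<alpha> / 2) +
        ennreal (1 / (2 * s powr - \<alpha>)) * (\<integral>\<^sup>+y. \<integral>\<^sup>+z. ennreal ((l (x + s *\<^sub>R y) - l (x + (2 * s) *\<^sub>R z))\<^sup>2) \<partial>cube \<partial>cube))"
      by (simp add: nn_integral_add nn_integral_cmult m_def mult.commute mult.left_commute[of 8 8]
          mult.assoc[symmetric])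
    also have "\<dots> \<le> 8 * m (2 * s) + (64 * ennreal (s powr - \<alpha> / 2) +
        ennreal (1 / (2 * s powr - \<alpha>)) * ennreal (c * s powr (- 2 * \<alpha>)))"
      by (intro add_left_mono mult_left_mono F2) auto
    also have "64 * ennreal (s powr - \<alpha> / 2) +
        ennreal (1 / (2 * s powr - \<alpha>)) * ennreal (c * s powr (- 2 * \<alpha>)) = 8 * ennreal (E * s powr - \<alpha>)"
    proof -
      have e2: "s powr (- 2 * \<alpha>) = s powr - \<alpha> * s powr - \<alpha>" using s by (simp add: powr_add[symmetric])
      have "64 * ennreal (s powr - \<alpha> / 2) + ennreal (1 / (2 * s powr - \<alpha>)) * ennreal
          (c * s powr (- 2 * \<alpha>)) = ennreal 64 * ennreal (s powr - \<alpha> / 2) +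
          ennreal (1 / (2 * s powr - \<alpha>)) * ennreal (c * s powr (- 2 * \<alpha>))" by simp
      also have "\<dots> = ennreal (64 * (s powr - \<alpha> / 2) + 1 / (2 * s powr - \<alpha>) * (c * s powr (- 2 * \<alpha>)))"
        using c0 sp by (subst ennreal_mult[symmetric], simp, simp)+ (subst ennreal_plus, auto)
      also have "64 * (s powr - \<alpha> / 2) + 1 / (2 * s powr - \<alpha>) * (c * s powr (- 2 * \<alpha>)) =
          8 * (E * s powr - \<alpha>)"
        unfolding e2 E_def using sp by (simp add: field_simps)
      also have "ennreal (8 * (E * s powr - \<alpha>)) = 8 * ennreal (E * s powr - \<alpha>)"
        using c0 by (subst ennreal_mult) (auto simp: E_def)
      finally show ?thesis .
    qed
    also have "8 * m (2 * s) + 8 * ennreal (E * s powr - \<alpha>) =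
        8 * (m (2 * s) + ennreal (E * s powr - \<alpha>))" by (simp add: distrib_left)
    finally have "8 * m s \<le> 8 * (m (2 * s) + ennreal (E * s powr - \<alpha>))" .
    then have "m s \<le> m (2 * s) + ennreal (E * s powr - \<alpha>)"
      by (subst (asm) ennreal_mult_le_mult_iff) auto
    then show ?thesis by (simp add: m_def)
  qed
  have "(cube_mass l x s) \<le> ennreal (max (64 * (\<integral>x. \<bar>l x\<bar> \<partial>tor)) (E / (1 - 2 powr - \<alpha>)) * s powr - \<alpha>)"
      if "0 < s" "s \<le> 1/2" for x s
    by (rule dyadic_growth[of "\<lambda>s. \<integral>\<^sup>+y. ennreal \<bar>l (x + s *\<^sub>R y)\<bar> \<partial>cube"])
      (use that step small_cube_L1_bound[OF assms(1,2) _ _ i] \<theta> c0 in \<open>auto simp: \<alpha>_def E_def\<close>)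
  then show thesis unfolding \<alpha>_def by (intro that[of "max (64 * (\<integral>x. \<bar>l x\<bar> \<partial>tor))
      (E / (1 - 2 powr - \<alpha>))"]) (auto simp: \<alpha>_def le_max_iff_disj)
qed

text \<open>
  Mollification with a probability kernel preserves bounds on \<open>L\<^sup>1\<close> masses of cubes that are uniform
  in the centre.
\<close>

lemma conv_kern_cube_bound:
  fixes g :: "real^3 \<Rightarrow> real"
  assumes [measurable]: "g \<in> borel_measurable borel" and per: "periodic g" and i: "integrable tor g"
    and B: "\<And>x. (cube_mass g x s) \<le> B"
  shows "(cube_mass (conv (kern n) g) x s) \<le> B"
proof -
  have [measurable]: "kern n \<in> borel_measurable borel" by (rule trig_measurable[OF kern_trig])
  have "(cube_mass (conv (kern n) g) x s) \<le> (\<integral>\<^sup>+y. \<integral>\<^sup>+z. ennreal (kern n z) * ennreal \<bar>g (x + s *\<^sub>R y +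
      z)\<bar> \<partial>tor \<partial>cube)"
    using conv_kern_nn_bound[OF assms(1-3), of n _ 0] by (intro nn_integral_mono) simp
  also have "\<dots> = (\<integral>\<^sup>+z. \<integral>\<^sup>+y. ennreal (kern n z) * ennreal \<bar>g (x + s *\<^sub>R y + z)\<bar> \<partial>cube \<partial>tor)"
    by (rule unif2.Fubini') measurable
  also have "\<dots> = (\<integral>\<^sup>+z. ennreal (kern n z) * (\<integral>\<^sup>+y. ennreal \<bar>g ((x + z) + s *\<^sub>R y)\<bar> \<partial>cube) \<partial>tor)"
    by (simp add: nn_integral_cmult add_ac)
  also have "\<dots> \<le> (\<integral>\<^sup>+z. ennreal (kern n z) * B \<partial>tor)"
    by (intro nn_integral_mono mult_left_mono B) auto
  also have "\<dots> = B"
  proof -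
    have "(\<integral>\<^sup>+z. ennreal (kern n z) \<partial>tor) = 1"
      by (subst nn_integral_eq_integral[OF kern_integrable]) (auto simp: kern_integral kern_nonneg)
    then show ?thesis by (simp add: nn_integral_multc)
  qed
  finally show ?thesis .
qed

text \<open>
  For a function with square-integrable weak gradient \<open>g\<close> the increment between the scales \<open>s\<close> and
  \<open>2 s\<close> is at most the integral over \<open>\<sigma> \<in> [s, 2 s]\<close> of the \<open>L\<^sup>1\<close> masses of the \<open>g j\<close> at scale \<open>\<sigma>\<close>, which is of
  order \<open>\<sigma>\<^bsup>-3/2\<^esup>\<close>.  This is done for the mollified function first.
\<close>

lemma kato_H1:
  fixes l :: "real^3 \<Rightarrow> real" and g :: "3 \<Rightarrow> real^3 \<Rightarrow> real"
  assumes [measurable]: "l \<in> borel_measurable borel" and per: "periodic l" and i: "integrable tor l"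
    and gm [measurable]: "\<And>j. g j \<in> borel_measurable borel" and gp: "\<And>j. periodic (g j)"
        and g2: "\<And>j. integrable tor (\<lambda>x. (g j x)\<^sup>2)"
    and w: "\<And>h j. h \<in> trig \<Longrightarrow> (\<integral>x. h x * g j x \<partial>tor) = - (\<integral>x. partial j h x * l x \<partial>tor)"
  obtains C where "C \<ge> 0" "\<And>x s. 0 < s \<Longrightarrow> s \<le> 1/2 \<Longrightarrow> (cube_mass l x s) \<le> ennreal (C * s powr - (1/2))"
proof -
  have gi: "integrable tor (g j)" for j by (rule integrable_from_square[OF gm g2])
  define G where "G = (\<Sum>j\<in>UNIV. \<integral>x. (g j x)\<^sup>2 \<partial>tor)"
  have G0: "G \<ge> 0" unfolding G_def by (intro sum_nonneg Bochner_Integration.integral_nonneg) auto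
  have Gj: "(\<integral>\<^sup>+x. ennreal ((g j x)\<^sup>2) \<partial>tor) \<le> ennreal G" for j
  proof -
    have "(\<integral>\<^sup>+x. ennreal ((g j x)\<^sup>2) \<partial>tor) = ennreal (\<integral>x. (g j x)\<^sup>2 \<partial>tor)"
      by (rule nn_integral_eq_integral) (use g2 in auto)
    also have "\<dots> \<le> ennreal G" unfolding G_def
      by (intro ennreal_leI member_le_sum Bochner_Integration.integral_nonneg) auto
    finally show ?thesis .
  qed
  define E where "E = 3 * (4 + G / 2)"
  have E0: "E \<ge> 0" using G0 by (simp add: E_def)
  have gb: "(cube_mass (g j) x \<sigma>) \<le> ennreal ((4 + G / 2) * \<sigma> powr - (3/2))" if \<sigma>: "0 < \<sigma>" "\<sigma> \<le> 1/2"
      for j x \<sigma>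
  proof -
    let ?t = "\<sigma> powr - (3/2)"
    have t: "?t > 0" using \<sigma> by simp
    have "(cube_mass (g j) x \<sigma>) \<le> (\<integral>\<^sup>+y. ennreal (?t / 2) +
        ennreal (1 / (2 * ?t)) * ennreal ((g j (x + \<sigma> *\<^sub>R y))\<^sup>2) \<partial>cube)"
      by (intro nn_integral_mono young_ennreal t)
    also have "\<dots> = 8 * ennreal (?t / 2) + ennreal (1 / (2 * ?t)) *
        (\<integral>\<^sup>+y. ennreal ((g j (x + \<sigma> *\<^sub>R y))\<^sup>2) \<partial>cube)"
      by (subst nn_integral_add, simp, simp) (simp add: nn_integral_cmult mult.commute[of _ "8::ennreal"])
    also have "\<dots> \<le> 8 * ennreal (?t / 2) + ennreal (1 / (2 * ?t)) *
        (ennreal (1 / \<sigma>^3) * (\<integral>\<^sup>+x. ennreal ((g j x)\<^sup>2) \<partial>tor))"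
      by (intro add_left_mono mult_left_mono nn_integral_small_cube_le[of "\<lambda>x. ennreal ((g j x)\<^sup>2)"])
          (use gp[of j] \<sigma> in \<open>auto simp: periodic_def\<close>)
    also have "\<dots> \<le> 8 * ennreal (?t / 2) + ennreal (1 / (2 * ?t)) * (ennreal (1 / \<sigma>^3) * ennreal G)"
      by (intro add_left_mono mult_left_mono Gj) auto
    also have "\<dots> = ennreal 8 * ennreal (?t / 2) +
        ennreal (1 / (2 * ?t)) * (ennreal (1 / \<sigma>^3) * ennreal G)" by simp
    also have "\<dots> = ennreal (8 * (?t / 2) + 1 / (2 * ?t) * (1 / \<sigma>^3 * G))"
      using G0 t \<sigma> by (subst ennreal_mult[symmetric], simp, simp)+ (subst ennreal_plus, auto)
    also have "8 * (?t / 2) + 1 / (2 * ?t) * (1 / \<sigma>^3 * G) = (4 + G / 2) * ?t"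
    proof -
      have "?t * ?t = \<sigma> powr - 3" using \<sigma> by (simp add: powr_add[symmetric])
      also have "\<dots> = 1 / \<sigma>^3" using \<sigma> powr_realpow[of \<sigma> 3] by (simp add: powr_minus_divide)
      finally have "1 / \<sigma>^3 = ?t * ?t" by simp
      then show ?thesis using t by (simp add: field_simps)
    qed
    finally show ?thesis .
  qed
  have Lc: "c1_grad (conv (kern n) l) (\<lambda>j. conv (kern n) (g j))" for n
  proof (rule c1_grad_eq[OF conv_c1[OF kern_trig i] refl])
    fix j x
    have "conv (\<lambda>z. - partial j (kern n) z) l x = - (\<integral>y. partial j (\<lambda>y. kern n (y - x)) y * l y \<partial>tor)"
      by (simp add: conv_def partial_shift[OF kern_trig])
    also have "\<dots> = conv (kern n) (g j) x" unfolding conv_def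
      by (rule w[OF trig_shift[OF kern_trig], symmetric])
    finally show "conv (\<lambda>z. - partial j (kern n) z) l x = conv (kern n) (g j) x" .
  qed
  have [measurable]: "conv (kern n) l \<in> borel_measurable borel"
      "conv (kern n) (g j) \<in> borel_measurable borel" for n j
    using conv_measurable[OF i] conv_measurable[OF gi] by auto
  have step: "(cube_mass l x s) \<le> (cube_mass l x (2 * s)) + ennreal (E * s powr - (1/2))"
    if s: "0 < s" "s \<le> 1/4" for x s
  proof -
    define m where "m f s = (cube_mass f x s)" for f :: "real^3 \<Rightarrow> real" and s
    define \<delta> where "\<delta> n = (\<integral>\<^sup>+x. ennreal \<bar>conv (kern n) l x - l x\<bar> \<partial>tor)" for n
    have smooth: "m (conv (kern n) l) s \<le> m (conv (kern n) l) (2 * s) + ennreal (E * s powr - (1/2))"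
        for n
    proof -
      let ?L = "conv (kern n) l" and ?D = "\<lambda>j. conv (kern n) (g j)"
      have pt: "ennreal \<bar>?L (x + s *\<^sub>R y)\<bar> \<le> ennreal \<bar>?L (x + (2 * s) *\<^sub>R y)\<bar> +
          (\<integral>\<^sup>+\<sigma>. (\<Sum>j\<in>UNIV. ennreal \<bar>?D j (x + \<sigma> *\<^sub>R y)\<bar>) \<partial>unif s (2 * s))"
        if y: "y \<in> cbox (-1) 1" for y
      proof -
        let ?I = "\<integral>\<sigma>. (\<Sum>j\<in>UNIV. ?D j (x + \<sigma> *\<^sub>R y) * y $ j) \<partial>unif s (2 * s)"
        have c: "continuous_on UNIV (\<lambda>\<sigma>. \<Sum>j\<in>UNIV. ?D j (x + \<sigma> *\<^sub>R y) * y $ j)"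
          by (intro continuous_intros continuous_on_compose2[OF c1_grad_cont_grad[OF Lc]]) auto
        have "?L (x + s *\<^sub>R y) = ?L (x + (2 * s) *\<^sub>R y) - ?I"
          using c1_grad_FTC[OF Lc, of s "2 * s" n x y] s by simp
        then have "\<bar>?L (x + s *\<^sub>R y)\<bar> \<le> \<bar>?L (x + (2 * s) *\<^sub>R y)\<bar> + \<bar>?I\<bar>" by arith
        then have "ennreal \<bar>?L (x + s *\<^sub>R y)\<bar> \<le> ennreal (\<bar>?L (x + (2 * s) *\<^sub>R y)\<bar> + \<bar>?I\<bar>)"
          by (rule ennreal_leI)
        also have "\<dots> = ennreal \<bar>?L (x + (2 * s) *\<^sub>R y)\<bar> + ennreal \<bar>?I\<bar>" by (rule ennreal_plus) auto
        also have "ennreal \<bar>?I\<bar> \<le> (\<integral>\<^sup>+\<sigma>. ennreal \<bar>\<Sum>j\<in>UNIV. ?D j (x + \<sigma> *\<^sub>R y) * y $ j\<bar> \<partial>unif s (2 * s))"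
          using integral_norm_bound_ennreal[OF integrable_unif_continuous[OF c]] by simp
        also have "\<dots> \<le> (\<integral>\<^sup>+\<sigma>. (\<Sum>j\<in>UNIV. ennreal \<bar>?D j (x + \<sigma> *\<^sub>R y)\<bar>) \<partial>unif s (2 * s))"
        proof (rule nn_integral_mono)
          fix \<sigma> :: real
          have "\<bar>\<Sum>j\<in>UNIV. ?D j (x + \<sigma> *\<^sub>R y) * y $ j\<bar> \<le> (\<Sum>j\<in>UNIV. \<bar>?D j (x + \<sigma> *\<^sub>R y)\<bar>)"
          proof (intro order_trans[OF sum_abs] sum_mono)
            fix j :: 3
            have "-1 \<le> y $ j" "y $ j \<le> 1" using y by (auto simp: mem_box_cart)
            then have "\<bar>?D j (x + \<sigma> *\<^sub>R y)\<bar> * \<bar>y $ j\<bar> \<le> \<bar>?D j (x + \<sigma> *\<^sub>R y)\<bar> * 1"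
              by (intro mult_left_mono) (auto simp: abs_le_iff)
            then show "\<bar>?D j (x + \<sigma> *\<^sub>R y) * y $ j\<bar> \<le> \<bar>?D j (x + \<sigma> *\<^sub>R y)\<bar>" by (simp add: abs_mult)
          qed
          then have "ennreal \<bar>\<Sum>j\<in>UNIV. ?D j (x + \<sigma> *\<^sub>R y) * y $ j\<bar> \<le>
              ennreal (\<Sum>j\<in>UNIV. \<bar>?D j (x + \<sigma> *\<^sub>R y)\<bar>)" by (rule ennreal_leI)
          then show "ennreal \<bar>\<Sum>j\<in>UNIV. ?D j (x + \<sigma> *\<^sub>R y) * y $ j\<bar> \<le>
              (\<Sum>j\<in>UNIV. ennreal \<bar>?D j (x + \<sigma> *\<^sub>R y)\<bar>)" by simp
        qed
        finally show ?thesis by (simp add: add_left_mono)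
      qed
      have "m ?L s \<le> (\<integral>\<^sup>+y. ennreal \<bar>?L (x + (2 * s) *\<^sub>R y)\<bar> +
          (\<integral>\<^sup>+\<sigma>. (\<Sum>j\<in>UNIV. ennreal \<bar>?D j (x + \<sigma> *\<^sub>R y)\<bar>) \<partial>unif s (2 * s)) \<partial>cube)"
        unfolding m_def by (rule nn_integral_mono_AE) (use pt in \<open>auto simp: AE_unif\<close>)
      also have "\<dots> = m ?L (2 * s) + (\<integral>\<^sup>+y. \<integral>\<^sup>+\<sigma>. (\<Sum>j\<in>UNIV. ennreal \<bar>?D j (x + \<sigma> *\<^sub>R y)\<bar>) \<partial>unif s (2 * s)
          \<partial>cube)"
        unfolding m_def by (rule nn_integral_add) measurable
      also have "(\<integral>\<^sup>+y. \<integral>\<^sup>+\<sigma>. (\<Sum>j\<in>UNIV. ennreal \<bar>?D j (x + \<sigma> *\<^sub>R y)\<bar>) \<partial>unif s (2 * s) \<partial>cube) =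
          (\<integral>\<^sup>+\<sigma>. \<integral>\<^sup>+y. (\<Sum>j\<in>UNIV. ennreal \<bar>?D j (x + \<sigma> *\<^sub>R y)\<bar>) \<partial>cube \<partial>unif s (2 * s))"
        by (rule unif2.Fubini') measurable
      also have "\<dots> = (\<integral>\<^sup>+\<sigma>. (\<Sum>j\<in>UNIV. \<integral>\<^sup>+y. ennreal \<bar>?D j (x + \<sigma> *\<^sub>R y)\<bar> \<partial>cube) \<partial>unif s (2 * s))"
        by (simp add: nn_integral_sum del: sum_ennreal)
      also have "\<dots> \<le> (\<integral>\<^sup>+\<sigma>. ennreal (E * s powr - (3/2)) \<partial>unif s (2 * s))"
      proof (rule nn_integral_mono_AE)
        have "(\<Sum>j\<in>UNIV. \<integral>\<^sup>+y. ennreal \<bar>?D j (x + \<sigma> *\<^sub>R y)\<bar> \<partial>cube) \<le> ennreal (E * s powr - (3/2))"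
            if \<sigma>: "s \<le> \<sigma>" "\<sigma> \<le> 2 * s" for \<sigma>
        proof -
          have "(\<Sum>j\<in>UNIV. \<integral>\<^sup>+y. ennreal \<bar>?D j (x + \<sigma> *\<^sub>R y)\<bar> \<partial>cube) \<le>
              (\<Sum>j\<in>(UNIV::3 set). ennreal ((4 + G / 2) * \<sigma> powr - (3/2)))"
            by (intro sum_mono conv_kern_cube_bound[OF gm gp gi] gb) (use s \<sigma> in auto)
          also have "\<dots> = ennreal (\<Sum>j\<in>(UNIV::3 set). (4 + G / 2) * \<sigma> powr - (3/2))" using G0
            by (intro sum_ennreal) auto
          also have "(\<Sum>j\<in>(UNIV::3 set). (4 + G / 2) * \<sigma> powr - (3/2)) = E * \<sigma> powr - (3/2)"
            by (simp add: E_def)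
          also have "\<dots> \<le> ennreal (E * s powr - (3/2))"
            using E0 s \<sigma> by (intro ennreal_leI mult_left_mono powr_mono2') auto
          finally show ?thesis .
        qed
        then show "AE \<sigma> in unif s (2 * s). (\<Sum>j\<in>UNIV. \<integral>\<^sup>+y. ennreal \<bar>?D j (x + \<sigma> *\<^sub>R y)\<bar> \<partial>cube) \<le>
            ennreal (E * s powr - (3/2))"
          by (auto simp: AE_unif)
      qed
      also have "\<dots> = ennreal (E * s powr - (3/2)) * ennreal s" using s by (simp add: emeasure_unif)
      also have "\<dots> = ennreal (E * s powr - (1/2))"
      proof -
        have "s powr - (3/2) * s = s powr (- (3/2) + 1)" using s by (subst powr_add) simp
        then have "s powr - (3/2) * s = s powr - (1/2)" by simp
        then show ?thesis using s E0 by (subst ennreal_mult[symmetric]) (auto simp: mult.assoc)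
      qed
      finally show ?thesis by (simp add: add_left_mono)
    qed
    have tri: "m f s' \<le> m h s' + ennreal (1 / s'^3) * (\<integral>\<^sup>+x. ennreal \<bar>f x - h x\<bar> \<partial>tor)" 
      if [measurable]: "f \<in> borel_measurable borel" "h \<in> borel_measurable borel"
          and p: "periodic f" "periodic h" and s': "0 < s'" "s' \<le> 1/2" for f h s'
    proof -
      have "m f s' \<le> (\<integral>\<^sup>+y. ennreal \<bar>h (x + s' *\<^sub>R y)\<bar> +
          ennreal \<bar>f (x + s' *\<^sub>R y) - h (x + s' *\<^sub>R y)\<bar> \<partial>cube)"
        unfolding m_def
      proof (rule nn_integral_mono)
        fix y
        have "\<bar>f (x + s' *\<^sub>R y)\<bar> \<le> \<bar>h (x + s' *\<^sub>R y)\<bar> + \<bar>f (x + s' *\<^sub>R y) - h (x + s' *\<^sub>R y)\<bar>" by arith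
        then have "ennreal \<bar>f (x + s' *\<^sub>R y)\<bar> \<le>
            ennreal (\<bar>h (x + s' *\<^sub>R y)\<bar> + \<bar>f (x + s' *\<^sub>R y) - h (x + s' *\<^sub>R y)\<bar>)" by (rule ennreal_leI)
        then show "ennreal \<bar>f (x + s' *\<^sub>R y)\<bar> \<le>
            ennreal \<bar>h (x + s' *\<^sub>R y)\<bar> + ennreal \<bar>f (x + s' *\<^sub>R y) - h (x +
            s' *\<^sub>R y)\<bar>" by (subst (asm) ennreal_plus) auto
      qed
      also have "\<dots> = m h s' + (\<integral>\<^sup>+y. ennreal \<bar>f (x + s' *\<^sub>R y) - h (x + s' *\<^sub>R y)\<bar> \<partial>cube)"
        unfolding m_def by (rule nn_integral_add) measurable
      also have "\<dots> \<le> m h s' + ennreal (1 / s'^3) * (\<integral>\<^sup>+x. ennreal \<bar>f x - h x\<bar> \<partial>tor)"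
        by (intro add_left_mono nn_integral_small_cube_le[of "\<lambda>x. ennreal \<bar>f x - h x\<bar>"])
            (use p s' in \<open>auto simp: periodic_def\<close>)
      finally show ?thesis .
    qed
    have Lp: "periodic (conv (kern n) l)" for n by (rule conv_periodic[OF trig_periodic[OF kern_trig]])
    have \<delta>': "(\<integral>\<^sup>+x. ennreal \<bar>l x - conv (kern n) l x\<bar> \<partial>tor) = \<delta> n" for n
      unfolding \<delta>_def by (simp add: abs_minus_commute)
    have "m l s \<le> m l (2 * s) + ennreal (E * s powr - (1/2)) +
        (ennreal (1 / (2 * s)^3) * \<delta> n + ennreal (1 / s^3) * \<delta> n)" for n
    proof -
      have "m l s \<le> m (conv (kern n) l) s + ennreal (1 / s^3) * \<delta> n"
        using tri[of l "conv (kern n) l" s] Lp per s by (simp add: \<delta>')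
      also have "\<dots> \<le> (m (conv (kern n) l) (2 * s) + ennreal (E * s powr - (1/2))) +
          ennreal (1 / s^3) * \<delta> n"
        by (intro add_right_mono smooth)
      also have "\<dots> \<le> (m l (2 * s) + ennreal (1 / (2 * s)^3) * \<delta> n + ennreal (E * s powr - (1/2))) +
          ennreal (1 / s^3) * \<delta> n"
        using tri[of "conv (kern n) l" l "2 * s"] Lp per s by (intro add_right_mono) (simp add: \<delta>_def)
      finally show ?thesis by (simp add: add_ac)
    qed
    moreover have "(\<lambda>n. m l (2 * s) + ennreal (E * s powr - (1/2)) +
        (ennreal (1 / (2 * s)^3) * \<delta> n + ennreal (1 / s^3) * \<delta> n)) \<longlonglongrightarrow>
        m l (2 * s) + ennreal (E * s powr - (1/2)) +
        (ennreal (1 / (2 * s)^3) * 0 + ennreal (1 / s^3) * 0)"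
      unfolding \<delta>_def by (intro tendsto_add tendsto_const ennreal_tendsto_cmult conv_kern_L1 assms(1)
          per i) auto
    ultimately have "m l s \<le> m l (2 * s) + ennreal (E * s powr - (1/2)) +
        (ennreal (1 / (2 * s)^3) * 0 + ennreal (1 / s^3) * 0)"
      by (intro LIMSEQ_le_const[of _ _ "m l s"]) auto
    then show ?thesis by (simp add: m_def)
  qed
  have "(cube_mass l x s) \<le> ennreal (max (64 * (\<integral>x. \<bar>l x\<bar> \<partial>tor)) (E / (1 - 2 powr - (1/2))) * s powr -
      (1/2))" if "0 < s" "s \<le> 1/2" for x s
    by (rule dyadic_growth[of "\<lambda>s. \<integral>\<^sup>+y. ennreal \<bar>l (x + s *\<^sub>R y)\<bar> \<partial>cube"])
      (use that step small_cube_L1_bound[OF assms(1,2) _ _ i] E0 in auto)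
  then show thesis by (intro that[of "max (64 * (\<integral>x. \<bar>l x\<bar> \<partial>tor)) (E / (1 - 2 powr - (1/2)))"])
      (auto simp: le_max_iff_disj)
qed

section \<open>Borel representatives of periodic functions\<close>

lemma AE_lborel_shift:
  fixes a :: "'a::euclidean_space"
  assumes "AE x in lborel. P x" shows "AE x in lborel. P (x + a)"
proof -
  obtain N where N: "{x \<in> space lborel. \<not> P x} \<subseteq> N" "emeasure lborel N = 0" "N \<in> sets lborel"
    using assms by (rule AE_E)
  have [measurable]: "N \<in> sets borel" using N by simp
  have "(\<integral>\<^sup>+x. indicator N (x + a) \<partial>lborel) = (\<integral>\<^sup>+x. indicator N x \<partial>lborel)"
    by (rule nn_integral_lborel_shift) measurable
  also have "\<dots> = 0" using N by simp
  finally have "AE x in lborel. indicator N (x + a) = (0::ennreal)"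
    by (subst (asm) nn_integral_0_iff_AE) auto
  then show ?thesis by eventually_elim (use N in \<open>auto simp: indicator_def split: if_splits\<close>)
qed

text \<open>A Borel representative is made periodic by composing it with \<open>wrap\<close>.\<close>

lemma borel_periodic_rep:
  fixes f :: "real^3 \<Rightarrow> real"
  assumes f: "f \<in> borel_measurable lebesgue" and per: "periodic f"
  obtains g where "g \<in> borel_measurable borel" "periodic g" "AE x in lborel. f x = g x"
proof -
  obtain h where h: "h \<in> borel_measurable lborel" "AE x in lborel. f x = h x"
    using completion_ex_borel_measurable_real[OF f] by auto
  have [measurable]: "h \<in> borel_measurable borel" using h by simp
  have "AE x in lborel. \<forall>k\<in>lattice. f (x + k) = h (x + k)"
    using countable_lattice AE_lborel_shift[OF h(2)] by (subst AE_ball_countable) auto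
  then have "AE x in lborel. f x = h (wrap x)"
  proof eventually_elim
    case (elim x)
    from bspec[OF elim wrap_lattice(1)[of x]] have "f (wrap x) = h (wrap x)" by simp
    then show ?case by (simp add: periodic_wrap[OF per])
  qed
  then show thesis
    by (intro that[of "\<lambda>x. h (wrap x)"]) (auto simp: periodic_def wrap_plus_axis)
qed

lemma AE_torus: "(AE x in torus. P x) \<longleftrightarrow> (AE x in tor. P x)"
  unfolding torus_def by (subst AE_restrict_space_iff) (auto simp: AE_completion_iff AE_unif)

lemma nn_integral_torus: assumes "g \<in> borel_measurable borel"
    shows "(\<integral>\<^sup>+x. g x \<partial>torus) = (\<integral>\<^sup>+x. g x \<partial>tor)"
  unfolding torus_def using assms by (simp add: nn_integral_restrict_space nn_integral_completion
      nn_integral_unif)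

lemma integral_torus_borel:
  fixes g :: "real^3 \<Rightarrow> real"
  assumes g: "g \<in> borel_measurable borel"
  shows "(LINT x|torus. g x) = (\<integral>x. g x \<partial>tor)" "integrable torus g \<longleftrightarrow> integrable tor g"
proof -
  have [measurable]: "g \<in> borel_measurable lborel" using g by simp
  show "(LINT x|torus. g x) = (\<integral>x. g x \<partial>tor)"
    unfolding torus_def using g
    by (simp add: integral_restrict_space integral_completion integral_unif set_lebesgue_integral_def)
  have "integrable torus g \<longleftrightarrow> (\<integral>\<^sup>+x. ennreal (norm (g x)) \<partial>torus) < \<infinity>"
    using g by (subst integrable_iff_bounded)
        (auto simp: torus_def intro!: measurable_restrict_space1 measurable_completion)
  then show "integrable torus g \<longleftrightarrow> integrable tor g"
    using g by (subst (asm) nn_integral_torus) (auto simp: integrable_iff_bounded)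
qed

lemma integral_torus_eq:
  fixes f g :: "real^3 \<Rightarrow> real"
  assumes f: "f \<in> borel_measurable lebesgue" and g: "g \<in> borel_measurable borel"
      and eq: "AE x in lborel. f x = g x"
  shows "(LINT x|torus. f x) = (\<integral>x. g x \<partial>tor)" "integrable torus f \<longleftrightarrow> integrable tor g"
proof -
  have m: "f \<in> borel_measurable torus" "g \<in> borel_measurable torus"
    unfolding torus_def using f g by (auto intro!: measurable_restrict_space1 measurable_completion)
  have ae: "AE x in torus. f x = g x" unfolding AE_torus by (rule AE_unifI[OF eq])
  show "(LINT x|torus. f x) = (\<integral>x. g x \<partial>tor)"
    using integral_cong_AE[OF m ae] integral_torus_borel(1)[OF g] by simp
  show "integrable torus f \<longleftrightarrow> integrable tor g"
    using integrable_cong_AE[OF m ae] integral_torus_borel(2)[OF g] by simp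
qed

text \<open>The components of a smooth field are continuously differentiable.\<close>

lemma smooth_c1:
  assumes "smooth_on UNIV v" shows "c1_grad (\<lambda>x. v x $ k) (\<lambda>i x. partial i v x $ k)"
proof -
  have d0: "v differentiable_on UNIV" using assms unfolding smooth_on_def
    by (auto dest: spec[of _ "[]"] simp: iter_deriv_def)
  have d1: "(\<lambda>x. frechet_derivative v (at x) e) differentiable_on UNIV" for e
    using assms unfolding smooth_on_def by (auto dest: spec[of _ "[e]"] simp: iter_deriv_def)
  have dv: "(v has_derivative frechet_derivative v (at x)) (at x)" for x
    using d0 by (simp add: differentiable_on_def frechet_derivative_works[symmetric])
  show ?thesis unfolding c1_grad_def
  proof (intro conjI allI)
    fix x
    have "((\<lambda>x. v x $ k) has_derivative (\<lambda>h. frechet_derivative v (at x) h $ k)) (at x)"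
      by (rule bounded_linear.has_derivative[OF bounded_linear_vec_nth dv])
    moreover have "frechet_derivative v (at x) h $ k = (\<Sum>i\<in>UNIV. partial i v x $ k * h $ i)" for h
    proof -
      have lin: "linear (frechet_derivative v (at x))"
        using dv has_derivative_bounded_linear bounded_linear.linear by blast
      have "h = (\<Sum>i\<in>UNIV. h $ i *\<^sub>R axis i 1)"
        by (simp add: vec_eq_iff axis_def if_distrib cong: if_cong)
      then have "frechet_derivative v (at x) h =
          frechet_derivative v (at x) (\<Sum>i\<in>UNIV. h $ i *\<^sub>R axis i 1)" by simp
      also have "\<dots> = (\<Sum>i\<in>UNIV. h $ i *\<^sub>R partial i v x)"
        by (simp add: linear_sum[OF lin] linear_cmul[OF lin] partial_def)
      finally show ?thesis by (simp add: mult.commute)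
    qed
    ultimately show "((\<lambda>x. v x $ k) has_derivative (\<lambda>h. \<Sum>i\<in>UNIV. partial i v x $ k * h $ i)) (at x)"
      by simp
    fix i
    have "continuous_on UNIV (\<lambda>x. partial i v x)" unfolding partial_def using d1
      by (intro differentiable_imp_continuous_on) auto
    then show "continuous_on UNIV (\<lambda>x. partial i v x $ k)" by (intro continuous_intros)
  qed
qed

section \<open>Solenoidal fields are weakly divergence free\<close>

text \<open>Borel measurable periodic components of a field in \<open>L\<^sup>2\<close>.\<close>

lemma L2_component_rep:
  fixes v :: "real^3 \<Rightarrow> real^3"
  assumes "v \<in> L2_torus"
  obtains u where "\<And>i. u i \<in> borel_measurable borel" "\<And>i. periodic (u i)"
      "AE x in lborel. \<forall>i. v x $ i = u i x" "\<And>i. integrable tor (\<lambda>x. (u i x)\<^sup>2)"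
proof -
  have v: "periodic v" "v \<in> borel_measurable lebesgue" "integrable torus (\<lambda>x. (norm (v x))\<^sup>2)"
    using assms by (auto simp: L2_torus_def)
  have [measurable]: "v \<in> borel_measurable lebesgue" by (rule v)
  have "\<exists>u. u \<in> borel_measurable borel \<and> periodic u \<and> (AE x in lborel. v x $ i = u x)" for i
  proof -
    have "(\<lambda>x. v x $ i) \<in> borel_measurable lebesgue" by measurable
    moreover have "periodic (\<lambda>x. v x $ i)" using v(1) by (simp add: periodic_def)
    ultimately show ?thesis by (rule borel_periodic_rep) blast
  qed
  then obtain u where u: "\<And>i. u i \<in> borel_measurable borel" "\<And>i. periodic (u i)"
      "\<And>i. AE x in lborel. v x $ i = u i x"
    by metis
  have ae: "AE x in lborel. \<forall>i. v x $ i = u i x" using u(3) by (auto simp: AE_all_countable)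
  have "integrable tor (\<lambda>x. (u i x)\<^sup>2)" for i
  proof -
    have "integrable torus (\<lambda>x. (v x $ i)\<^sup>2)"
    proof (rule Bochner_Integration.integrable_bound[OF v(3)])
      have "(\<lambda>x. (v x $ i)\<^sup>2) \<in> borel_measurable lebesgue" by measurable
      then show "(\<lambda>x. (v x $ i)\<^sup>2) \<in> borel_measurable torus" unfolding torus_def
        by (rule measurable_restrict_space1)
      show "AE x in torus. norm ((v x $ i)\<^sup>2) \<le> norm ((norm (v x))\<^sup>2)"
        using component_le_norm_cart[of "v _" i]
          by (auto intro!: AE_I2 power2_le_iff_abs_le[THEN iffD2] simp: abs_le_square_iff[symmetric])
    qed
    moreover have "integrable torus (\<lambda>x. (v x $ i)\<^sup>2) \<longleftrightarrow> integrable tor (\<lambda>x. (u i x)\<^sup>2)"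
      by (rule integral_torus_eq(2)) (use u(1)[of i] u(3)[of i] in \<open>auto elim!: eventually_mono\<close>)
    ultimately show ?thesis by simp
  qed
  with u ae show thesis by (intro that[of u]) auto
qed

lemma inner_L2_rep:
  fixes v :: "real^3 \<Rightarrow> real^3"
  assumes [measurable]: "v \<in> borel_measurable lebesgue"
      and [measurable]: "\<And>i. u i \<in> borel_measurable borel" "\<And>i. g i \<in> borel_measurable borel"
    and ae: "AE x in lborel. \<forall>i. v x $ i = u i x" and w: "\<And>x i. w x $ i = g i x"
  shows "inner_L2 v w = (\<integral>x. (\<Sum>i\<in>UNIV. u i x * g i x) \<partial>tor)"
  unfolding inner_L2_def
proof (rule integral_torus_eq(1))
  have [measurable]: "g i \<in> borel_measurable lebesgue" for i by (rule measurable_completion) simp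
  have "(\<lambda>x. \<Sum>i\<in>UNIV. v x $ i * g i x) \<in> borel_measurable lebesgue" by measurable
  then show "(\<lambda>x. v x \<bullet> w x) \<in> borel_measurable lebesgue" by (simp add: inner_vec_def w)
  show "AE x in lborel. v x \<bullet> w x = (\<Sum>i\<in>UNIV. u i x * g i x)" using ae
    by eventually_elim (simp add: inner_vec_def w)
qed measurable

lemma L2_small_L1_small:
  fixes f :: "real^3 \<Rightarrow> real"
  assumes [measurable]: "f \<in> borel_measurable borel" and i: "integrable tor (\<lambda>x. (f x)\<^sup>2)"
      and e: "0 < e" "(\<integral>x. (f x)\<^sup>2 \<partial>tor) < e\<^sup>2"
  shows "(\<integral>x. \<bar>f x\<bar> \<partial>tor) < e"
proof -
  have "(\<integral>x. \<bar>f x\<bar> \<partial>tor) \<le> (\<integral>x. e / 2 + 1 / (2 * e) * (f x)\<^sup>2 \<partial>tor)"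
  proof (rule integral_mono)
    show "integrable tor (\<lambda>x. \<bar>f x\<bar>)" using integrable_from_square[OF assms(1) i] by auto
    show "integrable tor (\<lambda>x. e / 2 + 1 / (2 * e) * (f x)\<^sup>2)" using i by auto
    fix x
    have "0 \<le> (\<bar>f x\<bar> - e)\<^sup>2" by simp
    then have "2 * e * \<bar>f x\<bar> \<le> e * e + (f x)\<^sup>2" by (simp add: power2_eq_square algebra_simps)
    then have "\<bar>f x\<bar> \<le> (e * e + (f x)\<^sup>2) / (2 * e)" using e by (simp add: pos_le_divide_eq mult.commute)
    then show "\<bar>f x\<bar> \<le> e / 2 + 1 / (2 * e) * (f x)\<^sup>2" using e by (simp add: add_divide_distrib)
  qed
  also have "\<dots> = e / 2 + 1 / (2 * e) * (\<integral>x. (f x)\<^sup>2 \<partial>tor)" using i by (simp add: measure_def)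
  also have "\<dots> < e / 2 + 1 / (2 * e) * e\<^sup>2" using e
    by (intro add_strict_left_mono mult_strict_left_mono) auto
  also have "\<dots> = e" using e by (simp add: power2_eq_square)
  finally show ?thesis .
qed

text \<open>The weak divergence vanishes for smooth solenoidal fields and is continuous in \<open>L\<^sup>2\<close>.\<close>

lemma solenoidal_weak_div:
  assumes v: "v \<in> solenoidal_L2" and um [measurable]: "\<And>i. u i \<in> borel_measurable borel"
    and ae: "AE x in lborel. \<forall>i. v x $ i = u i x" and u2: "\<And>i. integrable tor (\<lambda>x. (u i x)\<^sup>2)"
        and g: "g \<in> trig"
  shows "(\<Sum>i\<in>UNIV. \<integral>x. partial i g x * u i x \<partial>tor) = 0"
proof -
  note [measurable] = trig_measurable[OF trig_partial[OF g]]
  have vm [measurable]: "v \<in> borel_measurable lebesgue" using v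
    by (auto simp: solenoidal_L2_def L2_torus_def)
  have "\<exists>C\<ge>0. \<forall>x. \<bar>partial i g x\<bar> \<le> C" for i
    using periodic_continuous_bounded[OF trig_cont[OF trig_partial[OF g]] trig_periodic[OF trig_partial[OF g]]] by metis
  then obtain C where C: "\<And>i. C i \<ge> 0" "\<And>i x. \<bar>partial i g x\<bar> \<le> C i" by metis
  have "\<bar>\<Sum>i\<in>UNIV. \<integral>x. partial i g x * u i x \<partial>tor\<bar> \<le> (\<Sum>i\<in>UNIV. C i) * e" if e: "e > 0" for e
  proof -
    obtain w where w: "w \<in> solenoidal_smooth" "norm_L2 (\<lambda>x. v x - w x) < e"
      using v e by (auto simp: solenoidal_L2_def)
    have wp: "periodic w" and wc: "\<And>k. c1_grad (\<lambda>x. w x $ k) (\<lambda>i x. partial i w x $ k)"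
        and wd: "\<And>x. divergence w x = 0"
      using w(1) smooth_c1 by (auto simp: solenoidal_smooth_def)
    have [measurable]: "(\<lambda>x. w x $ k) \<in> borel_measurable borel" for k
      using c1_grad_measurable(1)[OF wc] .
    have wcont: "continuous_on UNIV (\<lambda>x. w x $ k)" for k by (rule c1_grad_cont[OF wc])
    have [measurable]: "w \<in> borel_measurable lebesgue"
    proof -
      have "continuous_on UNIV (\<lambda>x. \<chi> k. w x $ k)" by (intro continuous_on_vec_lambda wcont)
      then have "continuous_on UNIV w" by simp
      then show ?thesis by (intro measurable_completion) (auto intro: borel_measurable_continuous_onI)
    qed
    have "continuous_on UNIV (\<lambda>x. (w x $ k)\<^sup>2)" for k by (intro continuous_intros wcont)
    then have w2: "integrable tor (\<lambda>x. (w x $ k)\<^sup>2)" for k by (rule integrable_unif_continuous)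
    have wi: "integrable tor (\<lambda>x. w x $ k)" for k by (rule integrable_unif_continuous[OF wcont])
    have uw: "integrable tor (\<lambda>x. u k x * w x $ k)" for k
      by (rule integrable_product_from_squares[OF um _ u2 w2]) measurable
    have d2: "integrable tor (\<lambda>x. (u k x - w x $ k)\<^sup>2)" for k
      using u2[of k] w2[of k] uw[of k] by (simp add: power2_diff mult.assoc)
    have nrm: "(\<integral>x. (\<Sum>k\<in>UNIV. (u k x - w x $ k)\<^sup>2) \<partial>tor) < e\<^sup>2"
    proof -
      have eq: "(LINT x|torus. (norm (v x - w x))\<^sup>2) = (\<integral>x. (\<Sum>k\<in>UNIV. (u k x - w x $ k)\<^sup>2) \<partial>tor)"
      proof (rule integral_torus_eq(1))
        show "AE x in lborel. (norm (v x - w x))\<^sup>2 = (\<Sum>k\<in>UNIV. (u k x - w x $ k)\<^sup>2)"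
          using ae unfolding power2_norm_eq_inner inner_vec_def
            by eventually_elim (simp add: power2_eq_square)
      qed measurable
      have "sqrt (LINT x|torus. (norm (v x - w x))\<^sup>2) < sqrt (e\<^sup>2)" using w(2) e
        by (simp add: norm_L2_def)
      then show ?thesis by (simp only: real_sqrt_less_iff eq)
    qed
    have L1: "(\<integral>x. \<bar>u k x - w x $ k\<bar> \<partial>tor) < e" for k
    proof (rule L2_small_L1_small[OF _ d2 e])
      have "(\<integral>x. (u k x - w x $ k)\<^sup>2 \<partial>tor) \<le> (\<integral>x. (\<Sum>k\<in>UNIV. (u k x - w x $ k)\<^sup>2) \<partial>tor)"
        by (intro integral_mono d2 Bochner_Integration.integrable_sum) (auto intro: member_le_sum)
      then show "(\<integral>x. (u k x - w x $ k)\<^sup>2 \<partial>tor) < e\<^sup>2" using nrm by simp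
    qed measurable
    have zero: "(\<Sum>i\<in>UNIV. \<integral>x. partial i g x * w x $ i \<partial>tor) = 0"
    proof -
      have cg: "continuous_on UNIV g" "continuous_on UNIV (partial i g)" for i
        by (rule trig_cont[OF g], rule trig_cont[OF trig_partial[OF g]])
      have "(\<integral>x. g x * partial i w x $ i + partial i g x * w x $ i \<partial>tor) = 0" for i
        by (rule integral_tor_partial_eq_0[OF c1_grad_mult[OF trig_c1_grad[OF g] wc]])
          (use wp trig_periodic[OF g] in \<open>simp add: periodic_def\<close>)
      moreover have i1: "integrable tor (\<lambda>x. g x * partial i w x $ i)"
          and i2: "integrable tor (\<lambda>x. partial i g x * w x $ i)" for i
        by (intro integrable_unif_continuous continuous_on_mult cg wcont c1_grad_cont_grad[OF wc])+
      ultimately have "(\<integral>x. partial i g x * w x $ i \<partial>tor) = - (\<integral>x. g x * partial i w x $ i \<partial>tor)" for i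
        by (simp add: eq_neg_iff_add_eq_0 add.commute)
      then have "(\<Sum>i\<in>UNIV. \<integral>x. partial i g x * w x $ i \<partial>tor) =
          - (\<integral>x. (\<Sum>i\<in>UNIV. g x * partial i w x $ i) \<partial>tor)"
        using i1 by (simp add: sum_negf)
      also have "(\<lambda>x. \<Sum>i\<in>UNIV. g x * partial i w x $ i) = (\<lambda>x. 0)"
        using wd by (simp add: divergence_def sum_distrib_left[symmetric] fun_eq_iff)
      finally show ?thesis by simp
    qed
    have "(\<Sum>i\<in>UNIV. \<integral>x. partial i g x * u i x \<partial>tor) =
        (\<Sum>i\<in>UNIV. \<integral>x. partial i g x * (u i x - w x $ i) \<partial>tor)"
    proof -
      have "(\<integral>x. partial i g x * (u i x - w x $ i) \<partial>tor) =
          (\<integral>x. partial i g x * u i x \<partial>tor) - (\<integral>x. partial i g x * w x $ i \<partial>tor)" for i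
        using integrable_trig_mult[OF trig_partial[OF g] integrable_from_square[OF um u2]]
            integrable_trig_mult[OF trig_partial[OF g] wi]
        by (simp add: right_diff_distrib)
      then show ?thesis using zero by (simp add: sum_subtractf)
    qed
    also have "\<bar>\<dots>\<bar> \<le> (\<Sum>i\<in>UNIV. \<bar>\<integral>x. partial i g x * (u i x - w x $ i) \<partial>tor\<bar>)" by (rule sum_abs)
    also have "\<dots> \<le> (\<Sum>i\<in>UNIV. C i * e)"
    proof (rule sum_mono)
      fix i :: 3
      have di: "integrable tor (\<lambda>x. u i x - w x $ i)" using integrable_from_square[OF um u2] wi by auto
      have "\<bar>\<integral>x. partial i g x * (u i x - w x $ i) \<partial>tor\<bar> \<le>
          (\<integral>x. \<bar>partial i g x * (u i x - w x $ i)\<bar> \<partial>tor)" by (rule integral_abs_bound)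
      also have "\<dots> \<le> (\<integral>x. C i * \<bar>u i x - w x $ i\<bar> \<partial>tor)"
      proof (rule integral_mono)
        show "integrable tor (\<lambda>x. \<bar>partial i g x * (u i x - w x $ i)\<bar>)"
          by (rule integrable_abs[OF integrable_trig_mult[OF trig_partial[OF g] di]])
        show "integrable tor (\<lambda>x. C i * \<bar>u i x - w x $ i\<bar>)" using di by auto
        show "\<bar>partial i g x * (u i x - w x $ i)\<bar> \<le> C i * \<bar>u i x - w x $ i\<bar>" for x
          unfolding abs_mult by (intro mult_right_mono C) auto
      qed
      also have "\<dots> = C i * (\<integral>x. \<bar>u i x - w x $ i\<bar> \<partial>tor)" by simp
      also have "\<dots> \<le> C i * e" using L1[of i] C(1) by (intro mult_left_mono) auto
      finally show "\<bar>\<integral>x. partial i g x * (u i x - w x $ i) \<partial>tor\<bar> \<le> C i * e" .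
    qed
    finally show ?thesis by (simp add: sum_distrib_right)
  qed
  note le = this
  have C0: "(\<Sum>i\<in>UNIV. C i) + 1 > 0" using C(1) by (intro add_nonneg_pos sum_nonneg) auto
  have "\<bar>\<Sum>i\<in>UNIV. \<integral>x. partial i g x * u i x \<partial>tor\<bar> \<le> 0 + \<epsilon>" if "\<epsilon> > 0" for \<epsilon>
  proof -
    have "\<bar>\<Sum>i\<in>UNIV. \<integral>x. partial i g x * u i x \<partial>tor\<bar> \<le> (\<Sum>i\<in>UNIV. C i) * (\<epsilon> / ((\<Sum>i\<in>UNIV. C i) + 1))"
      using C0 that by (intro le) auto
    also have "\<dots> = ((\<Sum>i\<in>UNIV. C i) / ((\<Sum>i\<in>UNIV. C i) + 1)) * \<epsilon>" by simp
    also have "\<dots> \<le> 1 * \<epsilon>" using C0 that by (intro mult_right_mono) (auto simp: divide_le_eq)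
    finally show ?thesis by simp
  qed
  then have "\<bar>\<Sum>i\<in>UNIV. \<integral>x. partial i g x * u i x \<partial>tor\<bar> \<le> 0" by (rule field_le_epsilon)
  then show ?thesis by simp
qed

section \<open>Kato bound for Sobolev functions\<close>

lemma weak_partial_rep:
  assumes f: "f \<in> L2_torus" "is_weak_partial r f g"
  and rep: "l \<in> borel_measurable borel" "AE x in lborel. f x = l x"
  obtains k where "k \<in> borel_measurable borel" "periodic k" "AE x in lborel. g x = k x"
      "integrable tor (\<lambda>x. (k x)\<^sup>2)"
    "\<And>h. h \<in> trig \<Longrightarrow> multi_partial r h \<in> trig \<Longrightarrow> (\<integral>x. h x * k x \<partial>tor) =
        (- 1) ^ multi_degree r * (\<integral>x. multi_partial r h x * l x \<partial>tor)"
proof -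
  have g: "periodic g" "g \<in> borel_measurable lebesgue" "integrable torus (\<lambda>x. (norm (g x))\<^sup>2)"
    using f(2) by (auto simp: is_weak_partial_def L2_torus_def)
  have [measurable]: "g \<in> borel_measurable lebesgue" "f \<in> borel_measurable lebesgue"
      "l \<in> borel_measurable borel" 
    using g f(1) rep by (auto simp: L2_torus_def)
  obtain k where k: "k \<in> borel_measurable borel" "periodic k" "AE x in lborel. g x = k x"
    by (rule borel_periodic_rep[OF g(2,1)])
  have [measurable]: "k \<in> borel_measurable borel" by (rule k)
  have "integrable torus (\<lambda>x. (norm (g x))\<^sup>2) \<longleftrightarrow> integrable tor (\<lambda>x. (k x)\<^sup>2)"
    by (rule integral_torus_eq(2)) (use k(3) in \<open>auto elim!: eventually_mono\<close>)
  then have k2: "integrable tor (\<lambda>x. (k x)\<^sup>2)" using g(3) by simp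
  have "(\<integral>x. h x * k x \<partial>tor) = (- 1) ^ multi_degree r * (\<integral>x. multi_partial r h x * l x \<partial>tor)"
      if h: "h \<in> trig" "multi_partial r h \<in> trig" for h
  proof -
    note [measurable] = trig_measurable[OF h(1)] trig_measurable[OF h(2)]
    have [measurable]: "h \<in> borel_measurable lebesgue" "multi_partial r h \<in> borel_measurable lebesgue"
      by (rule measurable_completion, simp)+
    have 1: "inner_L2 g h = (\<integral>x. h x * k x \<partial>tor)" unfolding inner_L2_def
      by (rule integral_torus_eq(1)) (use k(3) in \<open>auto elim!: eventually_mono\<close>)
    have 2: "inner_L2 f (multi_partial r h) = (\<integral>x. multi_partial r h x * l x \<partial>tor)"
      unfolding inner_L2_def
      by (rule integral_torus_eq(1)) (use rep(2) in \<open>auto elim!: eventually_mono\<close>)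
    have "smooth_on UNIV h" using trig_smooth[OF h(1), of "1::real"] by simp
    then show ?thesis using f(2) trig_periodic[OF h(1)] 1 2 by (simp add: is_weak_partial_def)
  qed
  with k k2 show thesis by (intro that[of k]) auto
qed

lemma multi_partial_axis: "multi_partial (axis j 1) \<psi> = partial j \<psi>"
proof -
  consider "j = 1" | "j = 2" | "j = 3" using exhaust_3 by blast
  then show ?thesis by cases (auto simp: multi_partial_def axis_def)
qed

lemma multi_degree_axis: "multi_degree (axis j 1) = 1"
  by (simp add: multi_degree_def axis_def)

lemma multi_degree_0: "multi_degree r = 0 \<longleftrightarrow> r = 0"
  by (auto simp: multi_degree_def vec_eq_iff)

lemma multi_partial_0: "multi_partial 0 \<psi> = \<psi>"
  by (simp add: multi_partial_def)

text \<open>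
  For \<open>\<tau> < 1\<close> the Gagliardo seminorm in the definition of \<open>H\<^sup>\<tau>\<close> is that of a chosen weak
  derivative of order \<open>0\<close>, which agrees with \<open>f\<close> almost everywhere.  For \<open>\<tau> \<ge> 1\<close> only the first
  weak derivatives are used.
\<close>

lemma sobolev_kato:
  assumes \<tau>: "\<tau> > 1/2" and f: "f \<in> sobolev \<tau>"
  obtains l \<alpha> C where "l \<in> borel_measurable borel" "periodic l" "AE x in lborel. f x = l x"
      "integrable tor (\<lambda>x. (l x)\<^sup>2)"
    "\<alpha> < 1" "C \<ge> 0" "\<And>x s. 0 < s \<Longrightarrow> s \<le> 1/2 \<Longrightarrow> (cube_mass l x s) \<le> ennreal (C * s powr - \<alpha>)"
proof -
  have fL2: "f \<in> L2_torus" using f by (auto simp: sobolev_def sobolev_int_def)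
  have fp: "periodic f" and [measurable]: "f \<in> borel_measurable lebesgue"
      and f2: "integrable torus (\<lambda>x. (norm (f x))\<^sup>2)"
    using fL2 by (auto simp: L2_torus_def)
  obtain l where l [measurable]: "l \<in> borel_measurable borel" and lp: "periodic l"
      and lae: "AE x in lborel. f x = l x"
    by (rule borel_periodic_rep[of f]) (use fp in auto)
  have "integrable torus (\<lambda>x. (norm (f x))\<^sup>2) \<longleftrightarrow> integrable tor (\<lambda>x. (l x)\<^sup>2)"
    by (rule integral_torus_eq(2)) (use lae in \<open>auto elim!: eventually_mono\<close>)
  then have l2: "integrable tor (\<lambda>x. (l x)\<^sup>2)" using f2 by simp
  have li: "integrable tor l" by (rule integrable_from_square[OF l l2])
  show thesis
  proof (cases "\<tau> < 1")
    case False
    then have n: "1 \<le> nat \<lfloor>\<tau>\<rfloor>" by linarith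
    have ex: "\<exists>k. k \<in> borel_measurable borel \<and> periodic k \<and> integrable tor (\<lambda>x. (k x)\<^sup>2) \<and>
        (\<forall>h\<in>trig. (\<integral>x. h x * k x \<partial>tor) = - (\<integral>x. partial j h x * l x \<partial>tor))" for j
    proof -
      have "\<forall>r. multi_degree r \<le> nat \<lfloor>\<tau>\<rfloor> \<longrightarrow> (\<exists>g. is_weak_partial r f g)"
        using f by (simp add: sobolev_def sobolev_int_def)
      then obtain g where g: "is_weak_partial (axis j 1) f g"
        using n multi_degree_axis[of j] by metis
      obtain k where "k \<in> borel_measurable borel" "periodic k" "AE x in lborel. g x = k x"
          "integrable tor (\<lambda>x. (k x)\<^sup>2)"
        and w: "\<And>h. h \<in> trig \<Longrightarrow> multi_partial (axis j 1) h \<in> trig \<Longrightarrow> (\<integral>x. h x * k x \<partial>tor) =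
            (- 1) ^ multi_degree (axis j 1) * (\<integral>x. multi_partial (axis j 1) h x * l x \<partial>tor)"
        using weak_partial_rep[OF fL2 g l lae] by blast
      moreover have "(\<integral>x. h x * k x \<partial>tor) = - (\<integral>x. partial j h x * l x \<partial>tor)" if "h \<in> trig" for h
        using w[of h, unfolded multi_partial_axis multi_degree_axis] trig_partial[OF that] that by simp
      ultimately show ?thesis by blast
    qed
    have "\<exists>k. \<forall>j. k j \<in> borel_measurable borel \<and> periodic (k j) \<and> integrable tor (\<lambda>x. (k j x)\<^sup>2) \<and>
        (\<forall>h\<in>trig. (\<integral>x. h x * k j x \<partial>tor) = - (\<integral>x. partial j h x * l x \<partial>tor))"
      by (rule choice) (rule allI, rule ex)
    then obtain k where k: "\<And>j. k j \<in> borel_measurable borel" "\<And>j. periodic (k j)"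
        "\<And>j. integrable tor (\<lambda>x. (k j x)\<^sup>2)"
        "\<And>j h. h \<in> trig \<Longrightarrow> (\<integral>x. h x * k j x \<partial>tor) = - (\<integral>x. partial j h x * l x \<partial>tor)"
      by blast
    obtain C where C: "C \<ge> 0" "\<And>x s. 0 < s \<Longrightarrow> s \<le> 1/2 \<Longrightarrow> (cube_mass l x s) \<le> ennreal (C * s powr - (1/2))"
      by (rule kato_H1[OF l lp li k]) auto
    show thesis by (rule that[OF l lp lae l2 _ C]) auto
  next
    case True
    have fl: "\<lfloor>\<tau>\<rfloor> = 0" using True \<tau> by linarith
    have frt: "frac \<tau> = \<tau>" using fl by (simp add: frac_def)
    have nint: "\<tau> \<notin> \<int>" using fl \<tau> by (auto elim!: Ints_cases)
    define g where "g = weak_partial 0 f"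
    have "\<exists>g. is_weak_partial 0 f g" using f by (auto simp: sobolev_def sobolev_int_def fl
        multi_degree_0)
    then have g: "is_weak_partial 0 f g" unfolding g_def weak_partial_def by (rule someI_ex)
    have gag: "gagliardo \<tau> g < \<infinity>" using f nint by (auto simp: sobolev_def fl frt multi_degree_0 g_def)
    obtain k where k: "k \<in> borel_measurable borel" "periodic k" "AE x in lborel. g x = k x"
        "integrable tor (\<lambda>x. (k x)\<^sup>2)"
        and w: "\<And>h. h \<in> trig \<Longrightarrow> multi_partial 0 h \<in> trig \<Longrightarrow> (\<integral>x. h x * k x \<partial>tor) =
            (- 1) ^ multi_degree 0 * (\<integral>x. multi_partial 0 h x * l x \<partial>tor)"
      using weak_partial_rep[OF fL2 g l lae] by blast
    have [measurable]: "k \<in> borel_measurable borel" by (rule k)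
    have ki: "integrable tor k" by (rule integrable_from_square[OF k(1,4)])
    have eq: "(\<integral>x. h x * k x \<partial>tor) = (\<integral>x. h x * l x \<partial>tor)" if "h \<in> trig" for h
      using w[OF that] that by (simp add: multi_partial_0 multi_degree_0[THEN iffD2])
    have "AE x in tor. k x - l x = 0"
    proof (rule AE_eq_0_if_conv_eq_0)
      show "periodic (\<lambda>x. k x - l x)" using k lp by (simp add: periodic_def)
      show "integrable tor (\<lambda>x. k x - l x)" using ki li by auto
      fix n x
      show "conv (kern n) (\<lambda>x. k x - l x) x = 0"
        unfolding conv_def right_diff_distrib
        using integrable_trig_mult[OF trig_shift[OF kern_trig] ki]
            integrable_trig_mult[OF trig_shift[OF kern_trig] li] eq[OF trig_shift[OF kern_trig, of n x]]
        by simp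
    qed measurable
    then have kl: "AE x in torus. k x = l x" by (simp add: AE_torus)
    have gl: "AE x in torus. g x = l x"
      using AE_unifI[OF k(3), of 0 1, unfolded AE_torus[symmetric]] kl by eventually_elim simp
    define N where "N = (\<lambda>p q. ennreal (\<bar>l p - l q\<bar>\<^sup>2 / torus_dist p q powr (3 + 2 * \<tau>)))"
    have "gagliardo \<tau> g = (\<integral>\<^sup>+x. \<integral>\<^sup>+y. N x y \<partial>tor \<partial>tor)"
    proof -
      have "gagliardo \<tau> g = (\<integral>\<^sup>+x. \<integral>\<^sup>+y. N x y \<partial>torus \<partial>torus)"
        unfolding gagliardo_def
      proof (rule nn_integral_cong_AE, use gl in eventually_elim)
        fix x assume x: "g x = l x"
        show "(\<integral>\<^sup>+y. ennreal (\<bar>g x - g y\<bar>\<^sup>2 / torus_dist x y powr (3 + 2 * \<tau>)) \<partial>torus) =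
            (\<integral>\<^sup>+y. N x y \<partial>torus)"
          by (rule nn_integral_cong_AE, use gl in eventually_elim) (simp add: N_def x)
      qed
      also have "\<dots> = (\<integral>\<^sup>+x. \<integral>\<^sup>+y. N x y \<partial>tor \<partial>torus)"
        by (intro nn_integral_cong nn_integral_torus) (simp add: N_def)
      also have "\<dots> = (\<integral>\<^sup>+x. \<integral>\<^sup>+y. N x y \<partial>tor \<partial>tor)"
        by (rule nn_integral_torus) (simp add: N_def)
      finally show ?thesis .
    qed
    with gag have fin: "(\<integral>\<^sup>+x. \<integral>\<^sup>+y. N x y \<partial>tor \<partial>tor) < \<infinity>" by simp
    obtain C where C: "C \<ge> 0" "\<And>x s. 0 < s \<Longrightarrow> s \<le> 1/2 \<Longrightarrow> (cube_mass l x s) \<le>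
        ennreal (C * s powr - (3/2 - \<tau>))"
      by (rule kato_gagliardo[OF l lp li \<tau> True fin[unfolded N_def]]) auto
    show thesis by (rule that[OF l lp lae l2 _ C]) (use \<tau> in auto)
  qed
qed

section \<open>The nonlinearity of a Beltrami field is a gradient\<close>

lemma cross_axis_le: "\<bar>cross3 (axis i 1) (axis j 1) $ k\<bar> \<le> 1"
proof -
  consider "i = 1" | "i = 2" | "i = 3" using exhaust_3 by blast
  then show ?thesis
    by cases (use exhaust_3[of j] exhaust_3[of k] in \<open>auto simp: cross3_def axis_def\<close>)
qed

text \<open>The curl of \<open>g c\<close> is \<open>\<nabla>g \<times> c\<close>; for \<open>c = e\<^sub>i \<times> e\<^sub>j\<close> this is \<open>e\<^sub>i \<partial>\<^sub>j g - e\<^sub>j \<partial>\<^sub>i g\<close>.\<close>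

lemma curl_scaleR: assumes "g \<in> trig"
  shows "a \<bullet> curl (\<lambda>x. g x *\<^sub>R cross3 (axis i 1) (axis j 1)) x =
      a $ i * partial j g x - a $ j * partial i g x"
proof -
  consider "i = 1" | "i = 2" | "i = 3" using exhaust_3 by blast
  then show ?thesis
    by cases (use exhaust_3[of j] in \<open>auto simp: curl_def partial_scaleR_const[OF assms] inner_vec_def
        sum_3 cross3_def axis_def\<close>)
qed

lemma curl_scaleR_component: assumes "g \<in> trig"
  shows "curl (\<lambda>x. g x *\<^sub>R cross3 (axis i 1) (axis j 1)) x $ k =
      axis k 1 $ i * partial j g x - axis k 1 $ j * partial i g x"
  using curl_scaleR[OF assms, of "axis k 1" i j x] by (simp add: inner_axis')

lemma sum_axis_pair:
  "(\<Sum>k\<in>UNIV. f k * ((axis k 1 :: real^3) $ i * a - (axis k 1 :: real^3) $ j * b)) = a * f i - b * f j"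
proof -
  consider "i = 1" | "i = 2" | "i = 3" using exhaust_3 by blast
  then show ?thesis
    by cases (use exhaust_3[of j] in \<open>auto simp: sum_3 axis_def algebra_simps\<close>)
qed

text \<open>
  The nonlinear term of the weak formulation vanishes against solenoidal modes for every field in
  the energy space that satisfies the Beltrami relation with a coefficient in \<open>H\<^sup>\<tau>\<close>, \<open>\<tau> > 1/2\<close>.
\<close>

lemma beltrami_flux_zero:
  assumes v: "v \<in> solenoidal_L2" and curl: "weak_curl v (\<lambda>x. lam x *\<^sub>R v x)"
    and \<tau>: "\<tau> > 1/2" and lam: "lam \<in> sobolev \<tau>"
    and g: "g \<in> trig" and d: "\<And>x. (\<Sum>j\<in>UNIV. partial j g x * d $ j) = 0"
  shows "inner_L2 (\<lambda>x. tensor (v x) (v x)) (grad (\<lambda>x. g x *\<^sub>R d)) = 0"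
proof -
  have vL2: "v \<in> L2_torus" using v by (simp add: solenoidal_L2_def)
  have vm [measurable]: "v \<in> borel_measurable lebesgue" using vL2 by (simp add: L2_torus_def)
  have lamm [measurable]: "lam \<in> borel_measurable lebesgue" using lam
    by (auto simp: sobolev_def sobolev_int_def L2_torus_def)
  obtain u where um [measurable]: "\<And>i. u i \<in> borel_measurable borel" and up: "\<And>i. periodic (u i)"
    and uae: "AE x in lborel. \<forall>i. v x $ i = u i x" and u2: "\<And>i. integrable tor (\<lambda>x. (u i x)\<^sup>2)"
    by (rule L2_component_rep[OF vL2]) blast
  obtain l \<alpha> C where l [measurable]: "l \<in> borel_measurable borel" and lp: "periodic l"
      and lae: "AE x in lborel. lam x = l x" and l2: "integrable tor (\<lambda>x. (l x)\<^sup>2)"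
    and \<alpha>: "\<alpha> < 1" and C: "C \<ge> 0" and kato: "\<And>x s. 0 < s \<Longrightarrow> s \<le> 1/2 \<Longrightarrow> (cube_mass l x s) \<le>
        ennreal (C * s powr - \<alpha>)"
    by (rule sobolev_kato[OF \<tau> lam]) blast
  define c where "c i j = cross3 (axis i 1) (axis j (1::real))" for i j
  \<comment> \<open>\<open>\<partial>\<^sub>i u\<^sub>j - \<partial>\<^sub>j u\<^sub>i\<close> is the component of the curl along \<open>e\<^sub>i \<times> e\<^sub>j\<close>\<close>
  define Om where "Om i j x = l x * (\<Sum>k\<in>UNIV. c i j $ k * u k x)" for i j x
  interpret B: beltrami u l Om \<alpha> C
  proof
    show "Om i j \<in> borel_measurable borel" for i j unfolding Om_def by measurable
    show "periodic (Om i j)" for i j using up lp by (simp add: Om_def periodic_def)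
    show "\<bar>Om i j x\<bar> \<le> \<bar>l x\<bar> * (\<Sum>k\<in>UNIV. \<bar>u k x\<bar>)" for i j x
      unfolding Om_def abs_mult
    proof (rule mult_left_mono)
      show "\<bar>\<Sum>k\<in>UNIV. c i j $ k * u k x\<bar> \<le> (\<Sum>k\<in>UNIV. \<bar>u k x\<bar>)"
      proof (intro order_trans[OF sum_abs] sum_mono)
        fix k
        have "\<bar>c i j $ k\<bar> * \<bar>u k x\<bar> \<le> 1 * \<bar>u k x\<bar>" unfolding c_def
          by (intro mult_right_mono cross_axis_le) auto
        then show "\<bar>c i j $ k * u k x\<bar> \<le> \<bar>u k x\<bar>" by (simp add: abs_mult)
      qed
    qed simp
    show "(\<Sum>i\<in>UNIV. u i x * Om i j x) = 0" for j x
    proof -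
      consider "j = 1" | "j = 2" | "j = 3" using exhaust_3 by blast
      then show ?thesis
        by cases (auto simp: Om_def c_def sum_3 cross3_def axis_def)
    qed
    show "(\<Sum>i\<in>UNIV. \<integral>x. partial i h x * u i x \<partial>tor) = 0" if "h \<in> trig" for h
      by (rule solenoidal_weak_div[OF v um uae u2 that])
    show "(\<integral>x. partial i h x * u j x \<partial>tor) - (\<integral>x. partial j h x * u i x \<partial>tor) =
        - (\<integral>x. h x * Om i j x \<partial>tor)" if h: "h \<in> trig" for h i j
    proof -
      note [measurable] = trig_measurable[OF h] trig_measurable[OF trig_partial[OF h]]
      have ui: "integrable tor (u k)" for k by (rule integrable_from_square[OF um u2])
      let ?\<psi> = "\<lambda>x. h x *\<^sub>R c i j"
      have "periodic ?\<psi>" using trig_periodic[OF h] by (simp add: periodic_def)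
      then have "inner_L2 (\<lambda>x. lam x *\<^sub>R v x) ?\<psi> = inner_L2 v (Defs.curl ?\<psi>)"
        using curl trig_smooth[OF h, of "c i j"] unfolding weak_curl_def by blast
      also have "inner_L2 (\<lambda>x. lam x *\<^sub>R v x) ?\<psi> =
          (\<integral>x. (\<Sum>k\<in>UNIV. (l x * u k x) * (h x * c i j $ k)) \<partial>tor)"
        by (rule inner_L2_rep) (use uae lae in \<open>auto elim: eventually_elim2\<close>)
      also have "\<dots> = (\<integral>x. h x * Om i j x \<partial>tor)"
        by (rule Bochner_Integration.integral_cong) (auto simp: Om_def sum_distrib_left mult_ac)
      also have "inner_L2 v (Defs.curl ?\<psi>) = (\<integral>x. (\<Sum>k\<in>UNIV. u k x * (axis k 1 $ i * partial j h x - axis k 1 $ j * partial i h x)) \<partial>tor)"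
        by (rule inner_L2_rep) (use uae in \<open>auto simp: c_def curl_scaleR_component[OF h]\<close>)
      also have "\<dots> = (\<integral>x. partial j h x * u i x - partial i h x * u j x \<partial>tor)"
        by (simp only: sum_axis_pair)
      also have "\<dots> = (\<integral>x. partial j h x * u i x \<partial>tor) - (\<integral>x. partial i h x * u j x \<partial>tor)"
        using integrable_trig_mult[OF trig_partial[OF h] ui] by simp
      finally show ?thesis by simp
    qed
  qed (use um up u2 l lp l2 \<alpha> C kato in auto)
  have \<phi>: "(\<lambda>x. g x * d $ j) \<in> trig" for j using trig_cmult[OF g, of "d $ j"]
    by (simp add: mult.commute)
  have pd: "partial i (\<lambda>x. g x * d $ j) x = partial i g x * d $ j" for i j x
    using partial_scaleR_const[OF g, of i "d $ j" x] by simp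
  note [measurable] = trig_measurable[OF trig_partial[OF g]]
  have [measurable]: "partial i g \<in> borel_measurable lebesgue" for i
    by (rule measurable_completion) simp
  have flux: "(\<Sum>i\<in>UNIV. \<Sum>j\<in>UNIV. \<integral>x. u i x * u j x * (partial i g x * d $ j) \<partial>tor) = 0"
    using B.flux_zero[of "\<lambda>j x. g x * d $ j", OF \<phi>] by (simp add: pd d)
  have "inner_L2 (\<lambda>x. tensor (v x) (v x)) (grad (\<lambda>x. g x *\<^sub>R d)) =
      (\<integral>x. (\<Sum>i\<in>UNIV. \<Sum>j\<in>UNIV. u i x * u j x * (partial i g x * d $ j)) \<partial>tor)"
    unfolding inner_L2_def
  proof (rule integral_torus_eq(1))
    have e: "tensor (v x) (v x) \<bullet> grad (\<lambda>x. g x *\<^sub>R d) x =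
        (\<Sum>i\<in>UNIV. \<Sum>j\<in>UNIV. v x $ i * v x $ j * (partial i g x * d $ j))" for x
      by (simp add: inner_vec_def tensor_def grad_def partial_scaleR_const[OF g])
    show "(\<lambda>x. tensor (v x) (v x) \<bullet> grad (\<lambda>x. g x *\<^sub>R d) x) \<in> borel_measurable lebesgue"
      unfolding e by measurable
    show "AE x in lborel. tensor (v x) (v x) \<bullet> grad (\<lambda>x. g x *\<^sub>R d) x =
        (\<Sum>i\<in>UNIV. \<Sum>j\<in>UNIV. u i x * u j x * (partial i g x * d $ j))"
      using uae by eventually_elim (simp add: e)
  qed measurable
  also have "\<dots> = (\<Sum>i\<in>UNIV. \<Sum>j\<in>UNIV. \<integral>x. u i x * u j x * (partial i g x * d $ j) \<partial>tor)"
  proof -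
    have "integrable tor (\<lambda>x. u i x * u j x * (partial i g x * d $ j))" for i j
    proof -
      have "integrable tor (\<lambda>x. d $ j * (partial i g x * (u i x * u j x)))"
        using integrable_trig_mult[OF trig_partial[OF g] integrable_product_from_squares[OF um um u2 u2]] by auto
      then show ?thesis by (simp add: mult_ac)
    qed
    then show ?thesis by simp
  qed
  finally show ?thesis using flux by simp
qed

section \<open>Flat cut-off functions in time\<close>

text \<open>
  The functions \<open>s\<^bsup>1-n\<^esup> exp(- \<kappa> / s)\<close>, extended by zero to \<open>s \<le> 0\<close>, and their derivatives; the
  derivatives are combinations of functions of the same form.
\<close>

definition flat :: "real \<Rightarrow> nat \<Rightarrow> real \<Rightarrow> real" where
  "flat \<kappa> n s = (if s > 0 then s * (1 / s) ^ n * exp (- \<kappa> / s) else 0)"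

definition dflat :: "real \<Rightarrow> nat \<Rightarrow> real \<Rightarrow> real" where
  "dflat \<kappa> n s = (1 - real n) * flat \<kappa> (n + 1) s + \<kappa> * flat \<kappa> (n + 2) s"

lemma power_exp_tendsto_0:
  assumes "\<kappa> > 0" shows "((\<lambda>y::real. y ^ n * exp (- \<kappa> * y)) \<longlongrightarrow> 0) at_top"
proof -
  have "((\<lambda>y. (\<kappa> * y) ^ n / exp (\<kappa> * y)) \<longlongrightarrow> 0) at_top"
    by (rule filterlim_compose[OF tendsto_power_div_exp_0])
      (use assms in \<open>auto intro: filterlim_tendsto_pos_mult_at_top[OF tendsto_const _ filterlim_ident]\<close>)
  then have "((\<lambda>y. (1 / \<kappa> ^ n) * ((\<kappa> * y) ^ n / exp (\<kappa> * y))) \<longlongrightarrow> (1 / \<kappa> ^ n) * 0) at_top"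
    by (intro tendsto_intros)
  then show ?thesis using assms by (simp add: power_mult_distrib exp_minus field_simps)
qed

lemma flat_tendsto_0: assumes "\<kappa> > 0" shows "(flat \<kappa> n \<longlongrightarrow> 0) (at_right 0)"
proof -
  have "((\<lambda>s. s * ((inverse s) ^ n * exp (- \<kappa> * inverse s))) \<longlongrightarrow> 0 * 0) (at_right (0::real))"
    by (intro tendsto_mult tendsto_ident_at filterlim_compose[OF power_exp_tendsto_0[OF assms] filterlim_inverse_at_top_right])
  then have "((\<lambda>s. s * ((inverse s) ^ n * exp (- \<kappa> * inverse s))) \<longlongrightarrow> 0) (at_right (0::real))" by simp
  then show ?thesis
    by (rule Lim_transform_eventually)
      (auto simp: flat_def inverse_eq_divide mult.assoc eventually_at_filter)
qed

lemma flat_derivative: assumes "\<kappa> > 0" shows "(flat \<kappa> n has_real_derivative dflat \<kappa> n s) (at s)"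
proof -
  consider "s > 0" | "s < 0" | "s = 0" by linarith
  then show ?thesis
  proof cases
    case 1
    have "((\<lambda>s. s * (1 / s) ^ n * exp (- \<kappa> / s)) has_real_derivative dflat \<kappa> n s) (at s)"
    proof (cases n)
      case 0
      then show ?thesis using 1
        by (auto intro!: derivative_eq_intros simp: dflat_def flat_def field_simps power2_eq_square)
    next
      case (Suc m)
      have "((\<lambda>s. s * (1 / s) ^ n * exp (- \<kappa> / s)) has_real_derivative
         (1 * (1 / s) ^ n + (real n * ((1 / s) ^ (n - 1) * (- 1 / (s * s)))) * s) * exp (- \<kappa> / s) +
             exp (- \<kappa> / s) * (\<kappa> / (s * s)) * (s * (1 / s) ^ n)) (at s)"
        using 1 by (auto intro!: derivative_eq_intros)
      moreover have "(1 * (1 / s) ^ n + (real n * ((1 / s) ^ (n - 1) * (- 1 / (s * s)))) * s) * exp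
          (- \<kappa> / s) + exp (- \<kappa> / s) * (\<kappa> / (s * s)) * (s * (1 / s) ^ n) = dflat \<kappa> n s"
        using 1 Suc by (simp add: dflat_def flat_def field_simps)
      ultimately show ?thesis by simp
    qed
    then show ?thesis
      by (rule has_field_derivative_transform_within_open[of _ _ _ "{0<..}"])
          (use 1 in \<open>auto simp: flat_def\<close>)
  next
    case 2
    have "((\<lambda>s. 0) has_real_derivative dflat \<kappa> n s) (at s)" using 2 by (simp add: dflat_def flat_def)
    then show ?thesis
      by (rule has_field_derivative_transform_within_open[of _ _ _ "{..<0}"])
          (use 2 in \<open>auto simp: flat_def\<close>)
  next
    case 3
    have "((\<lambda>h. (flat \<kappa> n (0 + h) - flat \<kappa> n 0) / h) \<longlongrightarrow> 0) (at 0)"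
    proof (rule filterlim_split_at)
      have "((\<lambda>h::real. 0::real) \<longlongrightarrow> 0) (at_left 0)" by simp
      then show "((\<lambda>h. (flat \<kappa> n (0 + h) - flat \<kappa> n 0) / h) \<longlongrightarrow> 0) (at_left 0)"
        by (rule Lim_transform_eventually) (auto simp: flat_def eventually_at_filter)
      show "((\<lambda>h. (flat \<kappa> n (0 + h) - flat \<kappa> n 0) / h) \<longlongrightarrow> 0) (at_right 0)"
        by (rule Lim_transform_eventually[OF flat_tendsto_0[OF assms, of "n + 1"]])
          (auto simp: flat_def eventually_at_filter)
    qed
    then show ?thesis using 3 by (simp add: DERIV_def dflat_def flat_def)
  qed
qed

lemma flat_continuous: "\<kappa> > 0 \<Longrightarrow> continuous_on UNIV (flat \<kappa> n)"
  by (meson DERIV_isCont continuous_at_imp_continuous_on flat_derivative)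

lemma dflat_continuous: "\<kappa> > 0 \<Longrightarrow> continuous_on UNIV (dflat \<kappa> n)"
  unfolding dflat_def[abs_def] by (intro continuous_intros flat_continuous)

text \<open>
  As \<open>\<kappa>\<close> tends to \<open>0\<close>, this derivative tends to the indicator function of \<open>s > 0\<close>, and it stays
  between \<open>0\<close> and \<open>1\<close> (\<open>dflat_0_bounds\<close>).
\<close>

lemma dflat_0: "dflat \<kappa> 0 s = (if s > 0 then (1 + \<kappa> / s) * exp (- (\<kappa> / s)) else 0)"
  by (auto simp: dflat_def flat_def field_simps power2_eq_square)

lemma dflat_0_bounds: assumes "\<kappa> > 0" shows "0 \<le> dflat \<kappa> 0 s" "dflat \<kappa> 0 s \<le> 1"
proof -
  show "0 \<le> dflat \<kappa> 0 s" using assms by (auto simp: dflat_0)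
  have "(1 + z) * exp (- z) \<le> exp z * exp (- z)" for z :: real
    by (intro mult_right_mono exp_ge_add_one_self) auto
  then show "dflat \<kappa> 0 s \<le> 1" by (auto simp: dflat_0 exp_minus)
qed

section \<open>Test functions with separated variables\<close>

text \<open>
  Sums of products of a flat function of \<open>a - t\<close>, a trigonometric polynomial in space and a fixed
  vector.
\<close>

inductive_set separated :: "real \<Rightarrow> real \<Rightarrow> real^3 \<Rightarrow> (real \<times> (real^3) \<Rightarrow> real^3) set" for a \<kappa> d where
  sep_prod: "h \<in> trig \<Longrightarrow> (\<lambda>p. (flat \<kappa> n (a - fst p) * h (snd p)) *\<^sub>R d) \<in> separated a \<kappa> d"
| sep_add: "f \<in> separated a \<kappa> d \<Longrightarrow> g \<in> separated a \<kappa> d \<Longrightarrow> (\<lambda>p. f p + g p) \<in> separated a \<kappa> d"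

lemma separated_derivative:
  assumes "\<kappa> > 0" and "f \<in> separated a \<kappa> d"
  shows "\<exists>f'. (\<forall>p. (f has_derivative f' p) (at p within S)) \<and> (\<forall>v. (\<lambda>p. f' p v) \<in> separated a \<kappa> d)"
  using assms(2)
proof (induction rule: separated.induct)
  case (sep_prod h n)
  define f' where "f' p v = (flat \<kappa> n (a - fst p) * (\<Sum>i\<in>UNIV. partial i h (snd p) * snd v $ i) - dflat \<kappa>
      n (a - fst p) * fst v * h (snd p)) *\<^sub>R d" for p v :: "real \<times> (real^3)"
  have der: "((\<lambda>p. (flat \<kappa> n (a - fst p) * h (snd p)) *\<^sub>R d) has_derivative f' p) (at p within S)" for p
  proof -
    have 1: "((\<lambda>p::real \<times> (real^3). flat \<kappa> n (a - fst p)) has_derivative (\<lambda>v. dflat \<kappa> n (a - fst p) * (- fst v))) (at p within S)"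
    proof (rule has_derivative_compose[of "\<lambda>p. a - fst p" "\<lambda>v. - fst v" p S "flat \<kappa> n"])
      show "((\<lambda>p::real \<times> (real^3). a - fst p) has_derivative (\<lambda>v. - fst v)) (at p within S)"
        by (auto intro!: derivative_eq_intros)
      show "(flat \<kappa> n has_derivative (*) (dflat \<kappa> n (a - fst p))) (at (a - fst p))"
        using flat_derivative[OF assms(1)] by (simp add: has_field_derivative_def)
    qed
    have 2: "((\<lambda>p::real \<times> (real^3). h (snd p)) has_derivative (\<lambda>v. \<Sum>i\<in>UNIV. partial i h (snd p) * snd v $ i)) (at p within S)"
      by (rule has_derivative_compose[of snd snd p S h, OF _ c1_gradD[OF trig_c1_grad[OF sep_prod]]])
        (auto intro!: derivative_eq_intros)
    show ?thesis
      by (rule has_derivative_eq_rhs[OF has_derivative_scaleR_left[OF has_derivative_mult[OF 1 2]]])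
        (auto simp: f'_def fun_eq_iff algebra_simps)
  qed
  have "(\<lambda>p. f' p v) \<in> separated a \<kappa> d" for v
  proof -
    define h1 where "h1 x = (\<Sum>i\<in>UNIV. partial i h x * snd v $ i)" for x
    have h1: "h1 \<in> trig"
    proof -
      have "(\<lambda>x. partial i h x * snd v $ i) \<in> trig" for i
        using trig_cmult[OF trig_partial[OF sep_prod], of "snd v $ i" i] by (simp add: mult.commute)
      then show ?thesis unfolding h1_def[abs_def] sum_3 by (intro trig_add)
    qed
    have h2: "(\<lambda>x. - ((1 - real n) * fst v) * h x) \<in> trig" "(\<lambda>x. - (\<kappa> * fst v) * h x) \<in> trig" 
      by (intro trig_cmult sep_prod)+
    have "(\<lambda>p. f' p v) = (\<lambda>p. (flat \<kappa> n (a - fst p) * h1 (snd p)) *\<^sub>R d + 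
       ((flat \<kappa> (n + 1) (a - fst p) * (- ((1 - real n) * fst v) * h (snd p))) *\<^sub>R d +
           (flat \<kappa> (n + 2) (a - fst p) * (- (\<kappa> * fst v) * h (snd p))) *\<^sub>R d))"
      by (auto simp: f'_def h1_def dflat_def fun_eq_iff algebra_simps)
    also have "\<dots> \<in> separated a \<kappa> d" by (intro separated.sep_add separated.sep_prod[OF h1]
        separated.sep_prod[OF h2(1)] separated.sep_prod[OF h2(2)])
    finally show ?thesis .
  qed
  with der show ?case by (intro exI[of _ f']) auto
next
  case (sep_add f g)
  then obtain f' g' where "\<forall>p. (f has_derivative f' p) (at p within S)"
      "\<forall>v. (\<lambda>p. f' p v) \<in> separated a \<kappa> d"
    "\<forall>p. (g has_derivative g' p) (at p within S)" "\<forall>v. (\<lambda>p. g' p v) \<in> separated a \<kappa> d" by blast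
  then show ?case
    by (intro exI[of _ "\<lambda>p v. f' p v + g' p v"]) (auto intro: has_derivative_add separated.sep_add)
qed

text \<open>Derivatives within \<open>[0,T) \<times> \<real>\<^sup>3\<close> are unique, also at time \<open>0\<close>.\<close>

lemma derivative_unique_within_slab:
  fixes f :: "real \<times> (real^3) \<Rightarrow> 'b::real_normed_vector"
  assumes T: "0 < T" and p: "p \<in> {0..<T} \<times> UNIV"
    and f: "(f has_derivative f') (at p within {0..<T} \<times> UNIV)"
        "(f has_derivative f'') (at p within {0..<T} \<times> UNIV)"
  shows "f' = f''"
proof (rule frechet_derivative_unique_within[OF f])
  fix i :: "real \<times> (real^3)" and e :: real assume i: "i \<in> Basis" and e: "e > 0"
  obtain t x where p': "p = (t, x)" "0 \<le> t" "t < T" using p by auto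
  consider "i = (1, 0)" | b where "i = (0, b)" using i by (auto simp: Basis_prod_def)
  then show "\<exists>d. 0 < \<bar>d\<bar> \<and> \<bar>d\<bar> < e \<and> p + d *\<^sub>R i \<in> {0..<T} \<times> UNIV"
  proof cases
    case 1
    define r where "r = min (e / 2) ((T - t) / 2)"
    have "r \<le> e / 2" "r \<le> (T - t) / 2" by (simp_all only: r_def min.cobounded1 min.cobounded2)
    moreover have "0 < r" using e p' by (simp add: r_def)
    ultimately have "0 < r" "r < e" "t + r < T" using e p'(3) by (auto simp: field_simps)
    then show ?thesis using 1 p' by (intro exI[of _ r]) auto
  next
    case 2
    then show ?thesis using e p' by (intro exI[of _ "e / 2"]) auto
  qed
qed

lemma separated_test_function:
  assumes T: "0 < T" and a: "0 < a" "a < T" and \<kappa>: "\<kappa> > 0" and g: "g \<in> trig"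
      and d: "\<And>x. (\<Sum>j\<in>UNIV. partial j g x * d $ j) = 0"
  shows "(\<lambda>t x. (flat \<kappa> 0 (a - t) * g x) *\<^sub>R d) \<in> euler_test_functions T"
  unfolding euler_test_functions_def
proof (intro CollectI conjI ballI allI)
  have "smooth_on ({0..<T} \<times> UNIV) (\<lambda>p. (flat \<kappa> 0 (a - fst p) * g (snd p)) *\<^sub>R d)"
  proof (rule smooth_on_coinduct[of "separated a \<kappa> d"])
    fix f assume "f \<in> separated a \<kappa> d"
    from separated_derivative[OF \<kappa> this, of "{0..<T} \<times> UNIV"]
    show "\<exists>f'. (\<forall>p\<in>{0..<T} \<times> UNIV. (f has_derivative f' p) (at p within {0..<T} \<times> UNIV)) \<and>
        (\<forall>v. (\<lambda>p. f' p v) \<in> separated a \<kappa> d)"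
      by blast
  next
    show "(\<lambda>p. (flat \<kappa> 0 (a - fst p) * g (snd p)) *\<^sub>R d) \<in> separated a \<kappa> d"
      by (rule separated.sep_prod[OF g])
  qed (rule derivative_unique_within_slab[OF T])
  then show "smooth_on ({0..<T} \<times> UNIV) (\<lambda>(t, x). (flat \<kappa> 0 (a - t) * g x) *\<^sub>R d)"
    by (simp add: case_prod_beta')
  show "periodic (\<lambda>x. (flat \<kappa> 0 (a - t) * g x) *\<^sub>R d)" for t using trig_periodic[OF g]
    by (simp add: periodic_def)
  show "\<exists>T'<T. \<forall>t\<in>{0..<T}. T' \<le> t \<longrightarrow> (\<forall>x. (flat \<kappa> 0 (a - t) * g x) *\<^sub>R d = 0)"
    using a by (intro exI[of _ a]) (auto simp: flat_def)
  show "divergence (\<lambda>x. (flat \<kappa> 0 (a - t) * g x) *\<^sub>R d) x = 0" for t x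
  proof -
    have c: "partial i (\<lambda>x. flat \<kappa> 0 (a - t) * g x) x = flat \<kappa> 0 (a - t) * partial i g x" for i
      by (rule c1_grad_partial[OF c1_grad_cmult[OF trig_c1_grad[OF g]]])
    show ?thesis
      using d[of x] by (simp add: divergence_def partial_scaleR_const[OF trig_cmult[OF g]] c mult.assoc
          sum_distrib_left[symmetric])
  qed
qed

section \<open>Vanishing of a function of time with vanishing primitive\<close>

text \<open>
  The positive and the negative part of \<open>f\<close> are densities of finite measures that agree on all
  half-lines.
\<close>

lemma AE_zero_from_primitive:
  fixes f :: "real \<Rightarrow> real"
  assumes i: "integrable lborel f" and z: "\<And>a. (\<integral>t. f t * indicator {..<a} t \<partial>lborel) = 0"
      and tot: "(\<integral>t. f t \<partial>lborel) = 0"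
  shows "AE t in lborel. f t = 0"
proof -
  have [measurable]: "f \<in> borel_measurable borel" using borel_measurable_integrable[OF i] by simp
  define p where "p t = ennreal (f t)" for t
  define q where "q t = ennreal (- f t)" for t
  have [measurable]: "p \<in> borel_measurable borel" "q \<in> borel_measurable borel" unfolding p_def q_def
    by measurable
  have pf: "integral\<^sup>N lborel p < \<infinity>" and qf: "integral\<^sup>N lborel q < \<infinity>"
    using i unfolding p_def q_def by (auto simp: real_integrable_def less_top)
  have "density lborel p = density lborel q"
  proof (rule measure_eqI_lessThan)
    fix x :: real
    have em: "emeasure (density lborel r) {x<..} = (\<integral>\<^sup>+t. r t * indicator {x<..} t \<partial>lborel)"
        if [measurable]: "r \<in> borel_measurable borel" for r
      by (rule emeasure_density) auto
    have "emeasure (density lborel p) {x<..} \<le> integral\<^sup>N lborel p" 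
      by (subst em) (auto intro!: nn_integral_mono simp: indicator_def)
    then show "emeasure (density lborel p) {x<..} < \<infinity>" using pf by (rule le_less_trans)
    have ig: "integrable lborel (\<lambda>t. f t * indicator {x<..} t)"
      using integrable_real_mult_indicator[of "{x<..}" lborel f] i by (simp add: mult.commute)
    have il: "integrable lborel (\<lambda>t. f t * indicator {..<x} t)"
      using integrable_real_mult_indicator[of "{..<x}" lborel f] i by (simp add: mult.commute)
    have "(\<integral>t. f t \<partial>lborel) = (\<integral>t. f t * indicator {x<..} t + f t * indicator {..<x} t \<partial>lborel)"
    proof (rule integral_cong_AE)
      show "AE t in lborel. f t = f t * indicator {x<..} t + f t * indicator {..<x} t"
        using AE_lborel_singleton[of x] by eventually_elim (auto simp: indicator_def)
    qed auto
    also have "\<dots> = (\<integral>t. f t * indicator {x<..} t \<partial>lborel) + 0" using ig il z[of x] by simp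
    finally have zero: "(\<integral>t. f t * indicator {x<..} t \<partial>lborel) = 0" using tot by simp
    have "(\<integral>t. f t * indicator {x<..} t \<partial>lborel) =
        enn2real (\<integral>\<^sup>+t. ennreal (f t * indicator {x<..} t) \<partial>lborel) - enn2real
        (\<integral>\<^sup>+t. ennreal (- (f t * indicator {x<..} t)) \<partial>lborel)"
      by (rule real_lebesgue_integral_def[OF ig])
    moreover have "(\<integral>\<^sup>+t. ennreal (f t * indicator {x<..} t) \<partial>lborel) =
        (\<integral>\<^sup>+t. p t * indicator {x<..} t \<partial>lborel)"
      by (rule nn_integral_cong) (auto simp: p_def indicator_def)
    moreover have "(\<integral>\<^sup>+t. ennreal (- (f t * indicator {x<..} t)) \<partial>lborel) =
        (\<integral>\<^sup>+t. q t * indicator {x<..} t \<partial>lborel)"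
      by (rule nn_integral_cong) (auto simp: q_def indicator_def)
    ultimately have "enn2real (\<integral>\<^sup>+t. p t * indicator {x<..} t \<partial>lborel) =
        enn2real (\<integral>\<^sup>+t. q t * indicator {x<..} t \<partial>lborel)" using zero by simp
    moreover have "(\<integral>\<^sup>+t. p t * indicator {x<..} t \<partial>lborel) < \<infinity>"
      by (rule le_less_trans[OF _ pf]) (auto intro!: nn_integral_mono simp: indicator_def)
    moreover have "(\<integral>\<^sup>+t. q t * indicator {x<..} t \<partial>lborel) < \<infinity>"
      by (rule le_less_trans[OF _ qf]) (auto intro!: nn_integral_mono simp: indicator_def)
    ultimately show "emeasure (density lborel p) {x<..} = emeasure (density lborel q) {x<..}"
      by (simp add: em) (metis ennreal_enn2real_if less_irrefl infinity_ennreal_def)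
  qed auto
  then have "AE t in lborel. p t = q t"
    by (subst (asm) finite_density_unique) (use pf in auto)
  then show ?thesis
  proof eventually_elim
    case (elim t)
    then show ?case unfolding p_def q_def by (cases "f t" "0::real" rule: linorder_cases)
        (auto simp: ennreal_neg ennreal_eq_0_iff)
  qed
qed

text \<open>For \<open>\<kappa>\<close> tending to \<open>0\<close> the weights tend to the indicator function of \<open>t < a\<close>.\<close>

lemma AE_zero_from_flat_tests:
  fixes f :: "real \<Rightarrow> real"
  assumes [measurable]: "f \<in> borel_measurable borel" and out: "\<And>t. t \<notin> {0<..<T} \<Longrightarrow> f t = 0"
      and bd: "AE t in lborel. \<bar>f t\<bar> \<le> K" and T: "0 < T"
    and z: "\<And>a \<kappa>. 0 < a \<Longrightarrow> a < T \<Longrightarrow> \<kappa> > 0 \<Longrightarrow> (\<integral>t. dflat \<kappa> 0 (a - t) * f t \<partial>lborel) = 0"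
  shows "AE t in lborel. f t = 0"
proof -
  have iK: "integrable lborel (\<lambda>t. \<bar>K\<bar> * indicator {0<..<T} t)" using T
    by (intro integrable_mult_right integrable_real_indicator) auto
  have i: "integrable lborel f"
  proof (rule Bochner_Integration.integrable_bound[OF iK])
    show "AE t in lborel. norm (f t) \<le> norm (\<bar>K\<bar> * indicator {0<..<T} t)"
      using bd by eventually_elim (use out in \<open>auto simp: indicator_def\<close>)
  qed simp
  have mid: "(\<integral>t. f t * indicator {..<a} t \<partial>lborel) = 0" if a: "0 < a" "a < T" for a
  proof -
    define \<kappa> where "\<kappa> n = inverse (real (Suc n))" for n
    have \<kappa>0: "\<kappa> n > 0" for n by (simp add: \<kappa>_def)
    have \<kappa>l: "\<kappa> \<longlonglongrightarrow> 0" unfolding \<kappa>_def by (rule LIMSEQ_inverse_real_of_nat)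
    have "(\<lambda>n. \<integral>t. dflat (\<kappa> n) 0 (a - t) * f t \<partial>lborel) \<longlonglongrightarrow> (\<integral>t. f t * indicator {..<a} t \<partial>lborel)"
    proof (rule integral_dominated_convergence[OF _ _ integrable_abs[OF i]])
      have [measurable]: "dflat (\<kappa> n) 0 \<in> borel_measurable borel" for n
        by (rule borel_measurable_continuous_onI[OF dflat_continuous[OF \<kappa>0]])
      show "(\<lambda>t. dflat (\<kappa> n) 0 (a - t) * f t) \<in> borel_measurable lborel" for n by measurable
      show "AE t in lborel. (\<lambda>n. dflat (\<kappa> n) 0 (a - t) * f t) \<longlonglongrightarrow> f t * indicator {..<a} t"
      proof (rule AE_I2)
        fix t
        show "(\<lambda>n. dflat (\<kappa> n) 0 (a - t) * f t) \<longlonglongrightarrow> f t * indicator {..<a} t"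
        proof (cases "t < a")
          case True
          have "(\<lambda>n. (1 + \<kappa> n / (a - t)) * exp (- (\<kappa> n / (a - t))) * f t) \<longlonglongrightarrow>
              (1 + 0 / (a - t)) * exp (- (0 / (a - t))) * f t"
            using True by (intro tendsto_intros \<kappa>l) auto
          then show ?thesis using True by (simp add: dflat_0)
        qed (simp add: dflat_0)
      qed
      show "AE t in lborel. norm (dflat (\<kappa> n) 0 (a - t) * f t) \<le> \<bar>f t\<bar>" for n
        using dflat_0_bounds[OF \<kappa>0, of n] by (auto intro!: AE_I2 mult_left_le_one_le simp: abs_mult)
    qed simp
    then show ?thesis using z[OF a \<kappa>0] by (simp add: LIMSEQ_const_iff)
  qed
  have tot: "(\<integral>t. f t \<partial>lborel) = 0"
  proof -
    define a where "a n = T - T / real (n + 2)" for n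
    have a: "0 < a n" "a n < T" for n 
    proof -
      have "T * 1 < T * real (n + 2)" using T by (intro mult_strict_left_mono) auto
      then show "0 < a n" using T by (simp add: a_def divide_less_eq)
      show "a n < T" using T by (simp add: a_def)
    qed
    have "(\<lambda>n. \<integral>t. f t * indicator {..<a n} t \<partial>lborel) \<longlonglongrightarrow> (\<integral>t. f t \<partial>lborel)"
    proof (rule integral_dominated_convergence[OF _ _ integrable_abs[OF i]])
      show "AE t in lborel. (\<lambda>n. f t * indicator {..<a n} t) \<longlonglongrightarrow> f t"
      proof (rule AE_I2)
        fix t
        show "(\<lambda>n. f t * indicator {..<a n} t) \<longlonglongrightarrow> f t"
        proof (cases "t < T")
          case True
          have "a \<longlonglongrightarrow> T - 0" unfolding a_def
            by (intro tendsto_diff tendsto_const LIMSEQ_ignore_initial_segment[of "\<lambda>n. T / real n"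
                0 2] lim_const_over_n)
          then have "eventually (\<lambda>n. t < a n) sequentially" using True by (intro order_tendstoD) auto
          then have "eventually (\<lambda>n. f t * indicator {..<a n} t = f t) sequentially"
            by eventually_elim auto
          then show ?thesis by (rule tendsto_eventually)
        next
          case False then show ?thesis using out[of t] by simp
        qed
      qed
    qed (auto simp: indicator_def)
    then show ?thesis using mid[OF a] by (simp add: LIMSEQ_const_iff)
  qed
  show ?thesis
  proof (rule AE_zero_from_primitive[OF i _ tot])
    fix a :: real
    consider "a \<le> 0" | "0 < a" "a < T" | "T \<le> a" by linarith
    then show "(\<integral>t. f t * indicator {..<a} t \<partial>lborel) = 0"
    proof cases
      case 1
      then have "(\<lambda>t. f t * indicator {..<a} t) = (\<lambda>t. 0)" using out
        by (auto simp: fun_eq_iff indicator_def)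
      then show ?thesis by simp
    next
      case 2 then show ?thesis by (rule mid)
    next
      case 3
      then have "(\<lambda>t. f t * indicator {..<a} t) = f" using out by (auto simp: fun_eq_iff indicator_def)
      then show ?thesis using tot by simp
    qed
  qed
qed

section \<open>The momentum of every mode is constant in time\<close>

lemma integral_lebesgue_on_eq:
  fixes G G' :: "real \<Rightarrow> real"
  assumes S: "S \<in> sets borel" and [measurable]: "G' \<in> borel_measurable borel"
      and ae: "AE t in lebesgue_on S. G t = G' t"
  shows "(LINT t|lebesgue_on S. G t) = (\<integral>t. indicator S t * G' t \<partial>lborel)"
proof -
  have Sl: "S \<inter> space lebesgue \<in> sets lebesgue" using S by simp
  have [measurable]: "S \<in> sets borel" by (rule S)
  have m': "(\<lambda>t. indicator S t * G' t) \<in> borel_measurable lebesgue" by (rule measurable_completion) simp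
  have ae': "AE t in lebesgue. indicator S t * G' t = indicator S t * G t"
    using ae unfolding AE_restrict_space_iff[OF Sl] by eventually_elim (auto simp: indicator_def)
  have m: "(\<lambda>t. indicator S t * G t) \<in> borel_measurable lebesgue"
    by (rule borel_measurable_AE[OF m' ae'])
  have "(LINT t|lebesgue_on S. G t) = (LINT t|lebesgue. indicator S t * G t)"
    by (subst integral_restrict_space[OF Sl]) simp
  also have "\<dots> = (LINT t|lebesgue. indicator S t * G' t)"
    using ae' by (intro integral_cong_AE m m') (auto elim: eventually_mono)
  also have "\<dots> = (\<integral>t. indicator S t * G' t \<partial>lborel)" by (rule integral_completion) simp
  finally show ?thesis .
qed

lemma inner_L2_scaleR_right: "inner_L2 v (\<lambda>x. (c * g x) *\<^sub>R d) = c * inner_L2 v (\<lambda>x. g x *\<^sub>R d)"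
  unfolding inner_L2_def by (subst integral_mult_right_zero[symmetric]) (simp add: mult.assoc)

text \<open>
  The weak formulation with the test function \<open>flat \<kappa> 0 (a - t) g(x) d\<close> says that
  \<open>F(t) - F\<^sub>0\<close> integrates to zero against \<open>dflat \<kappa> 0 (a - t)\<close>, where \<open>F\<close> is the coefficient of \<open>u(t)\<close>
  along the mode \<open>g d\<close>.  Measurability of \<open>F\<close> comes from a Borel representative of \<open>u\<close> in
  space-time.
\<close>

lemma modes_constant:
  fixes u :: "real \<Rightarrow> real^3 \<Rightarrow> real^3"
  assumes T: "0 < T" and weak: "weak_euler_solution T u\<^sub>0 u"
    and flux: "AE t in lebesgue_on {0<..<T}. \<forall>g\<in>trig. \<forall>d. (\<forall>x. (\<Sum>j\<in>UNIV. partial j g x * d $ j) = 0) \<longrightarrow>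
                 inner_L2 (\<lambda>x. tensor (u t x) (u t x)) (grad (\<lambda>x. g x *\<^sub>R d)) = 0"
    and g: "g \<in> trig" and d: "\<And>x. (\<Sum>j\<in>UNIV. partial j g x * d $ j) = 0"
  shows "AE t in lebesgue_on {0<..<T}. inner_L2 (u t) (\<lambda>x. g x *\<^sub>R d) = inner_L2 u\<^sub>0 (\<lambda>x. g x *\<^sub>R d)"
proof -
  let ?I = "{0<..<T}"
  have Il: "?I \<inter> space lebesgue \<in> sets lebesgue" by simp
  note [measurable] = trig_measurable[OF g]
  have bl: "u \<in> bochner_Linf T solenoidal_L2 norm_L2" using weak by (simp add: weak_euler_solution_def)
  have meas: "(\<lambda>(t, x). u t x) \<in> borel_measurable (lebesgue_on (?I \<times> UNIV))"
    using bl by (simp add: bochner_Linf_def measurable_space_time_def)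
  have sol: "AE t in lborel. t \<in> ?I \<longrightarrow> u t \<in> solenoidal_L2"
    using bl unfolding bochner_Linf_def AE_restrict_space_iff[OF Il] AE_completion_iff by blast
  obtain C where C: "AE t in lborel. t \<in> ?I \<longrightarrow> norm_L2 (u t) \<le> C"
    using bl unfolding bochner_Linf_def AE_restrict_space_iff[OF Il] AE_completion_iff by blast
  have ex: "\<exists>h. h \<in> borel_measurable borel \<and> (AE p in lborel. (if p \<in> ?I \<times> UNIV then u (fst p) (snd p) $ i else 0) = h p)" for i
  proof -
    have "(\<lambda>p. u (fst p) (snd p) $ i) \<in> borel_measurable (lebesgue_on (?I \<times> UNIV))"
      using measurable_vec_nth[OF meas, of i] by (simp add: case_prod_beta')
    then have "(\<lambda>p. if p \<in> ?I \<times> UNIV then u (fst p) (snd p) $ i else 0) \<in> borel_measurable lebesgue"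
      by (subst borel_measurable_if) (auto intro!: lborelD borel_open open_Times)
    from completion_ex_borel_measurable_real[OF this] show ?thesis
      unfolding measurable_lborel2 Bex_def .
  qed
  have "\<exists>h. \<forall>i. h i \<in> borel_measurable borel \<and>
      (AE p in lborel. (if p \<in> ?I \<times> UNIV then u (fst p) (snd p) $ i else 0) = h i p)"
    by (rule choice) (rule allI, rule ex)
  then obtain h where hm: "\<And>i. h i \<in> borel_measurable borel"
      and hae: "\<And>i. AE p in lborel. (if p \<in> ?I \<times> UNIV then u (fst p) (snd p) $ i else 0) = h i p"
    by blast
  have [measurable]: "h i \<in> borel_measurable (borel \<Otimes>\<^sub>M borel)" for i using hm[of i]
    by (simp add: borel_prod)
  have slices: "AE t in lborel. t \<in> ?I \<longrightarrow> (AE x in lborel. \<forall>i. u t x $ i = h i (t, x))"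
  proof -
    have "AE p in lborel \<Otimes>\<^sub>M lborel. \<forall>i. (if p \<in> ?I \<times> UNIV then u (fst p) (snd p) $ i else 0) = h i p"
      unfolding lborel_prod using hae by (simp add: AE_all_countable)
    from lborel_pair.AE_pair[OF this]
    show ?thesis
    proof eventually_elim
      case (elim t)
      show ?case
      proof
        assume "t \<in> ?I"
        then show "AE x in lborel. \<forall>i. u t x $ i = h i (t, x)" using elim
          by (auto elim!: eventually_mono)
      qed
    qed
  qed
  define F where "F t = (\<integral>x. (\<Sum>i\<in>UNIV. h i (t, x) * (g x * d $ i)) \<partial>tor)" for t
  have Fm [measurable]: "F \<in> borel_measurable borel" unfolding F_def by measurable
  have Feq: "AE t in lborel. t \<in> ?I \<longrightarrow> inner_L2 (u t) (\<lambda>x. g x *\<^sub>R d) = F t"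
    using slices sol
  proof eventually_elim
    case (elim t)
    show ?case
    proof
      assume t: "t \<in> ?I"
      have "u t \<in> borel_measurable lebesgue" using elim t by (auto simp: solenoidal_L2_def L2_torus_def)
      then show "inner_L2 (u t) (\<lambda>x. g x *\<^sub>R d) = F t" unfolding F_def
        by (rule inner_L2_rep) (use elim t in auto)
    qed
  qed
  define F0 where "F0 = inner_L2 u\<^sub>0 (\<lambda>x. g x *\<^sub>R d)"
  obtain K where K: "K \<ge> 0" "\<And>x. \<bar>g x\<bar> \<le> K"
    using periodic_continuous_bounded[OF trig_cont[OF g] trig_periodic[OF g]] by metis
  have Fb: "AE t in lborel. t \<in> ?I \<longrightarrow> \<bar>F t\<bar> \<le> K * norm d * (1 + C\<^sup>2)"
    using Feq sol C
  proof eventually_elim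
    case (elim t)
    show ?case
    proof
      assume t: "t \<in> ?I"
      have L2: "u t \<in> L2_torus" using elim t by (simp add: solenoidal_L2_def)
      have m [measurable]: "u t \<in> borel_measurable lebesgue"
          and i2: "integrable torus (\<lambda>x. (norm (u t x))\<^sup>2)"
        using L2 by (auto simp: L2_torus_def)
      have i1: "integrable torus (\<lambda>x. 1::real)"
        by (subst integral_torus_borel(2)) (auto intro: integrable_unif_bounded[of _ _ _ 1])
      have one: "(LINT x|torus. 1::real) = 1"
        by (subst integral_torus_borel(1)) (auto simp: measure_def)
      have pt: "\<bar>u t x \<bullet> (g x *\<^sub>R d)\<bar> \<le> K * norm d * (1 + (norm (u t x))\<^sup>2)" for x
      proof -
        have "\<bar>u t x \<bullet> (g x *\<^sub>R d)\<bar> \<le> norm (u t x) * norm (g x *\<^sub>R d)" by (rule Cauchy_Schwarz_ineq2)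
        also have "\<dots> = norm (u t x) * (\<bar>g x\<bar> * norm d)" by simp
        also have "\<dots> \<le> (1 + (norm (u t x))\<^sup>2) * (K * norm d)"
        proof (intro mult_mono K(2))
          have "0 \<le> (norm (u t x) - 1)\<^sup>2" by simp
          then have "2 * norm (u t x) \<le> 1 + (norm (u t x))\<^sup>2"
            by (simp add: power2_eq_square algebra_simps)
          then show "norm (u t x) \<le> 1 + (norm (u t x))\<^sup>2" using norm_ge_zero[of "u t x"] by linarith
        qed (auto simp: K)
        finally show ?thesis by (simp add: mult_ac)
      qed
      have [measurable]: "g \<in> borel_measurable lebesgue" by (rule measurable_completion) simp
      have mi: "(\<lambda>x. u t x \<bullet> (g x *\<^sub>R d)) \<in> borel_measurable torus"
        unfolding torus_def by (rule measurable_restrict_space1) measurable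
      have ib: "integrable torus (\<lambda>x. K * norm d * (1 + (norm (u t x))\<^sup>2))" using i1 i2 by auto
      have ii: "integrable torus (\<lambda>x. u t x \<bullet> (g x *\<^sub>R d))"
        by (rule Bochner_Integration.integrable_bound[OF ib mi])
            (use pt K in \<open>auto intro!: AE_I2 order_trans[OF pt]\<close>)
      have "\<bar>inner_L2 (u t) (\<lambda>x. g x *\<^sub>R d)\<bar> \<le> (LINT x|torus. \<bar>u t x \<bullet> (g x *\<^sub>R d)\<bar>)"
        unfolding inner_L2_def by (rule integral_abs_bound)
      also have "\<dots> \<le> (LINT x|torus. K * norm d * (1 + (norm (u t x))\<^sup>2))"
        by (rule integral_mono[OF integrable_abs[OF ii] ib pt])
      also have "\<dots> = K * norm d * (1 + (norm_L2 (u t))\<^sup>2)"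
      proof -
        have "(LINT x|torus. 1 + (norm (u t x))\<^sup>2) = 1 + (LINT x|torus. (norm (u t x))\<^sup>2)"
          using Bochner_Integration.integral_add[OF i1 i2] unfolding one .
        then show ?thesis by (simp add: norm_L2_def)
      qed
      also have "\<dots> \<le> K * norm d * (1 + C\<^sup>2)"
        using elim t K by (intro mult_left_mono add_left_mono power_mono) (auto simp: norm_L2_def)
      finally show "\<bar>F t\<bar> \<le> K * norm d * (1 + C\<^sup>2)" using elim t by simp
    qed
  qed
  define B where "B = K * norm d * (1 + C\<^sup>2)"
  define f where "f t = indicator ?I t * (F t - F0)" for t
  have [measurable]: "f \<in> borel_measurable borel" unfolding f_def by measurable
  have "AE t in lborel. f t = 0"
  proof (rule AE_zero_from_flat_tests[OF _ _ _ T])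
    show "f \<in> borel_measurable borel" by measurable
    show "f t = 0" if "t \<notin> ?I" for t using that by (simp add: f_def)
    show "AE t in lborel. \<bar>f t\<bar> \<le> B + \<bar>F0\<bar>"
      using Fb
    proof eventually_elim
      case (elim t)
      have "0 \<le> B" unfolding B_def using K by simp
      then show ?case using elim by (auto simp: f_def indicator_def B_def)
    qed
    fix a \<kappa> :: real assume a: "0 < a" "a < T" and \<kappa>: "\<kappa> > 0"
    define b where "b t = dflat \<kappa> 0 (a - t)" for t
    have bc: "continuous_on UNIV b" unfolding b_def
      by (intro continuous_on_compose2[OF dflat_continuous[OF \<kappa>]] continuous_intros) auto
    have [measurable]: "b \<in> borel_measurable borel" by (rule borel_measurable_continuous_onI[OF bc])
    have bb: "0 \<le> b t" "b t \<le> 1" for t using dflat_0_bounds[OF \<kappa>] by (auto simp: b_def)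
    define \<phi> where "\<phi> t x = (flat \<kappa> 0 (a - t) * g x) *\<^sub>R d" for t x
    have "\<phi> \<in> euler_test_functions T"
      using separated_test_function[OF T a \<kappa> g d] by (simp add: \<phi>_def[abs_def])
    then have eq: "(LINT t|lebesgue_on ?I. inner_L2 (u t) (\<lambda>x. vector_derivative (\<lambda>s. \<phi> s x) (at t)) +
            inner_L2 (\<lambda>x. tensor (u t x) (u t x)) (grad (\<phi> t))) = - inner_L2 u\<^sub>0 (\<phi> 0)"
      using weak unfolding weak_euler_solution_def by blast
    have vd: "vector_derivative (\<lambda>s. \<phi> s x) (at t) = (- b t * g x) *\<^sub>R d" for t x
    proof (rule vector_derivative_at)
      have 1: "((\<lambda>s. flat \<kappa> 0 (a - s)) has_real_derivative dflat \<kappa> 0 (a - t) * (0 - 1)) (at t)"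
        by (rule DERIV_chain2[OF flat_derivative[OF \<kappa>]]) (auto intro!: derivative_eq_intros)
      have "((\<lambda>s. flat \<kappa> 0 (a - s) * g x) has_real_derivative - b t * g x) (at t)"
        using DERIV_cmult_right[OF 1, of "g x"] by (simp add: b_def)
      then show "((\<lambda>s. \<phi> s x) has_vector_derivative (- b t * g x) *\<^sub>R d) (at t)"
        unfolding \<phi>_def has_real_derivative_iff_has_vector_derivative
        by (rule bounded_linear.has_vector_derivative[OF bounded_linear_scaleR_left])
    qed
    have "AE t in lebesgue_on ?I. inner_L2 (u t) (\<lambda>x. vector_derivative (\<lambda>s. \<phi> s x) (at t)) +
            inner_L2 (\<lambda>x. tensor (u t x) (u t x)) (grad (\<phi> t)) = - (b t * F t)"
    proof -
      have Feq': "AE t in lebesgue_on ?I. inner_L2 (u t) (\<lambda>x. g x *\<^sub>R d) = F t"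
        unfolding AE_restrict_space_iff[OF Il] AE_completion_iff by (rule Feq)
      show ?thesis using flux Feq'
      proof eventually_elim
        case (elim t)
        have tr: "(\<lambda>x. flat \<kappa> 0 (a - t) * g x) \<in> trig" by (rule trig_cmult[OF g])
        have c: "partial i (\<lambda>x. flat \<kappa> 0 (a - t) * g x) x = flat \<kappa> 0 (a - t) * partial i g x" for i x
          by (rule c1_grad_partial[OF c1_grad_cmult[OF trig_c1_grad[OF g]]])
        have "\<forall>x. (\<Sum>j\<in>UNIV. partial j (\<lambda>x. flat \<kappa> 0 (a - t) * g x) x * d $ j) = 0"
          using d by (simp add: c mult.assoc sum_distrib_left[symmetric])
        then have "inner_L2 (\<lambda>x. tensor (u t x) (u t x)) (grad (\<phi> t)) = 0"
          using elim(1) tr unfolding \<phi>_def[abs_def] by blast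
        then show ?case using elim(2) unfolding vd inner_L2_scaleR_right by simp
      qed
    qed
    moreover have "inner_L2 u\<^sub>0 (\<phi> 0) = flat \<kappa> 0 a * F0"
      unfolding \<phi>_def[abs_def] inner_L2_scaleR_right F0_def by simp
    ultimately
    have main: "(\<integral>t. indicator ?I t * - (b t * F t) \<partial>lborel) = - (flat \<kappa> 0 a * F0)"
      using integral_lebesgue_on_eq[of ?I "\<lambda>t. - (b t * F t)"] eq by simp
    have iI: "integrable lborel (\<lambda>t. indicator ?I t * c)" for c :: real
      using T by (intro integrable_mult_left integrable_real_indicator) auto
    have i1: "integrable lborel (\<lambda>t. indicator ?I t * - (b t * F t))"
    proof (rule Bochner_Integration.integrable_bound[OF iI[of "B"]])
      show "AE t in lborel. norm (indicator ?I t * - (b t * F t)) \<le> norm (indicator ?I t * B)"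
        using Fb
      proof eventually_elim
        case (elim t)
        show ?case
        proof (cases "t \<in> ?I")
          case True
          then have "\<bar>b t * F t\<bar> \<le> 1 * B" unfolding abs_mult using elim bb[of t]
            by (intro mult_mono) (auto simp: B_def)
          then show ?thesis using True by simp
        qed simp
      qed
    qed measurable
    have i2: "integrable lborel (\<lambda>t. indicator ?I t * b t)"
      by (rule Bochner_Integration.integrable_bound[OF iI[of 1]]) (use bb in \<open>auto simp: indicator_def\<close>)
    \<comment> \<open>the constant \<open>F0\<close> satisfies the same identity as \<open>F\<close>\<close>
    have ftc: "(\<integral>t. indicator ?I t * b t \<partial>lborel) = flat \<kappa> 0 a"
    proof -
      have "(\<integral>t. indicator ?I t * b t \<partial>lborel) = (\<integral>t. b t * indicator {0..T} t \<partial>lborel)"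
      proof (rule integral_cong_AE)
        show "AE t in lborel. indicator ?I t * b t = b t * indicator {0..T} t"
          using AE_lborel_singleton[of 0] AE_lborel_singleton[of T]
            by eventually_elim (auto simp: indicator_def)
      qed measurable
      also have "\<dots> = - flat \<kappa> 0 (a - T) - - flat \<kappa> 0 (a - 0)"
      proof (rule integral_FTC_Icc_real)
        fix t
        have "((\<lambda>s. - flat \<kappa> 0 (a - s)) has_real_derivative - (dflat \<kappa> 0 (a - t) * (0 - 1))) (at t)"
          by (intro DERIV_minus DERIV_chain2[OF flat_derivative[OF \<kappa>]])
              (auto intro!: derivative_eq_intros)
        then show "((\<lambda>s. - flat \<kappa> 0 (a - s)) has_real_derivative b t) (at t)" by (simp add: b_def)
        show "isCont b t" using bc by (simp add: continuous_on_eq_continuous_at)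
      qed (use T in auto)
      also have "\<dots> = flat \<kappa> 0 a" using a by (simp add: flat_def)
      finally show ?thesis .
    qed
    have "(\<integral>t. dflat \<kappa> 0 (a - t) * f t \<partial>lborel) =
        (\<integral>t. - (indicator ?I t * - (b t * F t)) - F0 * (indicator ?I t * b t) \<partial>lborel)"
      by (rule Bochner_Integration.integral_cong) (auto simp: f_def b_def[symmetric] algebra_simps)
    also have "\<dots> = - (\<integral>t. indicator ?I t * - (b t * F t) \<partial>lborel) - F0 *
        (\<integral>t. indicator ?I t * b t \<partial>lborel)"
      using i1 i2 by (subst Bochner_Integration.integral_diff) auto
    also have "\<dots> = 0" unfolding main ftc by simp
    finally show "(\<integral>t. dflat \<kappa> 0 (a - t) * f t \<partial>lborel) = 0" .
  qed
  with Feq have "AE t in lborel. t \<in> ?I \<longrightarrow> inner_L2 (u t) (\<lambda>x. g x *\<^sub>R d) = F0"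
    by eventually_elim (auto simp: f_def)
  then show ?thesis unfolding AE_restrict_space_iff[OF Il] AE_completion_iff F0_def .
qed

section \<open>A solenoidal field is determined by its solenoidal modes\<close>

text \<open>
  For \<open>k \<noteq> 0\<close> the vector \<open>v\<close> of coefficients of \<open>W\<close> at the wave vector \<open>k\<close> is parallel to \<open>k\<close> by the
  hypothesis on solenoidal modes and orthogonal to \<open>k\<close> by the vanishing divergence.  The phases \<open>0\<close> and \<open>- \<pi>/2\<close> give the cosine and the
  sine at \<open>k\<close>.
\<close>

lemma trig_orthogonal_zero:
  assumes Wm [measurable]: "\<And>i. W i \<in> borel_measurable borel" and Wp: "\<And>i. periodic (W i)"
      and Wi: "\<And>i. integrable tor (W i)"
    and div: "\<And>g. g \<in> trig \<Longrightarrow> (\<Sum>i\<in>UNIV. \<integral>x. partial i g x * W i x \<partial>tor) = 0"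
    and modes: "\<And>k j b. k \<in> lattice \<Longrightarrow> b \<in> {0, - (pi / 2)} \<Longrightarrow>
        (\<Sum>i\<in>UNIV. (\<integral>x. wave 1 k b x * W i x \<partial>tor) * cross3 k (axis j 1) $ i) = 0"
    and mean: "\<And>i. (\<integral>x. W i x \<partial>tor) = 0"
  shows "AE x in tor. \<forall>i. W i x = 0"
proof -
  have iw: "integrable tor (\<lambda>x. wave c k b x * W i x)" if "k \<in> lattice" for c k b i
    by (rule integrable_trig_mult[OF trig_wave[OF that] Wi])
  have base: "(\<integral>x. wave 1 k b x * W i x \<partial>tor) = 0" if k: "k \<in> lattice" and b: "b \<in> {0, - (pi / 2)}"
      for k b i
  proof (cases "k = 0")
    case True
    have "(\<integral>x. wave 1 k b x * W i x \<partial>tor) = cos b * (\<integral>x. W i x \<partial>tor)" by (simp add: True wave_def)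
    then show ?thesis using mean by simp
  next
    case False
    define v where "v = (\<chi> i. \<integral>x. wave 1 k b x * W i x \<partial>tor)"
    have "v \<bullet> cross3 k (axis j 1) = 0" for j
      using modes[OF k b, of j] by (simp add: v_def inner_vec_def)
    then have "cross3 v k $ j = 0" for j
      by (metis cross_triple inner_axis inner_commute inner_real_def mult.right_neutral)
    then have "cross3 v k = 0" by (simp add: vec_eq_iff[of "cross3 v k" 0])
    then have cr: "cross3 k v = 0" using cross_skew[of k v] by simp
    have "(\<Sum>i\<in>UNIV. \<integral>x. partial i (wave 1 k (b - pi/2)) x * W i x \<partial>tor) = 0"
      by (rule div[OF trig_wave[OF k]])
    then have "(\<Sum>i\<in>UNIV. \<integral>x. 2 * pi * k $ i * (wave 1 k b x * W i x) \<partial>tor) = 0"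
      by (simp add: c1_grad_partial[OF c1_grad_wave] wave_def mult.assoc)
    then have "2 * pi * (\<Sum>i\<in>UNIV. k $ i * v $ i) = 0" by (simp add: v_def sum_distrib_left mult.assoc)
    then have "k \<bullet> v = 0" by (simp add: inner_vec_def)
    with cr False have "v = 0" using norm_and_cross_eq_0[of k v] by blast
    then have "v $ i = 0" by simp
    then show ?thesis by (simp add: v_def)
  qed
  have all: "(\<integral>x. g x * W i x \<partial>tor) = 0" if "g \<in> trig" for g i
    using that
  proof (induction rule: trig.induct)
    case (trig_wave k c b)
    have "wave c k b x = c * cos b * wave 1 k 0 x - c * sin b * wave 1 k (- (pi/2)) x" for x
      by (simp add: wave_def cos_add cos_diff algebra_simps)
    then have "(\<integral>x. wave c k b x * W i x \<partial>tor) =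
        (\<integral>x. c * cos b * (wave 1 k 0 x * W i x) - c * sin b * (wave 1 k (- (pi/2)) x * W i x) \<partial>tor)"
      by (simp only: left_diff_distrib mult.assoc)
    also have "\<dots> = 0" using iw[OF trig_wave] base[OF trig_wave] by simp
    finally show ?case .
  next
    case (trig_add f g)
    then show ?case using integrable_trig_mult[OF trig_add.hyps(1) Wi]
        integrable_trig_mult[OF trig_add.hyps(2) Wi]
      by (simp add: distrib_right)
  qed
  have "AE x in tor. W i x = 0" for i
    by (rule AE_eq_0_if_conv_eq_0[OF Wm Wp Wi]) (simp add: conv_def all[OF trig_shift[OF kern_trig]])
  then show ?thesis by (simp add: AE_all_countable)
qed

lemma wave_div_free: "(\<Sum>i\<in>UNIV. partial i (wave c k b) x * cross3 k (axis j 1) $ i) = 0"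
proof -
  have "(\<Sum>i\<in>UNIV. partial i (wave c k b) x * cross3 k (axis j 1) $ i) =
      2 * pi * wave c k (b + pi/2) x * (k \<bullet> cross3 k (axis j 1))"
    unfolding inner_vec_def[of k "cross3 k (axis j 1)"]
    by (simp add: c1_grad_partial[OF c1_grad_wave] wave_def sum_distrib_left sum_distrib_right mult_ac)
  then show ?thesis by (simp add: dot_cross_self)
qed

lemma norm_L2_eq_if_modes_eq:
  assumes v: "v \<in> solenoidal_L2" and w: "w \<in> solenoidal_L2"
    and modes: "\<And>k j b. k \<in> lattice \<Longrightarrow> b \<in> {0, - (pi / 2)} \<Longrightarrow>
        inner_L2 v (\<lambda>x. wave 1 k b x *\<^sub>R cross3 k (axis j 1)) =
        inner_L2 w (\<lambda>x. wave 1 k b x *\<^sub>R cross3 k (axis j 1))"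
    and mean: "\<And>j. inner_L2 v (\<lambda>x. 1 *\<^sub>R axis j 1) = inner_L2 w (\<lambda>x. 1 *\<^sub>R axis j 1)"
  shows "norm_L2 v = norm_L2 w"
proof -
  have vL: "v \<in> L2_torus" and wL: "w \<in> L2_torus" using v w by (auto simp: solenoidal_L2_def)
  have [measurable]: "v \<in> borel_measurable lebesgue" "w \<in> borel_measurable lebesgue" using vL wL
    by (auto simp: L2_torus_def)
  obtain p where pm [measurable]: "\<And>i. p i \<in> borel_measurable borel" and pp: "\<And>i. periodic (p i)"
      and pae: "AE x in lborel. \<forall>i. v x $ i = p i x" and p2: "\<And>i. integrable tor (\<lambda>x. (p i x)\<^sup>2)"
    by (rule L2_component_rep[OF vL]) blast
  obtain q where qm [measurable]: "\<And>i. q i \<in> borel_measurable borel" and qp: "\<And>i. periodic (q i)"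
      and qae: "AE x in lborel. \<forall>i. w x $ i = q i x" and q2: "\<And>i. integrable tor (\<lambda>x. (q i x)\<^sup>2)"
    by (rule L2_component_rep[OF wL]) blast
  have pi: "integrable tor (p i)" and qi: "integrable tor (q i)" for i
    by (rule integrable_from_square[OF pm p2], rule integrable_from_square[OF qm q2])
  have diff: "(\<integral>x. g x * (p i x - q i x) \<partial>tor) = (\<integral>x. g x * p i x \<partial>tor) - (\<integral>x. g x * q i x \<partial>tor)"
      if "g \<in> trig" for g i
    using integrable_trig_mult[OF that pi] integrable_trig_mult[OF that qi]
      by (simp add: right_diff_distrib)
  have inner: "inner_L2 v (\<lambda>x. g x *\<^sub>R d) = (\<Sum>i\<in>UNIV. (\<integral>x. g x * p i x \<partial>tor) * d $ i)"
       "inner_L2 w (\<lambda>x. g x *\<^sub>R d) = (\<Sum>i\<in>UNIV. (\<integral>x. g x * q i x \<partial>tor) * d $ i)" if g: "g \<in> trig" for g d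
  proof -
    note [measurable] = trig_measurable[OF g]
    have "inner_L2 v (\<lambda>x. g x *\<^sub>R d) = (\<integral>x. (\<Sum>i\<in>UNIV. p i x * (g x * d $ i)) \<partial>tor)"
      by (rule inner_L2_rep) (use pae in auto)
    also have "\<dots> = (\<integral>x. (\<Sum>i\<in>UNIV. g x * p i x * d $ i) \<partial>tor)" by (simp add: mult_ac)
    finally show "inner_L2 v (\<lambda>x. g x *\<^sub>R d) = (\<Sum>i\<in>UNIV. (\<integral>x. g x * p i x \<partial>tor) * d $ i)"
      using integrable_trig_mult[OF g pi] by simp
    have "inner_L2 w (\<lambda>x. g x *\<^sub>R d) = (\<integral>x. (\<Sum>i\<in>UNIV. q i x * (g x * d $ i)) \<partial>tor)"
      by (rule inner_L2_rep) (use qae in auto)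
    also have "\<dots> = (\<integral>x. (\<Sum>i\<in>UNIV. g x * q i x * d $ i) \<partial>tor)" by (simp add: mult_ac)
    finally show "inner_L2 w (\<lambda>x. g x *\<^sub>R d) = (\<Sum>i\<in>UNIV. (\<integral>x. g x * q i x \<partial>tor) * d $ i)"
      using integrable_trig_mult[OF g qi] by simp
  qed
  have "AE x in tor. \<forall>i. p i x - q i x = 0"
  proof (rule trig_orthogonal_zero)
    show "periodic (\<lambda>x. p i x - q i x)" for i using pp qp by (simp add: periodic_def)
    show "integrable tor (\<lambda>x. p i x - q i x)" for i using pi qi by auto
    show "(\<Sum>i\<in>UNIV. \<integral>x. partial i g x * (p i x - q i x) \<partial>tor) = 0" if g: "g \<in> trig" for g
      using solenoidal_weak_div[OF v pm pae p2 g] solenoidal_weak_div[OF w qm qae q2 g]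
      by (simp add: diff[OF trig_partial[OF g]] sum_subtractf)
    show "(\<Sum>i\<in>UNIV. (\<integral>x. wave 1 k b x * (p i x - q i x) \<partial>tor) * cross3 k (axis j 1) $ i) = 0"
      if k: "k \<in> lattice" and b: "b \<in> {0, - (pi / 2)}" for k j b
      using modes[OF k b, of j] inner[OF trig_wave[OF k], of 1 b "cross3 k (axis j 1)"]
      by (simp add: diff[OF trig_wave[OF k]] left_diff_distrib sum_subtractf)
    show "(\<integral>x. p i x - q i x \<partial>tor) = 0" for i
      using mean[of i] inner[OF trig_const[of 1], of "axis i 1"] pi qi by (simp add: sum_mult_axis)
  qed measurable
  then have ae: "AE x in tor. \<forall>i. p i x = q i x" by simp
  have vn: "(LINT x|torus. (norm (v x))\<^sup>2) = (\<integral>x. (\<Sum>i\<in>UNIV. (p i x)\<^sup>2) \<partial>tor)"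
  proof (rule integral_torus_eq(1))
    show "AE x in lborel. (norm (v x))\<^sup>2 = (\<Sum>i\<in>UNIV. (p i x)\<^sup>2)"
      using pae unfolding power2_norm_eq_inner inner_vec_def
        by eventually_elim (simp add: power2_eq_square)
  qed measurable
  have wn: "(LINT x|torus. (norm (w x))\<^sup>2) = (\<integral>x. (\<Sum>i\<in>UNIV. (q i x)\<^sup>2) \<partial>tor)"
  proof (rule integral_torus_eq(1))
    show "AE x in lborel. (norm (w x))\<^sup>2 = (\<Sum>i\<in>UNIV. (q i x)\<^sup>2)"
      using qae unfolding power2_norm_eq_inner inner_vec_def
        by eventually_elim (simp add: power2_eq_square)
  qed measurable
  have "(\<integral>x. (\<Sum>i\<in>UNIV. (p i x)\<^sup>2) \<partial>tor) = (\<integral>x. (\<Sum>i\<in>UNIV. (q i x)\<^sup>2) \<partial>tor)"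
    by (rule integral_cong_AE) (use ae in \<open>auto elim!: eventually_mono\<close>)
  then show ?thesis by (simp add: norm_L2_def vn wn)
qed

theorem theorem1p3:
  fixes T :: real
    and u\<^sub>0 :: "real^3 \<Rightarrow> real^3"
    and u :: "real \<Rightarrow> real^3 \<Rightarrow> real^3"
    and lam :: "real \<Rightarrow> real^3 \<Rightarrow> real"
  assumes "T > 0"
    and "u\<^sub>0 \<in> solenoidal_L2"
    and "weak_euler_solution T u\<^sub>0 u"
    and "beltrami_field T u lam"
    and "(\<exists>\<tau> \<beta>. 1/2 < \<tau> \<and> \<tau> \<le> 3/2 \<and> \<beta> > 5 / (2 * \<tau> - 1) \<and>
                lam \<in> bochner_Lq T \<beta> (sobolev \<tau>) (sobolev_norm \<tau>)) \<or>
         (\<exists>\<tau>>3/2. lam \<in> bochner_Lq T (5/2) (sobolev \<tau>) (sobolev_norm \<tau>))"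
  shows "AE t in lebesgue_on {0..T}. norm_L2 (u t) = norm_L2 u\<^sub>0"
proof -
  let ?I = "{0<..<T}"
  have "\<exists>\<tau>>1/2. AE t in lebesgue_on ?I. lam t \<in> sobolev \<tau>"
    using assms(5)
  proof (elim disjE exE conjE)
    fix \<tau> \<beta> assume "1/2 < \<tau>" "lam \<in> bochner_Lq T \<beta> (sobolev \<tau>) (sobolev_norm \<tau>)"
    then show ?thesis by (intro exI[of _ \<tau>]) (simp add: bochner_Lq_def)
  next
    fix \<tau> assume "3/2 < \<tau>" "lam \<in> bochner_Lq T (5/2) (sobolev \<tau>) (sobolev_norm \<tau>)"
    then show ?thesis by (intro exI[of _ \<tau>]) (simp add: bochner_Lq_def)
  qed
  then obtain \<tau> where \<tau>: "\<tau> > 1/2" and lam: "AE t in lebesgue_on ?I. lam t \<in> sobolev \<tau>" by blast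
  have sol: "AE t in lebesgue_on ?I. u t \<in> solenoidal_L2"
    using assms(3) by (simp add: weak_euler_solution_def bochner_Linf_def)
  have curl: "AE t in lebesgue_on ?I. weak_curl (u t) (\<lambda>x. lam t x *\<^sub>R u t x)"
    using assms(4) by (simp add: beltrami_field_def)
  have flux: "AE t in lebesgue_on ?I. \<forall>g\<in>trig. \<forall>d. (\<forall>x. (\<Sum>j\<in>UNIV. partial j g x * d $ j) = 0) \<longrightarrow>
                 inner_L2 (\<lambda>x. tensor (u t x) (u t x)) (grad (\<lambda>x. g x *\<^sub>R d)) = 0"
    using sol curl lam
  proof eventually_elim
    case (elim t)
    show ?case by (intro ballI allI impI beltrami_flux_zero[OF elim(1,2) \<tau> elim(3)]) auto
  qed
  note const = modes_constant[OF assms(1,3) flux]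
  have mean: "AE t in lebesgue_on ?I. \<forall>j. inner_L2 (u t) (\<lambda>x. 1 *\<^sub>R axis j 1) =
      inner_L2 u\<^sub>0 (\<lambda>x. 1 *\<^sub>R axis j 1)"
    unfolding AE_all_countable
  proof
    fix j
    show "AE t in lebesgue_on ?I. inner_L2 (u t) (\<lambda>x. 1 *\<^sub>R axis j 1) =
        inner_L2 u\<^sub>0 (\<lambda>x. 1 *\<^sub>R axis j 1)"
      by (rule const[OF trig_const]) (simp add: c1_grad_partial[OF c1_grad_const])
  qed
  have modes: "AE t in lebesgue_on ?I. \<forall>k\<in>lattice. \<forall>j. \<forall>b\<in>{0, - (pi / 2)}.
      inner_L2 (u t) (\<lambda>x. wave 1 k b x *\<^sub>R cross3 k (axis j 1)) =
          inner_L2 u\<^sub>0 (\<lambda>x. wave 1 k b x *\<^sub>R cross3 k (axis j 1))"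
  proof -
    have fin: "countable {0, - (pi / 2)}" by simp
    show ?thesis
      unfolding AE_ball_countable[OF countable_lattice] AE_all_countable AE_ball_countable[OF fin]
      by (intro ballI allI const trig_wave wave_div_free)
  qed
  have "AE t in lebesgue_on ?I. norm_L2 (u t) = norm_L2 u\<^sub>0"
    using sol mean modes
  proof eventually_elim
    case (elim t)
    then show ?case by (intro norm_L2_eq_if_modes_eq assms(2)) auto
  qed
  then have "AE t in lborel. t \<in> ?I \<longrightarrow> norm_L2 (u t) = norm_L2 u\<^sub>0"
    by (subst (asm) AE_restrict_space_iff) (auto simp: AE_completion_iff)
  then have "AE t in lborel. t \<in> {0..T} \<longrightarrow> norm_L2 (u t) = norm_L2 u\<^sub>0"
    using AE_lborel_singleton[of 0] AE_lborel_singleton[of T] by eventually_elim auto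
  then show ?thesis
    by (subst AE_restrict_space_iff) (auto simp: AE_completion_iff)
qed

end
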